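(* Let $(M,\boldsymbol{c})$ be a conformal manifold of dimension $n\ge3$ and $\gamma\hookrightarrow M$ a curve (an embedded one-dimensional submanifold). Then $\gamma$ is an unparametrised conformal circle if, and only if, its tractor second fundamental form $\mathbb{L}$ vanishes; equivalently, if and only if any one of the following holds: (a) $\nabla_i\mathrm{N}^A_B=0$; (b) $\nabla_iN_{A_1\cdots A_{n-1}}=0$; (c) $\nabla_i\star N^{A_1A_2A_3}=0$. In particular, $\mathbb{L}=0$ if and only if $\mu=0$, where $\mu$ is the conformal curvature of $\gamma$.
   Context: Conformal tractors. $(M,\boldsymbol{c})$ is a smooth connected oriented $n$-manifold with a class $\boldsymbol{c}$ of conformally related Riemannian metrics. Sections of the density bundle $\mathcal{E}[w]$ are classes of pairs $(g,f)\sim(\Omega^2g,\Omega^wf)$; $\mathcal{B}[w]:=\mathcal{B}\otimes\mathcal{E}[w]$; the conformal metric $\boldsymbol{g}\in\Gamma(S^2T^*M[2])$ is the class of $(g,g)$ and raises and lowers indices. For $g\in\boldsymbol{c}$, $\nabla$ is the Levi-Civita connection, $(\nabla_a\nabla_b-\nabla_b\nabla_a)v^c=R_{ab}{}^c{}_dv^d$, $R_{ab}=R_{ca}{}^c{}_b$, and $P_{ab}$ (Schouten) is defined by $R_{ab}=(n-2)P_{ab}+J\boldsymbol{g}_{ab}$, $J=\boldsymbol{g}^{ab}P_{ab}$. The standard tractor bundle $\mathcal{T}$ is identified by $g\in\boldsymbol{c}$ with $\mathcal{E}[1]\oplus T^*M[1]\oplus\mathcal{E}[-1]$, $V=(\sigma,\mu_a,\rho)$;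 for $\hat g=\Omega^2g$, $\Upsilon_a=\Omega^{-1}\nabla_a\Omega$, the triple becomes $(\sigma,\mu_a+\Upsilon_a\sigma,\rho-\Upsilon^b\mu_b-\tfrac12\Upsilon^b\Upsilon_b\sigma)$. The invariant tractor metric is $h(V,V)=2\sigma\rho+\boldsymbol{g}^{ab}\mu_a\mu_b$ and the invariant tractor connection is $\nabla_a(\sigma,\mu_b,\rho)=(\nabla_a\sigma-\mu_a,\ \nabla_a\mu_b+P_{ab}\sigma+\boldsymbol{g}_{ab}\rho,\ \nabla_a\rho-P_{ab}\mu^b)$. The tractor volume form $\varepsilon$ is the parallel section of $\Lambda^{n+2}\mathcal{T}^*$ given by the orientation with $\varepsilon^{A_1\cdots A_{n+2}}\varepsilon_{A_1\cdots A_{n+2}}=-(n+2)!$, and $\star\Psi_{B_1\cdots B_{n+2-k}}=\frac1{k!}\varepsilon^{A_1\cdots A_k}{}_{B_1\cdots B_{n+2-k}}\Psi_{A_1\cdots A_k}$. Submanifold objects (here for the oriented submanifold $\gamma$, $m=1$, codimension $d=n-1$). Index $i$ refers to $T\gamma$; $\nabla_i$ is the pullback to $\gamma$ of the ambient Levi-Civita or tractor connection; $\mathrm{N}^a_b$ is the orthogonal projection onto the normal bundle; $P_i{}^b$ is $P_a{}^b$ restricted to $T\gamma$ in the first index. For $g\in\boldsymbol{c}$, $H^c=\boldsymbol{g}^{ij}I\!I_{ij}{}^c$ is the mean curvature ($I\!I$ the second fundamental form). The normal tractor bundle $\mathcal{N}\subset\mathcal{T}|_\gamma$ is the image of $N\gamma[-1]$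 under the invariant map $n^a\mapsto(0,n_a,n_cH^c)$; $\mathrm{N}^A_B$ is the orthogonal projection onto $\mathcal{N}$; the tractor second fundamental form is $\mathbb{L}_i{}^C(V)=\mathrm{N}^C_A\nabla_iV^A$ for $V\in\Gamma(\mathcal{N}^\perp)$ (where $\mathcal{N}^\perp$ is identified with the tractor bundle $\mathcal{T}\gamma$). $N_{A_1\cdots A_{n-1}}$ is the section of $\Lambda^{n-1}\mathcal{N}^*$ compatible with orientations with $N^{A_1\cdots A_{n-1}}N_{A_1\cdots A_{n-1}}=(n-1)!$. The conformal curvature of $\gamma$ is $\mu_i{}^c:=\mathrm{N}^c_b(P_i{}^b-\nabla_iH^b)$, which is independent of $g\in\boldsymbol{c}$. Conformal circles. For a regular parametrised curve with velocity $u^b$, acceleration $a^b=u^c\nabla_cu^b$ and $u^2=u_cu^c$ (with respect to some $g\in\boldsymbol{c}$), the projectively parametrised conformal circle equation is the conformally invariant equation $$u^c\nabla_ca^b=u^2u^cP_c{}^b+3u^{-2}(u_ca^c)a^b-\tfrac32u^{-2}(a_ca^c)u^b-2u^cu^dP_{cd}u^b .$$ A curve is an unparametrised conformal circle if the component of this equation normal to the curve holds (a condition independent of the parametrisation). *)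

theory Defs
  imports "HOL-Analysis.Analysis"
begin

section \<open>Smooth maps\<close>

primrec ck_on :: "nat \<Rightarrow> 'x::euclidean_space set \<Rightarrow> ('x \<Rightarrow> 'y::real_normed_vector) \<Rightarrow> bool" where
  "ck_on 0 S f \<longleftrightarrow> continuous_on S f"
| "ck_on (Suc k) S f \<longleftrightarrow> (\<forall>x\<in>S. f differentiable (at x)) \<and>
     (\<forall>v. ck_on k S (\<lambda>x. frechet_derivative f (at x) v))"

text \<open>Only used for open sets \<open>S\<close>.\<close>

definition smooth_on :: "'x::euclidean_space set \<Rightarrow> ('x \<Rightarrow> 'y::real_normed_vector) \<Rightarrow> bool" where
  "smooth_on S f \<longleftrightarrow> (\<forall>k. ck_on k S f)"

definition pderiv_at :: "'n::finite \<Rightarrow> (real^'n \<Rightarrow> real) \<Rightarrow> real^'n \<Rightarrow> real" where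
  "pderiv_at a f x = frechet_derivative f (at x) (axis a 1)"


section \<open>Oriented manifolds and conformal classes\<close>

text \<open>
  The manifold is the whole of a Hausdorff second countable type \<open>'a\<close>, its dimension is
  \<open>CARD('n)\<close>, and its smooth structure and orientation are given by an oriented atlas.
  Charts are pairs of a domain and a coordinate map.  Tensor fields are given by their components
  in each chart.
\<close>

type_synonym ('a, 'n) chart = "'a set \<times> ('a \<Rightarrow> real^'n)"
type_synonym ('a, 'n) metric = "('a, 'n) chart \<Rightarrow> real^'n \<Rightarrow> real^'n^'n"

definition coord_region :: "('a, 'n::finite) chart \<Rightarrow> (real^'n) set" where
  "coord_region \<kappa> = snd \<kappa> ` fst \<kappa>"

definition chart_inv :: "('a, 'n::finite) chart \<Rightarrow> real^'n \<Rightarrow> 'a" where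
  "chart_inv \<kappa> = inv_into (fst \<kappa>) (snd \<kappa>)"

definition overlap :: "('a, 'n::finite) chart \<Rightarrow> ('a, 'n) chart \<Rightarrow> (real^'n) set" where
  "overlap \<kappa> \<kappa>' = snd \<kappa> ` (fst \<kappa> \<inter> fst \<kappa>')"

definition transition :: "('a, 'n::finite) chart \<Rightarrow> ('a, 'n) chart \<Rightarrow> real^'n \<Rightarrow> real^'n" where
  "transition \<kappa> \<kappa>' = snd \<kappa>' \<circ> chart_inv \<kappa>"

definition jacobian :: "('a, 'n::finite) chart \<Rightarrow> ('a, 'n) chart \<Rightarrow> real^'n \<Rightarrow> real^'n^'n" where
  "jacobian \<kappa> \<kappa>' x = matrix (frechet_derivative (transition \<kappa> \<kappa>') (at x))"

definition oriented_atlas :: "('a::topological_space, 'n::finite) chart set \<Rightarrow> bool" where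
  "oriented_atlas A \<longleftrightarrow>
     (\<Union>\<kappa>\<in>A. fst \<kappa>) = UNIV \<and>
     (\<forall>\<kappa>\<in>A. open (fst \<kappa>) \<and> open (coord_region \<kappa>) \<and>
        homeomorphism (fst \<kappa>) (coord_region \<kappa>) (snd \<kappa>) (chart_inv \<kappa>)) \<and>
     (\<forall>\<kappa>\<in>A. \<forall>\<kappa>'\<in>A. smooth_on (overlap \<kappa> \<kappa>') (transition \<kappa> \<kappa>') \<and>
        (\<forall>x\<in>overlap \<kappa> \<kappa>'. det (jacobian \<kappa> \<kappa>' x) > 0))"

definition riemannian_metric :: "('a, 'n::finite) chart set \<Rightarrow> ('a, 'n) metric \<Rightarrow> bool" where
  "riemannian_metric A g \<longleftrightarrow>
     (\<forall>\<kappa>\<in>A. smooth_on (coord_region \<kappa>) (g \<kappa>) \<and>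
        (\<forall>x\<in>coord_region \<kappa>. transpose (g \<kappa> x) = g \<kappa> x \<and>
           (\<forall>v. v \<noteq> 0 \<longrightarrow> v \<bullet> (g \<kappa> x *v v) > 0))) \<and>
     (\<forall>\<kappa>\<in>A. \<forall>\<kappa>'\<in>A. \<forall>x\<in>overlap \<kappa> \<kappa>'.
        g \<kappa> x = transpose (jacobian \<kappa> \<kappa>' x) ** g \<kappa>' (transition \<kappa> \<kappa>' x) ** jacobian \<kappa> \<kappa>' x)"

definition conformal_factor :: "('a, 'n::finite) chart set \<Rightarrow> ('a \<Rightarrow> real) \<Rightarrow> bool" where
  "conformal_factor A \<Omega> \<longleftrightarrow>
     (\<forall>p. \<Omega> p > 0) \<and> (\<forall>\<kappa>\<in>A. smooth_on (coord_region \<kappa>) (\<Omega> \<circ> chart_inv \<kappa>))"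

text \<open>\<open>g' = \<Omega>\<^sup>2 g\<close>\<close>

definition rescaled_by ::
  "('a, 'n::finite) chart set \<Rightarrow> ('a \<Rightarrow> real) \<Rightarrow> ('a, 'n) metric \<Rightarrow> ('a, 'n) metric \<Rightarrow> bool" where
  "rescaled_by A \<Omega> g g' \<longleftrightarrow> conformal_factor A \<Omega> \<and>
     (\<forall>\<kappa>\<in>A. \<forall>x\<in>coord_region \<kappa>. g' \<kappa> x = (\<Omega> (chart_inv \<kappa> x))\<^sup>2 *\<^sub>R g \<kappa> x)"

definition conformal_rel ::
  "('a, 'n::finite) chart set \<Rightarrow> (('a, 'n) metric \<times> ('a, 'n) metric) set" where
  "conformal_rel A = {(g, g'). riemannian_metric A g \<and> riemannian_metric A g' \<and>
     (\<exists>\<Omega>. rescaled_by A \<Omega> g g')}"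

definition conformal_class :: "('a, 'n::finite) chart set \<Rightarrow> ('a, 'n) metric set \<Rightarrow> bool" where
  "conformal_class A C \<longleftrightarrow> C \<in> {g. riemannian_metric A g} // conformal_rel A"


section \<open>Oriented embedded curves\<close>

text \<open>
  An embedded one-dimensional submanifold \<open>\<gamma>\<close> with an orientation, presented by a set \<open>\<Gamma>\<close> of
  positively oriented local parametrisations \<open>(I, c)\<close> that covers \<open>\<gamma>\<close>.  \<open>\<Gamma>\<close> need not be maximal.
\<close>

type_synonym 'a param = "real set \<times> (real \<Rightarrow> 'a)"

definition param_domain :: "('a, 'n::finite) chart \<Rightarrow> 'a param \<Rightarrow> real set" where
  "param_domain \<kappa> \<pi> = {t \<in> fst \<pi>. snd \<pi> t \<in> fst \<kappa>}"

definition coord_curve :: "('a, 'n::finite) chart \<Rightarrow> 'a param \<Rightarrow> real \<Rightarrow> real^'n" where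
  "coord_curve \<kappa> \<pi> = snd \<kappa> \<circ> snd \<pi>"

definition velocity :: "(real \<Rightarrow> real^'n::finite) \<Rightarrow> real \<Rightarrow> real^'n" where
  "velocity x t = vector_derivative x (at t)"

definition local_param ::
  "('a::topological_space, 'n::finite) chart set \<Rightarrow> 'a set \<Rightarrow> 'a param \<Rightarrow> bool" where
  "local_param A \<gamma> \<pi> \<longleftrightarrow>
     open (fst \<pi>) \<and> is_interval (fst \<pi>) \<and>
     openin (top_of_set \<gamma>) (snd \<pi> ` fst \<pi>) \<and>
     (\<exists>h. homeomorphism (fst \<pi>) (snd \<pi> ` fst \<pi>) (snd \<pi>) h) \<and>
     (\<forall>\<kappa>\<in>A. smooth_on (param_domain \<kappa> \<pi>) (coord_curve \<kappa> \<pi>) \<and>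
        (\<forall>t\<in>param_domain \<kappa> \<pi>. velocity (coord_curve \<kappa> \<pi>) t \<noteq> 0))"

definition oriented_embedded_curve ::
  "('a::topological_space, 'n::finite) chart set \<Rightarrow> 'a set \<Rightarrow> 'a param set \<Rightarrow> bool" where
  "oriented_embedded_curve A \<gamma> \<Gamma> \<longleftrightarrow>
     (\<forall>\<pi>\<in>\<Gamma>. local_param A \<gamma> \<pi>) \<and>
     (\<Union>\<pi>\<in>\<Gamma>. snd \<pi> ` fst \<pi>) = \<gamma> \<and>
     (\<forall>\<pi>\<in>\<Gamma>. \<forall>\<pi>'\<in>\<Gamma>. \<forall>\<kappa>\<in>A. \<forall>t\<in>param_domain \<kappa> \<pi>. \<forall>t'\<in>param_domain \<kappa> \<pi>'.
        snd \<pi> t = snd \<pi>' t' \<longrightarrow>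
        (\<exists>k>0. velocity (coord_curve \<kappa> \<pi>') t' = k *\<^sub>R velocity (coord_curve \<kappa> \<pi>) t))"


section \<open>Riemannian geometry in coordinates\<close>

text \<open>
  From here on \<open>G\<close> is the component matrix \<open>g \<kappa>\<close> of a metric in a chart, as a function of the
  coordinates, and \<open>x\<close> is the coordinate expression of a parametrised curve.  For \<open>g\<close> in the
  conformal class, all weighted objects are given by their components in the trivialisation of
  the density bundles by \<open>g\<close>, so that the conformal metric has components \<open>G\<close> and covariant
  derivatives of densities are ordinary derivatives.
\<close>

definition bilin :: "real^'m^'m \<Rightarrow> real^'m \<Rightarrow> real^'m \<Rightarrow> real" where
  "bilin B v w = v \<bullet> (B *v w)"

text \<open>The orthogonal projection onto \<open>S\<close> for a bilinear form \<open>B\<close> that is nondegenerate on \<open>S\<close>.\<close>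

definition orth_proj :: "real^'m^'m \<Rightarrow> (real^'m) set \<Rightarrow> real^'m \<Rightarrow> real^'m" where
  "orth_proj B S v = (THE w. w \<in> S \<and> (\<forall>s\<in>S. bilin B (v - w) s = 0))"

text \<open>\<open>christoffel G y c a b\<close> is \<open>\<Gamma>\<^sup>c\<^sub>a\<^sub>b\<close> of the Levi-Civita connection.\<close>

definition christoffel :: "(real^'n \<Rightarrow> real^'n^'n::finite) \<Rightarrow> real^'n \<Rightarrow> 'n \<Rightarrow> 'n \<Rightarrow> 'n \<Rightarrow> real" where
  "christoffel G y c a b = (1/2) * (\<Sum>d\<in>UNIV. matrix_inv (G y) $ c $ d *
     (pderiv_at a (\<lambda>z. G z $ b $ d) y + pderiv_at b (\<lambda>z. G z $ a $ d) y
       - pderiv_at d (\<lambda>z. G z $ a $ b) y))"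

text \<open>\<open>riemann G y a b c d\<close> is \<open>R\<^sub>a\<^sub>b\<^sup>c\<^sub>d\<close>, where \<open>(\<nabla>\<^sub>a\<nabla>\<^sub>b - \<nabla>\<^sub>b\<nabla>\<^sub>a) v\<^sup>c = R\<^sub>a\<^sub>b\<^sup>c\<^sub>d v\<^sup>d\<close>;
  \<open>ricci\<close> is \<open>R\<^sub>a\<^sub>b = R\<^sub>c\<^sub>a\<^sup>c\<^sub>b\<close>.\<close>

definition riemann ::
  "(real^'n \<Rightarrow> real^'n^'n::finite) \<Rightarrow> real^'n \<Rightarrow> 'n \<Rightarrow> 'n \<Rightarrow> 'n \<Rightarrow> 'n \<Rightarrow> real" where
  "riemann G y a b c d =
     pderiv_at a (\<lambda>z. christoffel G z c b d) y - pderiv_at b (\<lambda>z. christoffel G z c a d) y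
     + (\<Sum>e\<in>UNIV. christoffel G y c a e * christoffel G y e b d
                - christoffel G y c b e * christoffel G y e a d)"

definition ricci :: "(real^'n \<Rightarrow> real^'n^'n::finite) \<Rightarrow> real^'n \<Rightarrow> 'n \<Rightarrow> 'n \<Rightarrow> real" where
  "ricci G y a b = (\<Sum>c\<in>UNIV. riemann G y c a c b)"

definition schouten :: "(real^'n \<Rightarrow> real^'n^'n::finite) \<Rightarrow> real^'n \<Rightarrow> real^'n^'n" where
  "schouten G y = (THE P. \<exists>J. J = (\<Sum>a\<in>UNIV. \<Sum>b\<in>UNIV. matrix_inv (G y) $ a $ b * P $ a $ b) \<and>
     (\<forall>a b. ricci G y a b = (real CARD('n) - 2) * P $ a $ b + J * G y $ a $ b))"

text \<open>\<open>schouten_endo G y w\<close> is \<open>w\<^sup>a P\<^sub>a\<^sup>b\<close>.\<close>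

definition schouten_endo :: "(real^'n \<Rightarrow> real^'n^'n::finite) \<Rightarrow> real^'n \<Rightarrow> real^'n \<Rightarrow> real^'n" where
  "schouten_endo G y w = (\<chi> b. \<Sum>a\<in>UNIV. \<Sum>c\<in>UNIV. w $ a * schouten G y $ a $ c * matrix_inv (G y) $ c $ b)"

text \<open>The covariant derivative \<open>u\<^sup>a\<nabla>\<^sub>a X\<^sup>c\<close> of a vector field \<open>X\<close> along the curve \<open>x\<close>.\<close>

definition cov_deriv ::
  "(real^'n \<Rightarrow> real^'n^'n::finite) \<Rightarrow> (real \<Rightarrow> real^'n) \<Rightarrow> (real \<Rightarrow> real^'n) \<Rightarrow> real \<Rightarrow> real^'n" where
  "cov_deriv G x X t = vector_derivative X (at t) +
     (\<chi> c. \<Sum>a\<in>UNIV. \<Sum>b\<in>UNIV. christoffel G (x t) c a b * velocity x t $ a * X t $ b)"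

definition acceleration ::
  "(real^'n \<Rightarrow> real^'n^'n::finite) \<Rightarrow> (real \<Rightarrow> real^'n) \<Rightarrow> real \<Rightarrow> real^'n" where
  "acceleration G x = cov_deriv G x (velocity x)"

definition normal_space ::
  "(real^'n \<Rightarrow> real^'n^'n::finite) \<Rightarrow> (real \<Rightarrow> real^'n) \<Rightarrow> real \<Rightarrow> (real^'n) set" where
  "normal_space G x t = {v. bilin (G (x t)) v (velocity x t) = 0}"

definition normal_proj ::
  "(real^'n \<Rightarrow> real^'n^'n::finite) \<Rightarrow> (real \<Rightarrow> real^'n) \<Rightarrow> real \<Rightarrow> real^'n \<Rightarrow> real^'n" where
  "normal_proj G x t = orth_proj (G (x t)) (normal_space G x t)"

text \<open>
  In the coordinate \<open>t\<close> of the curve, the only component of the second fundamental form is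
  \<open>II(u,u)\<close>, the normal part of the acceleration, and the induced metric is \<open>u\<^sup>2 dt\<^sup>2\<close>.
\<close>

definition second_fund_form ::
  "(real^'n \<Rightarrow> real^'n^'n::finite) \<Rightarrow> (real \<Rightarrow> real^'n) \<Rightarrow> real \<Rightarrow> real^'n" where
  "second_fund_form G x t = normal_proj G x t (acceleration G x t)"

definition mean_curvature ::
  "(real^'n \<Rightarrow> real^'n^'n::finite) \<Rightarrow> (real \<Rightarrow> real^'n) \<Rightarrow> real \<Rightarrow> real^'n" where
  "mean_curvature G x t =
     (1 / bilin (G (x t)) (velocity x t) (velocity x t)) *\<^sub>R second_fund_form G x t"

text \<open>The conformal curvature \<open>\<mu>\<^sub>i\<^sup>c\<close>, contracted with the velocity \<open>u\<^sup>i\<close>.\<close>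

definition conformal_curvature ::
  "(real^'n \<Rightarrow> real^'n^'n::finite) \<Rightarrow> (real \<Rightarrow> real^'n) \<Rightarrow> real \<Rightarrow> real^'n" where
  "conformal_curvature G x t = normal_proj G x t
     (schouten_endo G (x t) (velocity x t) - cov_deriv G x (mean_curvature G x) t)"

definition circle_defect ::
  "(real^'n \<Rightarrow> real^'n^'n::finite) \<Rightarrow> (real \<Rightarrow> real^'n) \<Rightarrow> real \<Rightarrow> real^'n" where
  "circle_defect G x t = (let
      u = velocity x t; a = acceleration G x t; ip = bilin (G (x t))
    in cov_deriv G x (acceleration G x) t
       - (ip u u *\<^sub>R schouten_endo G (x t) u + (3 * ip u a / ip u u) *\<^sub>R a
          - (3/2 * ip a a / ip u u) *\<^sub>R u - (2 * bilin (schouten G (x t)) u u) *\<^sub>R u))"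


section \<open>Tractors\<close>

text \<open>
  In a scale \<open>g\<close> and a chart, a tractor \<open>(\<sigma>, \<mu>\<^sub>a, \<rho>)\<close> is a vector indexed by the following type,
  which has \<open>CARD('n) + 2\<close> elements.
\<close>

datatype 'n tractor_index = Hi | Mid 'n | Lo

instance tractor_index :: (finite) finite
proof
  have "UNIV = insert Hi (insert Lo (range (Mid :: 'a \<Rightarrow> 'a tractor_index)))"
    by (auto intro: tractor_index.exhaust)
  then show "finite (UNIV :: 'a tractor_index set)"
    by (metis finite finite_imageI finite_insert)
qed

type_synonym 'n tractor = "real^('n tractor_index)"

definition tractor :: "real \<Rightarrow> real^'n::finite \<Rightarrow> real \<Rightarrow> 'n tractor" where
  "tractor \<sigma> \<mu> \<rho> = (\<chi> A. case A of Hi \<Rightarrow> \<sigma> | Mid a \<Rightarrow> \<mu> $ a | Lo \<Rightarrow> \<rho>)"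

definition mid :: "'n::finite tractor \<Rightarrow> real^'n" where
  "mid V = (\<chi> a. V $ Mid a)"

text \<open>
  \<open>tractor_rescale G0 \<Omega> \<Upsilon> V\<close> gives the components in the scale \<open>\<Omega>\<^sup>2 g\<close> of the tractor
  with components \<open>V\<close> in the scale \<open>g\<close>.  The outer factors \<open>\<Omega>\<close>, \<open>\<Omega>\<close>, \<open>1/\<Omega>\<close> come from
  trivialising the densities of weights 1, 1, -1 by \<open>\<Omega>\<^sup>2 g\<close> instead of \<open>g\<close>.
\<close>

definition tractor_rescale ::
  "real^'n^'n::finite \<Rightarrow> real \<Rightarrow> real^'n \<Rightarrow> 'n tractor \<Rightarrow> 'n tractor" where
  "tractor_rescale G0 \<Omega> \<Upsilon> V = tractor
     (\<Omega> * V $ Hi)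
     (\<Omega> *\<^sub>R (mid V + V $ Hi *\<^sub>R \<Upsilon>))
     ((V $ Lo - bilin (matrix_inv G0) \<Upsilon> (mid V) - 1/2 * bilin (matrix_inv G0) \<Upsilon> \<Upsilon> * V $ Hi) / \<Omega>)"

definition upsilon :: "('a, 'n::finite) chart \<Rightarrow> ('a \<Rightarrow> real) \<Rightarrow> real^'n \<Rightarrow> real^'n" where
  "upsilon \<kappa> \<Omega> y = (\<chi> a. pderiv_at a (\<Omega> \<circ> chart_inv \<kappa>) y / \<Omega> (chart_inv \<kappa> y))"

text \<open>
  Sections of the tractor bundle along the part of the curve in the domain of a chart:
  a triple for every scale, subject to the transformation law.  The covector \<open>\<mu>\<^sub>a\<close> is written in
  the coordinates of that chart in every scale.
\<close>

definition tractor_section ::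
  "('a, 'n::finite) chart set \<Rightarrow> ('a, 'n) metric set \<Rightarrow> ('a, 'n) chart \<Rightarrow> 'a param \<Rightarrow>
     (('a, 'n) metric \<Rightarrow> real \<Rightarrow> 'n tractor) \<Rightarrow> bool" where
  "tractor_section A C \<kappa> \<pi> V \<longleftrightarrow>
     (\<forall>g\<in>C. smooth_on (param_domain \<kappa> \<pi>) (V g)) \<and>
     (\<forall>g\<in>C. \<forall>g'\<in>C. \<forall>\<Omega>. rescaled_by A \<Omega> g g' \<longrightarrow>
        (\<forall>t\<in>param_domain \<kappa> \<pi>. V g' t =
           tractor_rescale (g \<kappa> (coord_curve \<kappa> \<pi> t)) (\<Omega> (snd \<pi> t))
             (upsilon \<kappa> \<Omega> (coord_curve \<kappa> \<pi> t)) (V g t)))"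

text \<open>The matrix \<open>h\<^sub>A\<^sub>B\<close> of the tractor metric, \<open>h(V,V) = 2\<sigma>\<rho> + g\<^sup>a\<^sup>b\<mu>\<^sub>a\<mu>\<^sub>b\<close>.\<close>

definition tractor_metric :: "real^'n^'n::finite \<Rightarrow> real^('n tractor_index)^('n tractor_index)" where
  "tractor_metric G0 = (\<chi> A B. case (A, B) of
      (Hi, Lo) \<Rightarrow> 1 | (Lo, Hi) \<Rightarrow> 1 | (Mid a, Mid b) \<Rightarrow> matrix_inv G0 $ a $ b | _ \<Rightarrow> 0)"

text \<open>
  The tractor connection in the direction \<open>w\<close> at \<open>y\<close> is the sum of the directional derivative of
  the components and the following algebraic operator.
\<close>

definition tractor_conn ::
  "(real^'n \<Rightarrow> real^'n^'n::finite) \<Rightarrow> real^'n \<Rightarrow> real^'n \<Rightarrow> 'n tractor \<Rightarrow> 'n tractor" where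
  "tractor_conn G y w V = tractor
     (- (w \<bullet> mid V))
     ((\<chi> b. (\<Sum>a\<in>UNIV. w $ a * (schouten G y $ a $ b * V $ Hi + G y $ a $ b * V $ Lo
        - (\<Sum>c\<in>UNIV. christoffel G y c a b * mid V $ c)))))
     (- bilin (schouten G y) w (matrix_inv (G y) *v mid V))"

definition tractor_conn_matrix ::
  "(real^'n \<Rightarrow> real^'n^'n::finite) \<Rightarrow> (real \<Rightarrow> real^'n) \<Rightarrow> real \<Rightarrow>
     real^('n tractor_index)^('n tractor_index)" where
  "tractor_conn_matrix G x t = matrix (tractor_conn G (x t) (velocity x t))"

definition tractor_deriv ::
  "(real^'n \<Rightarrow> real^'n^'n::finite) \<Rightarrow> (real \<Rightarrow> real^'n) \<Rightarrow> (real \<Rightarrow> 'n tractor) \<Rightarrow> real \<Rightarrow> 'n tractor" where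
  "tractor_deriv G x V t = vector_derivative V (at t) + tractor_conn G (x t) (velocity x t) (V t)"

definition tractor_endo_deriv ::
  "(real^'n \<Rightarrow> real^'n^'n::finite) \<Rightarrow> (real \<Rightarrow> real^'n) \<Rightarrow>
     (real \<Rightarrow> real^('n tractor_index)^('n tractor_index)) \<Rightarrow> real \<Rightarrow>
     real^('n tractor_index)^('n tractor_index)" where
  "tractor_endo_deriv G x E t = vector_derivative E (at t)
     + tractor_conn_matrix G x t ** E t - E t ** tractor_conn_matrix G x t"


section \<open>Tractor forms\<close>

text \<open>
  A \<open>k\<close>-form \<open>F\<close> is given by its components \<open>F [A1, ..., Ak]\<close>; lists of any other length are
  mapped to 0.
\<close>

type_synonym 'i form = "'i list \<Rightarrow> real"

definition alternating_form :: "nat \<Rightarrow> 'i form \<Rightarrow> bool" where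
  "alternating_form k F \<longleftrightarrow> (\<forall>As. length As \<noteq> k \<longrightarrow> F As = 0) \<and>
     (\<forall>As i j. i < j \<and> j < length As \<longrightarrow> F (As[i := As ! j, j := As ! i]) = - F As)"

definition index_lists :: "nat \<Rightarrow> 'i list set" where
  "index_lists k = {As. length As = k}"

definition form_eval :: "('i::finite) form \<Rightarrow> (real^'i) list \<Rightarrow> real" where
  "form_eval F Vs = (\<Sum>As\<in>index_lists (length Vs). F As * (\<Prod>j<length Vs. (Vs ! j) $ (As ! j)))"

text \<open>All indices are contracted, without a factor \<open>1/k!\<close>.\<close>

definition form_contract :: "real^'i^'i::finite \<Rightarrow> nat \<Rightarrow> 'i form \<Rightarrow> 'i form \<Rightarrow> real" where
  "form_contract h k E F = (\<Sum>As\<in>index_lists k. \<Sum>Bs\<in>index_lists k.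
     (\<Prod>j<k. matrix_inv h $ (As ! j) $ (Bs ! j)) * E As * F Bs)"

text \<open>The contracted indices are the first \<open>k\<close> indices of the volume form \<open>\<epsilon>\<close>.\<close>

definition hodge :: "real^'i^'i::finite \<Rightarrow> 'i form \<Rightarrow> nat \<Rightarrow> 'i form \<Rightarrow> 'i form" where
  "hodge h \<epsilon> k F Bs = 1 / fact k * (\<Sum>As\<in>index_lists k. \<Sum>Cs\<in>index_lists k.
     (\<Prod>j<k. matrix_inv h $ (As ! j) $ (Cs ! j)) * \<epsilon> (Cs @ Bs) * F As)"

definition tractor_form_deriv ::
  "(real^'n \<Rightarrow> real^'n^'n::finite) \<Rightarrow> (real \<Rightarrow> real^'n) \<Rightarrow>
     (real \<Rightarrow> 'n tractor_index form) \<Rightarrow> real \<Rightarrow> 'n tractor_index form" where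
  "tractor_form_deriv G x F t As = vector_derivative (\<lambda>s. F s As) (at t)
     - (\<Sum>j<length As. \<Sum>B\<in>UNIV. tractor_conn_matrix G x t $ B $ (As ! j) * F t (As[j := B]))"

text \<open>
  An ordering of the coordinates, fixed once and for all.  It is used to read off the sign of a
  frame given as a list: the coordinate frame of a chart of the oriented atlas, in this order,
  is positive.
\<close>

definition coord_order :: "'n::finite list" where
  "coord_order = (SOME es. distinct es \<and> set es = UNIV)"

definition coord_pos :: "'n::finite \<Rightarrow> nat" where
  "coord_pos i = (THE k. k < CARD('n) \<and> coord_order ! k = i)"

definition frame_det :: "(real^'n::finite) list \<Rightarrow> real" where
  "frame_det vs = det (\<chi> i j. (vs ! coord_pos j) $ i)"

text \<open>
  The tractor volume form in a scale: these conditions determine it fibrewise, and the section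
  so obtained is the parallel one.  The orientation of the tractor bundle is the one for which
  the ordering \<open>\<sigma>, \<mu>\<^sub>1, \<dots>, \<mu>\<^sub>n, \<rho>\<close> is positive.
\<close>

definition tractor_volume :: "real^'n^'n::finite \<Rightarrow> 'n tractor_index form" where
  "tractor_volume G0 = (THE E. alternating_form (CARD('n) + 2) E \<and>
     form_contract (tractor_metric G0) (CARD('n) + 2) E E = - fact (CARD('n) + 2) \<and>
     E (Hi # map Mid coord_order @ [Lo]) > 0)"


section \<open>The normal tractor bundle of a curve\<close>

definition normal_tractor ::
  "(real^'n \<Rightarrow> real^'n^'n::finite) \<Rightarrow> (real \<Rightarrow> real^'n) \<Rightarrow> real \<Rightarrow> real^'n \<Rightarrow> 'n tractor" where
  "normal_tractor G x t v =
     tractor 0 (G (x t) *v v) (bilin (G (x t)) v (mean_curvature G x t))"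

definition normal_tractors ::
  "(real^'n \<Rightarrow> real^'n^'n::finite) \<Rightarrow> (real \<Rightarrow> real^'n) \<Rightarrow> real \<Rightarrow> 'n tractor set" where
  "normal_tractors G x t = normal_tractor G x t ` normal_space G x t"

definition normal_tractors_perp ::
  "(real^'n \<Rightarrow> real^'n^'n::finite) \<Rightarrow> (real \<Rightarrow> real^'n) \<Rightarrow> real \<Rightarrow> 'n tractor set" where
  "normal_tractors_perp G x t =
     {V. \<forall>W\<in>normal_tractors G x t. bilin (tractor_metric (G (x t))) V W = 0}"

definition tractor_normal_proj ::
  "(real^'n \<Rightarrow> real^'n^'n::finite) \<Rightarrow> (real \<Rightarrow> real^'n) \<Rightarrow> real \<Rightarrow> 'n tractor \<Rightarrow> 'n tractor" where
  "tractor_normal_proj G x t = orth_proj (tractor_metric (G (x t))) (normal_tractors G x t)"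

definition tractor_normal_proj_matrix ::
  "(real^'n \<Rightarrow> real^'n^'n::finite) \<Rightarrow> (real \<Rightarrow> real^'n) \<Rightarrow> real \<Rightarrow>
     real^('n tractor_index)^('n tractor_index)" where
  "tractor_normal_proj_matrix G x t = matrix (tractor_normal_proj G x t)"

text \<open>The tractor second fundamental form \<open>u\<^sup>i L\<^sub>i\<^sup>C(V)\<close>, for \<open>V\<close> with values in the orthogonal
  complement of the normal tractor bundle.\<close>

definition tractor_second_fund_form ::
  "(real^'n \<Rightarrow> real^'n^'n::finite) \<Rightarrow> (real \<Rightarrow> real^'n) \<Rightarrow> (real \<Rightarrow> 'n tractor) \<Rightarrow> real \<Rightarrow> 'n tractor" where
  "tractor_second_fund_form G x V t = tractor_normal_proj G x t (tractor_deriv G x V t)"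

text \<open>
  The form \<open>N\<close> with \<open>n-1\<close> indices.  It is a form on the normal tractor bundle, extended by zero on
  the orthogonal complement.  It is positive on the image of a normal frame
  \<open>v\<^sub>1, \<dots>, v\<^sub>n\<^sub>-\<^sub>1\<close> whenever \<open>u, v\<^sub>1, \<dots>, v\<^sub>n\<^sub>-\<^sub>1\<close> is a positive frame of the manifold.
\<close>

definition normal_form ::
  "(real^'n \<Rightarrow> real^'n^'n::finite) \<Rightarrow> (real \<Rightarrow> real^'n) \<Rightarrow> real \<Rightarrow> 'n tractor_index form" where
  "normal_form G x t = (THE F. alternating_form (CARD('n) - 1) F \<and>
     (\<forall>V\<in>normal_tractors_perp G x t. \<forall>As. (\<Sum>A\<in>UNIV. V $ A * F (A # As)) = 0) \<and>
     form_contract (tractor_metric (G (x t))) (CARD('n) - 1) F F = fact (CARD('n) - 1) \<and>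
     (\<forall>vs. length vs = CARD('n) - 1 \<and> set vs \<subseteq> normal_space G x t \<and>
        frame_det (velocity x t # vs) > 0 \<longrightarrow>
        form_eval F (map (normal_tractor G x t) vs) > 0))"

definition star_normal_form ::
  "(real^'n \<Rightarrow> real^'n^'n::finite) \<Rightarrow> (real \<Rightarrow> real^'n) \<Rightarrow> real \<Rightarrow> 'n tractor_index form" where
  "star_normal_form G x t =
     hodge (tractor_metric (G (x t))) (tractor_volume (G (x t))) (CARD('n) - 1) (normal_form G x t)"


section \<open>The conditions on a curve\<close>

text \<open>
  A tensorial or tractorial condition along the curve holds if it holds in every chart, for every
  scale in the conformal class and every parametrisation, at every point.
\<close>

definition holds_along ::
  "('a, 'n::finite) chart set \<Rightarrow> ('a, 'n) metric set \<Rightarrow> 'a param set \<Rightarrow>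
     ((real^'n \<Rightarrow> real^'n^'n) \<Rightarrow> (real \<Rightarrow> real^'n) \<Rightarrow> real \<Rightarrow> bool) \<Rightarrow> bool" where
  "holds_along A C \<Gamma> \<Phi> \<longleftrightarrow> (\<forall>\<kappa>\<in>A. \<forall>g\<in>C. \<forall>\<pi>\<in>\<Gamma>. \<forall>t\<in>param_domain \<kappa> \<pi>. \<Phi> (g \<kappa>) (coord_curve \<kappa> \<pi>) t)"

definition unparametrised_conformal_circle ::
  "('a, 'n::finite) chart set \<Rightarrow> ('a, 'n) metric set \<Rightarrow> 'a param set \<Rightarrow> bool" where
  "unparametrised_conformal_circle A C \<Gamma> \<longleftrightarrow>
     holds_along A C \<Gamma> (\<lambda>G x t. normal_proj G x t (circle_defect G x t) = 0)"

definition conformal_curvature_vanishes ::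
  "('a, 'n::finite) chart set \<Rightarrow> ('a, 'n) metric set \<Rightarrow> 'a param set \<Rightarrow> bool" where
  "conformal_curvature_vanishes A C \<Gamma> \<longleftrightarrow>
     holds_along A C \<Gamma> (\<lambda>G x t. conformal_curvature G x t = 0)"

definition tractor_second_fund_form_vanishes ::
  "('a, 'n::finite) chart set \<Rightarrow> ('a, 'n) metric set \<Rightarrow> 'a param set \<Rightarrow> bool" where
  "tractor_second_fund_form_vanishes A C \<Gamma> \<longleftrightarrow>
     (\<forall>\<kappa>\<in>A. \<forall>\<pi>\<in>\<Gamma>. \<forall>V. tractor_section A C \<kappa> \<pi> V \<and>
        (\<forall>g\<in>C. \<forall>t\<in>param_domain \<kappa> \<pi>. V g t \<in> normal_tractors_perp (g \<kappa>) (coord_curve \<kappa> \<pi>) t) \<longrightarrow>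
        (\<forall>g\<in>C. \<forall>t\<in>param_domain \<kappa> \<pi>.
           tractor_second_fund_form (g \<kappa>) (coord_curve \<kappa> \<pi>) (V g) t = 0))"

definition normal_proj_parallel ::
  "('a, 'n::finite) chart set \<Rightarrow> ('a, 'n) metric set \<Rightarrow> 'a param set \<Rightarrow> bool" where
  "normal_proj_parallel A C \<Gamma> \<longleftrightarrow>
     holds_along A C \<Gamma> (\<lambda>G x t. tractor_endo_deriv G x (tractor_normal_proj_matrix G x) t = 0)"

definition normal_form_parallel ::
  "('a, 'n::finite) chart set \<Rightarrow> ('a, 'n) metric set \<Rightarrow> 'a param set \<Rightarrow> bool" where
  "normal_form_parallel A C \<Gamma> \<longleftrightarrow>
     holds_along A C \<Gamma> (\<lambda>G x t. \<forall>As. length As = CARD('n) - 1 \<longrightarrow>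
       tractor_form_deriv G x (normal_form G x) t As = 0)"

definition star_normal_form_parallel ::
  "('a, 'n::finite) chart set \<Rightarrow> ('a, 'n) metric set \<Rightarrow> 'a param set \<Rightarrow> bool" where
  "star_normal_form_parallel A C \<Gamma> \<longleftrightarrow>
     holds_along A C \<Gamma> (\<lambda>G x t. \<forall>As. length As = 3 \<longrightarrow>
       tractor_form_deriv G x (star_normal_form G x) t As = 0)"

end

theory Submission
  imports Defs "HOL-Combinatorics.Multiset_Permutations"
begin

text \<open>
  Near each point of the curve take an orthonormal frame \<open>e\<^sub>b\<close> along it with one vector tangent to the
  curve, and complete the tractors \<open>(0, e\<^sub>b, g(e\<^sub>b,H))\<close> by the null tractors \<open>(1, -H, -H\<^sup>2/2)\<close> and
  \<open>(0, 0, 1)\<close>.  In this tractor frame the projection to the normal tractor bundle, the form \<open>N\<close> and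
  its Hodge dual have constant components, so each of them is parallel iff the connection matrix
  preserves the splitting into the normal tractor bundle and its complement.  The only entries of the
  connection matrix that mix the two are \<open>\<plusminus> g(e\<^sub>b, \<mu>)\<close> for \<open>e\<^sub>b\<close> normal, and they also are the components of
  the tractor second fundamental form.  Finally the normal part of the circle equation is
  \<open>-u\<^sup>2 \<mu>\<close>.  The Schouten tensor enters algebraically only; nothing about the curvature is used.
\<close>

text \<open>A form of top degree on a block sees an endomorphism of that block only through its
  trace. Parallelism of \<open>N\<close> or of its dual therefore means "no mixing, and zero trace",
  and the trace condition must come for free: it does because an adapted frame gives the connection
  matrix a zero diagonal. \<open>N\<close> then tests one off-diagonal block and its dual the
  opposite one; metricity makes both carry the same numbers up to sign. The third slot
  \<open>g(n,H)\<close> of a normal tractor is exactly what cancels the turning of the unit tangent,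
  which would otherwise appear as a further mixed entry. Signs have to be settled because
  \<open>N\<close> and the volume form are definite descriptions. The frame is taken positive so
  that \<open>N\<close> gets the sign +1; for the volume form it is enough that its sign is locally
  constant. All derivatives are taken at a single point, so a frame differentiable there and adapted
  nearby suffices. The condition on the tractor second fundamental form quantifies over sections
  given compatibly in all scales. It says something about a curve only if such a section with
  nonzero first slot exists, so one must be constructed and shown to be invariant.\<close>

lemma matrix_inv_eqI:
  fixes A :: "real^'n::finite^'n"
  assumes "A ** B = mat 1"
  shows "matrix_inv A = B"
proof -
  have BA: "B ** A = mat 1" using assms matrix_left_right_inverse by blast
  have "A ** matrix_inv A = mat 1 \<and> matrix_inv A ** A = mat 1"
    unfolding matrix_inv_def by (rule someI[of _ B]) (use assms BA in simp)
  then show ?thesis using BA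
    by (metis matrix_mul_assoc matrix_mul_lid matrix_mul_rid)
qed

section \<open>Multilinear algebra of forms given by their components\<close>

section \<open>Sums over index lists\<close>

lemma finite_index_lists [simp]: "finite (index_lists k :: 'i::finite list set)"
  unfolding index_lists_def using finite_lists_length_eq[of "UNIV :: 'i set" k] by simp

lemma in_index_lists [simp]: "As \<in> index_lists k \<longleftrightarrow> length As = k"
  by (simp add: index_lists_def)

lemma index_lists_0 [simp]: "index_lists 0 = {[]}"
  by (auto simp: index_lists_def)

lemma sum_index_lists_Suc:
  "(\<Sum>As\<in>index_lists (Suc k). f As) = (\<Sum>a\<in>UNIV. \<Sum>As\<in>index_lists k. f (a # As :: 'i::finite list))"
proof -
  have "(\<Sum>As\<in>index_lists (Suc k). f As) = (\<Sum>(a, As)\<in>UNIV \<times> index_lists k. f (a # As))"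
    by (rule sum.reindex_bij_witness[of _ "\<lambda>(a, As). a # As" "\<lambda>As. (hd As, tl As)"])
      (auto simp: length_Suc_conv)
  then show ?thesis by (simp add: sum.cartesian_product)
qed

lemma sum_index_lists_append:
  "(\<Sum>As\<in>index_lists (k + m). f As)
     = (\<Sum>As\<in>index_lists k. \<Sum>Bs\<in>index_lists m. f (As @ Bs :: 'i::finite list))"
proof -
  have "(\<Sum>As\<in>index_lists (k + m). f As)
      = (\<Sum>(As, Bs)\<in>index_lists k \<times> index_lists m. f (As @ Bs))"
    by (rule sum.reindex_bij_witness[of _ "\<lambda>(As, Bs). As @ Bs" "\<lambda>As. (take k As, drop k As)"]) auto
  then show ?thesis by (simp add: sum.cartesian_product)
qed

text \<open>Distributivity in the form that every change of frame uses: a product of one-index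
  contractions is a single contraction over index lists.\<close>

lemma prod_sum_index_lists:
  fixes f :: "nat \<Rightarrow> 'i::finite \<Rightarrow> real"
  shows "(\<Prod>j<k. \<Sum>b\<in>UNIV. f j b) = (\<Sum>Bs\<in>index_lists k. \<Prod>j<k. f j (Bs ! j))"
proof (induction k arbitrary: f)
  case (Suc k)
  show ?case
    unfolding sum_index_lists_Suc prod.lessThan_Suc_shift Suc.IH
    by (simp add: sum_product)
qed simp

lemma prod_append_nth:
  "(\<Prod>j<length As + length Bs. f ((As @ Bs) ! j) ((Cs @ Ds) ! j))
     = (\<Prod>j<length As. f (As ! j) (Cs ! j)) * (\<Prod>j<length Bs. f (Bs ! j) (Ds ! j) :: real)"
  if "length Cs = length As"
proof -
  have "(\<Prod>j<length As + length Bs. f ((As @ Bs) ! j) ((Cs @ Ds) ! j))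
     = (\<Prod>j<length As. f ((As @ Bs) ! j) ((Cs @ Ds) ! j))
       * (\<Prod>j=length As..<length As + length Bs. f ((As @ Bs) ! j) ((Cs @ Ds) ! j))"
    by (subst prod.union_disjoint[symmetric]) (auto intro!: prod.cong)
  also have "(\<Prod>j=length As..<length As + length Bs. f ((As @ Bs) ! j) ((Cs @ Ds) ! j))
     = (\<Prod>j<length Bs. f (Bs ! j) (Ds ! j))"
    by (rule prod.reindex_bij_witness[of _ "\<lambda>j. j + length As" "\<lambda>j. j - length As"])
      (use that in \<open>auto simp: nth_append\<close>)
  also have "(\<Prod>j<length As. f ((As @ Bs) ! j) ((Cs @ Ds) ! j)) = (\<Prod>j<length As. f (As ! j) (Cs ! j))"
    by (rule prod.cong) (use that in \<open>auto simp: nth_append\<close>)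
  finally show ?thesis .
qed

section \<open>Pullback of forms\<close>

text \<open>The components of \<open>F\<close> on the columns of \<open>M\<close>. With a frame
  matrix \<open>Q\<close> and its inverse \<open>Qi\<close>, \<open>pull Q\<close> passes from
  coordinate components to frame components and \<open>pull Qi\<close> passes back; the composition
  law is contravariant.\<close>

definition pull :: "real^'i^'i \<Rightarrow> ('i::finite) form \<Rightarrow> 'i form" where
  "pull M F As = (\<Sum>Bs\<in>index_lists (length As). F Bs * (\<Prod>j<length As. M $ (Bs ! j) $ (As ! j)))"

lemma pull_pull: "pull N (pull M F) = pull (M ** N) F"
proof
  fix As :: "'a list"
  let ?k = "length As"
  have "pull N (pull M F) As = (\<Sum>Bs\<in>index_lists ?k. \<Sum>Cs\<in>index_lists ?k. 
      F Cs * (\<Prod>j<?k. M $ (Cs ! j) $ (Bs ! j) * N $ (Bs ! j) $ (As ! j)))"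
    unfolding pull_def by (intro sum.cong) (auto simp: sum_distrib_right prod.distrib mult.assoc)
  also have "\<dots> = (\<Sum>Cs\<in>index_lists ?k. F Cs * (\<Sum>Bs\<in>index_lists ?k.
      (\<Prod>j<?k. M $ (Cs ! j) $ (Bs ! j) * N $ (Bs ! j) $ (As ! j))))"
    by (subst sum.swap) (simp add: sum_distrib_left)
  also have "\<dots> = pull (M ** N) F As"
  proof -
    have "(\<Sum>Bs\<in>index_lists ?k. \<Prod>j<?k. M $ (Cs ! j) $ (Bs ! j) * N $ (Bs ! j) $ (As ! j))
        = (\<Prod>j<?k. (M ** N) $ (Cs ! j) $ (As ! j))" for Cs
      by (simp add: matrix_matrix_mult_def prod_sum_index_lists)
    then show ?thesis by (simp add: pull_def)
  qed
  finally show "pull N (pull M F) As = pull (M ** N) F As" .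
qed

lemma prod_of_bool_eq_nth:
  "length Bs = length As \<Longrightarrow> (\<Prod>j<length As. of_bool (Bs ! j = As ! j) :: real) = of_bool (Bs = As)"
  using nth_equalityI[of Bs As] by auto

lemma pull_mat_1 [simp]: "pull (mat 1) F = F"
proof
  fix As :: "'a list"
  have "pull (mat 1) F As = (\<Sum>Bs\<in>index_lists (length As). F Bs * of_bool (Bs = As))"
    unfolding pull_def
  proof (intro sum.cong refl)
    fix Bs :: "'a list" assume "Bs \<in> index_lists (length As)"
    then show "F Bs * (\<Prod>j<length As. mat 1 $ (Bs ! j) $ (As ! j)) = F Bs * of_bool (Bs = As)"
      using prod_of_bool_eq_nth[of Bs As] by (simp only: mat_def of_bool_def vec_lambda_beta) simp
  qed
  also have "\<dots> = (\<Sum>Bs\<in>{As}. F Bs * of_bool (Bs = As))"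
    by (rule sum.mono_neutral_right) auto
  also have "\<dots> = F As" by simp
  finally show "pull (mat 1) F As = F As" .
qed

lemma pull_cmult: "pull M (\<lambda>As. c * F As) = (\<lambda>As. c * pull M F As)"
  by (auto simp: pull_def sum_distrib_left mult.assoc)

lemma form_eval_map_mult: "form_eval F (map ((*v) M) Vs) = form_eval (pull M F) Vs"
proof -
  let ?k = "length Vs"
  have "form_eval F (map ((*v) M) Vs)
    = (\<Sum>As\<in>index_lists ?k. F As * (\<Prod>j<?k. \<Sum>b\<in>UNIV. M $ (As ! j) $ b * (Vs ! j) $ b))"
    unfolding form_eval_def by (intro sum.cong) (auto simp: matrix_vector_mult_def intro!: prod.cong)
  also have "\<dots> = (\<Sum>As\<in>index_lists ?k. \<Sum>Bs\<in>index_lists ?k. 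
      F As * (\<Prod>j<?k. M $ (As ! j) $ (Bs ! j)) * (\<Prod>j<?k. (Vs ! j) $ (Bs ! j)))"
    unfolding prod_sum_index_lists by (simp add: sum_distrib_left prod.distrib mult.assoc)
  also have "\<dots> = form_eval (pull M F) Vs"
    unfolding form_eval_def pull_def by (subst sum.swap) (auto simp: sum_distrib_right intro!: sum.cong)
  finally show ?thesis .
qed

text \<open>Separates the leading indices from the trailing ones, as the Hodge star requires: it
  contracts the former and leaves the latter free.\<close>

lemma pull_append:
  "pull M F (As @ Bs) = (\<Sum>Es\<in>index_lists (length Bs).
     (\<Prod>j<length Bs. M $ (Es ! j) $ (Bs ! j)) * pull M (\<lambda>Ds. F (Ds @ Es)) As)"
proof -
  have "pull M F (As @ Bs) = (\<Sum>Ds\<in>index_lists (length As). \<Sum>Es\<in>index_lists (length Bs).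
     F (Ds @ Es) * ((\<Prod>j<length As. M $ (Ds ! j) $ (As ! j)) * (\<Prod>j<length Bs. M $ (Es ! j) $ (Bs ! j))))"
    unfolding pull_def length_append sum_index_lists_append
  proof (intro sum.cong refl, goal_cases)
    case (1 Ds Es)
    then show ?case using prod_append_nth[of As Ds "\<lambda>x y. M $ x $ y" Es Bs]
      prod_append_nth[of As Ds "\<lambda>x y. M $ y $ x" Bs Es] by simp
  qed
  also have "\<dots> = (\<Sum>Es\<in>index_lists (length Bs).
     (\<Prod>j<length Bs. M $ (Es ! j) $ (Bs ! j)) * pull M (\<lambda>Ds. F (Ds @ Es)) As)"
    unfolding pull_def by (subst sum.swap) (simp add: sum_distrib_left mult_ac)
  finally show ?thesis .
qed

text \<open>A full contraction may be computed in any frame. The hypothesis says that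
  \<open>hi\<close> is the inverse metric in the frame of the columns of \<open>Q\<close>; each
  factor \<open>Q\<close> is moved onto a form, and the rest interchanges the four sums.\<close>

lemma form_contract_pull:
  assumes h: "matrix_inv h = Q ** hi ** transpose Q"
  shows "form_contract h k E F = (\<Sum>As\<in>index_lists k. \<Sum>Bs\<in>index_lists k.
     (\<Prod>j<k. hi $ (As ! j) $ (Bs ! j)) * pull Q E As * pull Q F Bs)"
proof -
  have hij: "matrix_inv h $ a $ b = (\<Sum>c\<in>UNIV. \<Sum>d\<in>UNIV. Q $ a $ c * hi $ c $ d * Q $ b $ d)" for a b
    unfolding h by (simp add: matrix_matrix_mult_def transpose_def sum_distrib_right)
      (subst sum.swap, simp)
  have P: "(\<Prod>j<k. matrix_inv h $ (As ! j) $ (Bs ! j))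
    = (\<Sum>Cs\<in>index_lists k. \<Sum>Ds\<in>index_lists k. (\<Prod>j<k. Q $ (As ! j) $ (Cs ! j))
        * (\<Prod>j<k. hi $ (Cs ! j) $ (Ds ! j)) * (\<Prod>j<k. Q $ (Bs ! j) $ (Ds ! j)))" for As Bs
    unfolding hij prod_sum_index_lists by (simp add: prod.distrib)
  have "form_contract h k E F = (\<Sum>As\<in>index_lists k. \<Sum>Bs\<in>index_lists k. \<Sum>Cs\<in>index_lists k. \<Sum>Ds\<in>index_lists k.
     (\<Prod>j<k. hi $ (Cs ! j) $ (Ds ! j)) * (E As * (\<Prod>j<k. Q $ (As ! j) $ (Cs ! j)))
        * (F Bs * (\<Prod>j<k. Q $ (Bs ! j) $ (Ds ! j))))"
    unfolding form_contract_def P by (simp add: sum_distrib_right sum_distrib_left mult_ac)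
  also have "\<dots> = (\<Sum>As\<in>index_lists k. \<Sum>Cs\<in>index_lists k. \<Sum>Bs\<in>index_lists k. \<Sum>Ds\<in>index_lists k.
     (\<Prod>j<k. hi $ (Cs ! j) $ (Ds ! j)) * (E As * (\<Prod>j<k. Q $ (As ! j) $ (Cs ! j)))
        * (F Bs * (\<Prod>j<k. Q $ (Bs ! j) $ (Ds ! j))))"
    by (subst (2) sum.swap) simp
  also have "\<dots> = (\<Sum>Cs\<in>index_lists k. \<Sum>As\<in>index_lists k. \<Sum>Ds\<in>index_lists k. \<Sum>Bs\<in>index_lists k.
     (\<Prod>j<k. hi $ (Cs ! j) $ (Ds ! j)) * (E As * (\<Prod>j<k. Q $ (As ! j) $ (Cs ! j)))
        * (F Bs * (\<Prod>j<k. Q $ (Bs ! j) $ (Ds ! j))))"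
    by (subst sum.swap, subst (3) sum.swap) simp
  also have "\<dots> = (\<Sum>Cs\<in>index_lists k. \<Sum>Ds\<in>index_lists k. \<Sum>As\<in>index_lists k. \<Sum>Bs\<in>index_lists k.
     (\<Prod>j<k. hi $ (Cs ! j) $ (Ds ! j)) * (E As * (\<Prod>j<k. Q $ (As ! j) $ (Cs ! j)))
        * (F Bs * (\<Prod>j<k. Q $ (Bs ! j) $ (Ds ! j))))"
    by (subst (2) sum.swap) simp
  also have "\<dots> = (\<Sum>As\<in>index_lists k. \<Sum>Bs\<in>index_lists k.
     (\<Prod>j<k. hi $ (As ! j) $ (Bs ! j)) * pull Q E As * pull Q F Bs)"
    unfolding pull_def
    by (intro sum.cong refl) (simp add: sum_distrib_left sum_distrib_right sum_product mult_ac)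
  finally show ?thesis .
qed

section \<open>Alternating forms\<close>

lemma alternating_form_swap:
  "alternating_form k F \<Longrightarrow> i < length As \<Longrightarrow> j < length As \<Longrightarrow> i \<noteq> j \<Longrightarrow>
    F (As[i := As ! j, j := As ! i]) = - F As"
  unfolding alternating_form_def by (metis linorder_less_linear list_update_swap)

lemma alternating_formI:
  assumes "\<And>As. length As \<noteq> k \<Longrightarrow> F As = 0"
    and "\<And>As i j. length As = k \<Longrightarrow> i < j \<Longrightarrow> j < k \<Longrightarrow> F (As[i := As ! j, j := As ! i]) = - F As"
  shows "alternating_form k F"
  unfolding alternating_form_def using assms by (metis add.inverse_neutral length_list_update)

lemma alternating_form_length: "alternating_form k F \<Longrightarrow> length As \<noteq> k \<Longrightarrow> F As = 0"
  by (simp add: alternating_form_def)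

lemma nth_swap_list:
  "i < length As \<Longrightarrow> j < length As \<Longrightarrow> l < length As \<Longrightarrow>
    As[i := As ! j, j := As ! i] ! l = As ! (Transposition.transpose i j l)"
  by (auto simp: nth_list_update Transposition.transpose_def)

lemma alternating_form_not_distinct:
  fixes F :: "'i form"
  assumes F: "alternating_form k F" and "\<not> distinct As"
  shows "F As = 0"
proof -
  obtain i j where "i < length As" "j < length As" "i \<noteq> j" "As ! i = As ! j"
    using assms(2) by (auto simp: distinct_conv_nth)
  with alternating_form_swap[OF F this(1-3)] show ?thesis
    by (metis add.inverse_inverse equal_neg_zero list_update_id)
qed

text \<open>Substituting swapped lists for the summation variable swaps upper and lower indices of
  \<open>M\<close> simultaneously. The product of matrix entries is then only permuted, and the sign
  comes from \<open>F\<close>.\<close>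

lemma alternating_form_pull:
  assumes F: "alternating_form k F"
  shows "alternating_form k (pull M F)"
proof (rule alternating_formI)
  fix As :: "'a list" assume "length As \<noteq> k"
  then show "pull M F As = 0" unfolding pull_def
    by (intro sum.neutral) (auto simp: alternating_form_length[OF F])
next
  fix As :: "'a list" and i j assume l: "length As = k" and ij: "i < j" "j < k"
  let ?s = "\<lambda>Bs :: 'a list. Bs[i := Bs ! j, j := Bs ! i]"
  have inv: "?s (?s Bs) = Bs" if "length Bs = k" for Bs
    using that ij by (intro nth_equalityI) (auto simp: nth_list_update)
  have "pull M F (?s As) = (\<Sum>Bs\<in>index_lists k. F Bs * (\<Prod>j<k. M $ (Bs ! j) $ (?s As ! j)))"
    using l by (simp add: pull_def)
  also have "\<dots> = (\<Sum>Bs\<in>index_lists k. F (?s Bs) * (\<Prod>l<k. M $ (?s Bs ! l) $ (?s As ! l)))"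
    by (rule sum.reindex_bij_witness[of _ ?s ?s]) (auto simp: inv)
  also have "\<dots> = (\<Sum>Bs\<in>index_lists k. - F Bs * (\<Prod>l<k. M $ (Bs ! l) $ (As ! l)))"
  proof (intro sum.cong refl)
    fix Bs :: "'a list" assume "Bs \<in> index_lists k"
    then have lB: "length Bs = k" by simp
    have "(\<Prod>l<k. M $ (?s Bs ! l) $ (?s As ! l))
       = (\<Prod>l<k. M $ (Bs ! Transposition.transpose i j l) $ (As ! Transposition.transpose i j l))"
      by (intro prod.cong refl) (use l lB ij in \<open>auto simp: nth_swap_list simp del: nth_list_update\<close>)
    also have "\<dots> = (\<Prod>l<k. M $ (Bs ! l) $ (As ! l))"
      by (rule prod.permute[symmetric, unfolded comp_def]) (use ij in \<open>auto intro!: permutes_swap_id\<close>)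
    finally show "F (?s Bs) * (\<Prod>l<k. M $ (?s Bs ! l) $ (?s As ! l)) = - F Bs * (\<Prod>l<k. M $ (Bs ! l) $ (As ! l))"
      using alternating_form_swap[OF F, of i Bs j] lB ij by simp
  qed
  also have "\<dots> = - pull M F As" using l by (simp add: pull_def sum_negf)
  finally show "pull M F (?s As) = - pull M F As" .
qed

text \<open>The sign \<open>s\<close> is obtained before \<open>F\<close> and \<open>k\<close>, so
  the same one serves for two forms at once. Together with \<open>s * s = 1\<close> this replaces
  any computation of the sign of a permutation.\<close>

lemma alternating_form_perm:
  fixes As Bs :: "'i list"
  assumes "mset As = mset Bs"
  shows "\<exists>s::real. s * s = 1 \<and> (\<forall>F k. alternating_form k F \<longrightarrow> F As = s * F Bs)"
proof -
  from mset_eq_permutation[OF assms] obtain p where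
    p: "p permutes {..<length Bs}" "permute_list p Bs = As" .
  have "\<forall>Bs :: 'i list. length Bs = n \<longrightarrow>
     (\<exists>s::real. s * s = 1 \<and> (\<forall>F k. alternating_form k F \<longrightarrow> F (permute_list p Bs) = s * F Bs))"
    if "p permutes {..<n}" for n
    using that finite_lessThan
  proof (induction rule: permutes_induct)
    case id
    show ?case by (auto simp: permute_list_id intro!: exI[of _ 1])
  next
    case (swap a b p)
    show ?case
    proof (intro allI impI)
      fix Bs :: "'i list" assume l: "length Bs = n"
      let ?Bs = "Bs[a := Bs ! b, b := Bs ! a]"
      have "permute_list (Transposition.transpose a b) Bs = ?Bs"
        using swap.hyps l
        by (intro nth_equalityI) (auto simp: nth_swap_list permute_list_nth permutes_swap_id simp del: nth_list_update)
      then have *: "permute_list (Transposition.transpose a b \<circ> p) Bs = permute_list p ?Bs"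
        using swap.hyps l by (subst permute_list_compose) auto
      obtain s :: real where s: "s * s = 1" "\<And>F k. alternating_form k F \<Longrightarrow> F (permute_list p ?Bs) = s * F ?Bs"
        using swap.IH[rule_format, of ?Bs] l by auto
      show "\<exists>s::real. s * s = 1 \<and> (\<forall>F k. alternating_form k F \<longrightarrow>
          F (permute_list (Transposition.transpose a b \<circ> p) Bs) = s * F Bs)"
        using s swap.hyps l
        by (intro exI[of _ "- s"]) (auto simp: * alternating_form_swap)
    qed
  qed
  with p show ?thesis by blast
qed

lemma mset_eq_of_distinct_subset:
  assumes "distinct As" "set As \<subseteq> set L" "distinct L" "length As = length L"
  shows "mset As = mset L"
proof -
  have "set As = set L"
    using assms by (metis card_subset_eq distinct_card finite_set)
  then show ?thesis using assms by (simp add: set_eq_iff_mset_eq_distinct)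
qed

text \<open>Forms of degree \<open>k\<close> living on \<open>k\<close> indices make up a line. The
  proportionality is cross-multiplied so that it can be stated without dividing.\<close>

lemma alternating_form_unique:
  assumes F: "alternating_form k F" "\<And>As. \<not> set As \<subseteq> set L \<Longrightarrow> F As = 0"
    and E: "alternating_form k E" "\<And>As. \<not> set As \<subseteq> set L \<Longrightarrow> E As = 0"
    and L: "length L = k" "distinct L"
  shows "F As * E L = E As * F L"
proof (cases "length As = k \<and> distinct As \<and> set As \<subseteq> set L")
  case True
  with L have "mset As = mset L" by (intro mset_eq_of_distinct_subset) auto
  from alternating_form_perm[OF this] obtain s :: real where
    "\<And>F k. alternating_form k F \<Longrightarrow> F As = s * F L" by blast
  then show ?thesis using F(1) E(1) by (metis mult.assoc mult.commute)
next
  case False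
  then show ?thesis
    using F E alternating_form_length alternating_form_not_distinct by (metis mult_zero_left)
qed

text \<open>Only the \<open>k!\<close> orderings of \<open>L\<close> contribute, and the common sign
  of an ordering occurs squared. This is the origin of the factorials in the normalisations of
  \<open>N\<close> and of the volume form.\<close>

lemma sum_square_alternating:
  fixes F :: "'i::finite form"
  assumes F: "alternating_form k F" "\<And>As. \<not> set As \<subseteq> set L \<Longrightarrow> F As = 0"
    and E: "alternating_form k E"
    and L: "length L = k" "distinct L"
  shows "(\<Sum>As\<in>index_lists k. F As * E As) = fact k * (F L * E L)"
proof -
  have "(\<Sum>As\<in>index_lists k. F As * E As) = (\<Sum>As\<in>permutations_of_set (set L). F As * E As)"
  proof (rule sum.mono_neutral_right)
    show "permutations_of_set (set L) \<subseteq> index_lists k"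
      using L by (auto simp: permutations_of_set_def index_lists_def) (metis distinct_card)
    show "\<forall>i\<in>index_lists k - permutations_of_set (set L). F i * E i = 0"
    proof
      fix As assume As: "As \<in> index_lists k - permutations_of_set (set L)"
      have "\<not> distinct As \<or> \<not> set As \<subseteq> set L"
        using As L mset_eq_of_distinct_subset[of As L]
        by (auto simp: permutations_of_set_def dest: mset_eq_setD)
      then show "F As * E As = 0" using F alternating_form_not_distinct by auto
    qed
  qed simp
  also have "\<dots> = (\<Sum>As\<in>permutations_of_set (set L). F L * E L)"
  proof (intro sum.cong refl)
    fix As assume "As \<in> permutations_of_set (set L)"
    then have "mset As = mset L"
      using L by (auto simp: permutations_of_set_def set_eq_iff_mset_eq_distinct[symmetric])
    from alternating_form_perm[OF this] obtain s :: real where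
      s: "s * s = 1" "\<And>F k. alternating_form k F \<Longrightarrow> F As = s * F L" by blast
    show "F As * E As = F L * E L"
      unfolding s(2)[OF F(1)] s(2)[OF E] using s(1)
      by (metis (no_types, lifting) mult.assoc mult.commute mult.right_neutral)
  qed
  also have "\<dots> = fact k * (F L * E L)"
    using L by (simp add: distinct_card)
  finally show ?thesis .
qed

section \<open>Volume forms\<close>

definition list_pos :: "'i list \<Rightarrow> 'i \<Rightarrow> nat" where
  "list_pos L i = (THE k. k < length L \<and> L ! k = i)"

text \<open>\<open>frame_det\<close> for an arbitrary index type and enumeration, since the same
  determinant is needed for tractor indices as well as for coordinates.\<close>

definition list_det :: "'i::finite list \<Rightarrow> (real^'i) list \<Rightarrow> real" where
  "list_det L vs = det (\<chi> i j. (vs ! list_pos L j) $ i)"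

definition vol :: "'i::finite list \<Rightarrow> 'i form" where
  "vol L As = (if length As = CARD('i) then list_det L (map (\<lambda>a. axis a 1) As) else 0)"

lemma coord_order: "distinct (coord_order :: 'n::finite list)" "set (coord_order :: 'n list) = UNIV"
proof -
  have "distinct (coord_order :: 'n list) \<and> set (coord_order :: 'n list) = UNIV"
    unfolding coord_order_def by (rule someI_ex) (metis finite_distinct_list finite)
  then show "distinct (coord_order :: 'n list)" "set (coord_order :: 'n list) = UNIV" by auto
qed

lemma length_coord_order [simp]: "length (coord_order :: 'n::finite list) = CARD('n)"
  using coord_order distinct_card by metis

lemma frame_det_eq_list_det: "frame_det = list_det coord_order"
  by (auto simp: frame_det_def list_det_def coord_pos_def list_pos_def)

context
  fixes L :: "'i::finite list"
  assumes L: "distinct L" "set L = UNIV"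
begin

lemma length_enum: "length L = CARD('i)"
  using L distinct_card by metis

lemma list_pos: "list_pos L i < CARD('i)" "L ! list_pos L i = i"
proof -
  have "\<exists>!k. k < length L \<and> L ! k = i"
    using L by (metis UNIV_I distinct_Ex1)
  from theI'[OF this] show "list_pos L i < CARD('i)" "L ! list_pos L i = i"
    by (auto simp: list_pos_def length_enum)
qed

lemma list_pos_nth: "k < CARD('i) \<Longrightarrow> list_pos L (L ! k) = k"
  using list_pos L by (metis length_enum nth_eq_iff_index_eq)

lemma vol_enum: "vol L L = 1"
proof -
  have "(\<chi> i j. (map (\<lambda>a. axis a 1) L ! list_pos L j) $ i :: real^'i^'i) = mat 1"
    using list_pos by (auto simp: vec_eq_iff axis_def mat_def length_enum)
  then show ?thesis by (simp add: vol_def list_det_def length_enum)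
qed

text \<open>Swapping two entries of the list swaps the columns at \<open>L ! i\<close> and
  \<open>L ! j\<close>; the matrix is transposed to use the rule for permuted rows.\<close>

lemma alternating_vol: "alternating_form CARD('i) (vol L)"
proof (rule alternating_formI)
  fix As :: "'i list" and i j assume l: "length As = CARD('i)" and ij: "i < j" "j < CARD('i)"
  let ?p = "Transposition.transpose (L ! i) (L ! j)"
  let ?A = "(\<chi> k. axis (As ! list_pos L k) 1) :: real^'i^'i"
  have d: "L ! i \<noteq> L ! j" using ij L by (simp add: nth_eq_iff_index_eq length_enum)
  have pos: "list_pos L (?p k) = Transposition.transpose i j (list_pos L k)" for k
    using ij list_pos[of k] list_pos_nth[of i] list_pos_nth[of j]
    by (auto simp: Transposition.transpose_def)
  have "vol L (As[i := As ! j, j := As ! i]) = det (transpose (\<chi> k. ?A $ ?p k))"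
    unfolding vol_def list_det_def using l ij list_pos
    by (auto simp: pos nth_swap_list transpose_def simp del: nth_list_update intro!: arg_cong[where f=det])
  also have "\<dots> = of_int (sign ?p) * det ?A"
    unfolding det_transpose by (rule det_permute_rows) (simp add: permutes_swap_id)
  also have "det ?A = vol L As"
    unfolding vol_def list_det_def using l list_pos
    by (subst det_transpose[symmetric]) (auto simp: transpose_def intro!: arg_cong[where f=det])
  finally show "vol L (As[i := As ! j, j := As ! i]) = - vol L As"
    using d by (simp add: sign_swap_id)
qed (simp add: vol_def)

lemma form_eval_vol:
  assumes vs: "length vs = CARD('i)"
  shows "form_eval (vol L) vs = list_det L vs"
proof -
  let ?n = "CARD('i)"
  \<comment> \<open>In the Leibniz expansion row \<open>i\<close> meets the vector at position
    \<open>list_pos L (p i)\<close>. Renaming by this position \<open>j\<close> makes the row index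
    \<open>inv p (L ! j)\<close>.\<close>
  have re: "(\<Prod>i\<in>UNIV. f (list_pos L (p i)) i) = (\<Prod>j<?n. f j (inv p (L ! j)))"
    if "p permutes UNIV" for p and f :: "nat \<Rightarrow> 'i \<Rightarrow> real"
    by (rule prod.reindex_bij_witness[of _ "\<lambda>j. inv p (L ! j)" "\<lambda>i. list_pos L (p i)"])
      (use that list_pos list_pos_nth in \<open>auto simp: permutes_inverses\<close>)
  have "form_eval (vol L) vs = (\<Sum>As\<in>index_lists ?n. \<Sum>p | p permutes UNIV.
      of_int (sign p) * ((\<Prod>j<?n. of_bool (inv p (L ! j) = As ! j)) * (\<Prod>j<?n. (vs ! j) $ (As ! j))))"
    unfolding form_eval_def vs
  proof (intro sum.cong refl)
    fix As :: "'i list" assume "As \<in> index_lists ?n"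
    then have "vol L As = (\<Sum>p | p permutes UNIV. of_int (sign p)
        * (\<Prod>i\<in>UNIV. of_bool (i = As ! list_pos L (p i))))"
      unfolding vol_def list_det_def det_def using list_pos
      by (auto intro!: sum.cong prod.cong simp: axis_def)
    also have "\<dots> = (\<Sum>p | p permutes UNIV. of_int (sign p)
        * (\<Prod>j<?n. of_bool (inv p (L ! j) = As ! j)))"
      by (intro sum.cong refl) (use re[of _ "\<lambda>j i. of_bool (i = As ! j)"] in auto)
    finally show "vol L As * (\<Prod>j<?n. (vs ! j) $ (As ! j)) = (\<Sum>p | p permutes UNIV.
      of_int (sign p) * ((\<Prod>j<?n. of_bool (inv p (L ! j) = As ! j)) * (\<Prod>j<?n. (vs ! j) $ (As ! j))))"
      by (simp add: sum_distrib_right mult.assoc)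
  qed
  also have "\<dots> = (\<Sum>p | p permutes UNIV. of_int (sign p) *
     (\<Sum>As\<in>index_lists ?n. \<Prod>j<?n. of_bool (inv p (L ! j) = As ! j) * (vs ! j) $ (As ! j)))"
    by (subst sum.swap) (simp add: sum_distrib_left prod.distrib)
  also have "\<dots> = (\<Sum>p | p permutes UNIV. of_int (sign p) * (\<Prod>j<?n. (vs ! j) $ (inv p (L ! j))))"
  proof (intro sum.cong refl arg_cong2[where f="(*)"])
    fix p :: "'i \<Rightarrow> 'i"
    have "(\<Sum>As\<in>index_lists ?n. \<Prod>j<?n. of_bool (inv p (L ! j) = As ! j) * (vs ! j) $ (As ! j))
      = (\<Prod>j<?n. \<Sum>a\<in>UNIV. of_bool (inv p (L ! j) = a) * (vs ! j) $ a)"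
      by (rule prod_sum_index_lists[symmetric])
    moreover have "of_bool (inv p (L ! j) = a) * (vs ! j) $ a
      = (if a = inv p (L ! j) then (vs ! j) $ a else 0)" for j a
      by simp
    ultimately show "(\<Sum>As\<in>index_lists ?n. \<Prod>j<?n. of_bool (inv p (L ! j) = As ! j) * (vs ! j) $ (As ! j))
      = (\<Prod>j<?n. (vs ! j) $ (inv p (L ! j)))"
      by (simp only: sum.delta[OF finite] UNIV_I if_True)
  qed
  also have "\<dots> = list_det L vs"
    unfolding list_det_def det_def
    by (intro sum.cong refl) (use re[of _ "\<lambda>j i. (vs ! j) $ i"] in auto)
  finally show ?thesis .
qed

lemma list_det_map_mult:
  assumes "length vs = CARD('i)"
  shows "list_det L (map ((*v) M) vs) = det M * list_det L vs"
proof -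
  have "(\<chi> i j. (map ((*v) M) vs ! list_pos L j) $ i) = M ** (\<chi> i j. (vs ! list_pos L j) $ i)"
    using list_pos assms by (auto simp: vec_eq_iff matrix_vector_mult_def matrix_matrix_mult_def)
  then show ?thesis by (simp add: list_det_def det_mul)
qed

lemma alternating_form_top:
  assumes "alternating_form CARD('i) F"
  shows "F = (\<lambda>As. F L * vol L As)"
proof
  fix As
  have "F As * vol L L = vol L As * F L"
    by (rule alternating_form_unique[OF assms _ alternating_vol]) (use L length_enum in auto)
  then show "F As = F L * vol L As" by (simp add: vol_enum mult.commute)
qed

lemma vol_distinct_nonzero:
  assumes "distinct As" "set As = UNIV"
  shows "vol L As \<noteq> 0"
proof -
  have "mset As = mset L"
    using assms L by (simp add: set_eq_iff_mset_eq_distinct[symmetric])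
  from alternating_form_perm[OF this] obtain s :: real where "s * s = 1" "vol L As = s * vol L L"
    using alternating_vol by blast
  then show ?thesis by (auto simp: vol_enum)
qed

end

section \<open>The action of endomorphisms on forms\<close>

text \<open>The derivation induced by \<open>W\<close>, that is, the derivative of
  \<open>pull (mat 1 + s W) F\<close> at \<open>s = 0\<close>. For \<open>W\<close> the matrix of
  the tractor connection it is the term subtracted in \<open>tractor_form_deriv\<close>.\<close>

definition form_act :: "real^'i^'i \<Rightarrow> ('i::finite) form \<Rightarrow> 'i form" where
  "form_act W F As = (\<Sum>j<length As. \<Sum>B\<in>UNIV. W $ B $ (As ! j) * F (As[j := B]))"

text \<open>This and the next lemma bring both orders of composition to one shape, a product in
  which a single factor \<open>M\<close> is replaced by \<open>M ** W\<close> or by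
  \<open>W ** M\<close>, so that they can be compared with the product rule.\<close>

lemma form_act_pull:
  "form_act W (pull M F) As = (\<Sum>Bs\<in>index_lists (length As). F Bs * (\<Sum>j<length As.
     (M ** W) $ (Bs ! j) $ (As ! j) * (\<Prod>l\<in>{..<length As} - {j}. M $ (Bs ! l) $ (As ! l))))"
proof -
  let ?k = "length As"
  have split: "(\<Prod>l<?k. M $ (Bs ! l) $ (As[j := B] ! l))
      = M $ (Bs ! j) $ B * (\<Prod>l\<in>{..<?k} - {j}. M $ (Bs ! l) $ (As ! l))" if "j < ?k" for Bs j B
    using that by (subst prod.remove[of _ j]) (auto intro!: prod.cong)
  have "form_act W (pull M F) As = (\<Sum>j<?k. \<Sum>B\<in>UNIV. \<Sum>Bs\<in>index_lists ?k.
      F Bs * (M $ (Bs ! j) $ B * W $ B $ (As ! j) * (\<Prod>l\<in>{..<?k} - {j}. M $ (Bs ! l) $ (As ! l))))"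
    unfolding form_act_def pull_def
    by (intro sum.cong refl) (simp add: split sum_distrib_left mult_ac)
  also have "\<dots> = (\<Sum>j<?k. \<Sum>Bs\<in>index_lists ?k. F Bs * ((M ** W) $ (Bs ! j) $ (As ! j)
      * (\<Prod>l\<in>{..<?k} - {j}. M $ (Bs ! l) $ (As ! l))))"
    by (intro sum.cong refl, subst sum.swap)
      (simp add: matrix_matrix_mult_def sum_distrib_left sum_distrib_right)
  also have "\<dots> = (\<Sum>Bs\<in>index_lists ?k. F Bs * (\<Sum>j<?k.
     (M ** W) $ (Bs ! j) $ (As ! j) * (\<Prod>l\<in>{..<?k} - {j}. M $ (Bs ! l) $ (As ! l))))"
    by (subst sum.swap) (simp add: sum_distrib_left)
  finally show ?thesis .
qed

lemma pull_form_act: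
  "pull M (form_act W F) As = (\<Sum>Bs\<in>index_lists (length As). F Bs * (\<Sum>j<length As.
     (W ** M) $ (Bs ! j) $ (As ! j) * (\<Prod>l\<in>{..<length As} - {j}. M $ (Bs ! l) $ (As ! l))))"
proof -
  let ?k = "length As"
  have "pull M (form_act W F) As = (\<Sum>j<?k. \<Sum>(Cs, B)\<in>index_lists ?k \<times> UNIV.
      W $ B $ (Cs ! j) * F (Cs[j := B]) * (\<Prod>l<?k. M $ (Cs ! l) $ (As ! l)))"
    unfolding pull_def form_act_def sum.cartesian_product[symmetric]
    by (subst sum.swap) (simp add: sum_distrib_right)
  also have "\<dots> = (\<Sum>j<?k. \<Sum>(Bs, C)\<in>index_lists ?k \<times> UNIV. F Bs *
      (W $ (Bs ! j) $ C * M $ C $ (As ! j) * (\<Prod>l\<in>{..<?k} - {j}. M $ (Bs ! l) $ (As ! l))))"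
  proof (rule sum.cong[OF refl], goal_cases)
    case (1 j)
    then have j: "j < ?k" by simp
    show ?case
    \<comment> \<open>The overwritten entry is kept as the second component, so the map is its own
      inverse.\<close>
    proof (rule sum.reindex_bij_witness[of _ "\<lambda>(Bs, C). (Bs[j := C], Bs ! j)" "\<lambda>(Bs, C). (Bs[j := C], Bs ! j)"], goal_cases)
      case (5 p)
      then show ?case using j
        by (auto simp: prod.remove[of _ j] intro!: prod.cong)
    qed (use j in auto)
  qed
  also have "\<dots> = (\<Sum>j<?k. \<Sum>Bs\<in>index_lists ?k. F Bs * ((W ** M) $ (Bs ! j) $ (As ! j)
      * (\<Prod>l\<in>{..<?k} - {j}. M $ (Bs ! l) $ (As ! l))))"
    unfolding sum.cartesian_product[symmetric]
    by (simp add: matrix_matrix_mult_def sum_distrib_left sum_distrib_right)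
  also have "\<dots> = (\<Sum>Bs\<in>index_lists ?k. F Bs * (\<Sum>j<?k.
     (W ** M) $ (Bs ! j) $ (As ! j) * (\<Prod>l\<in>{..<?k} - {j}. M $ (Bs ! l) $ (As ! l))))"
    by (subst sum.swap) (simp add: sum_distrib_left)
  finally show ?thesis .
qed

text \<open>Made for the coframe equation, with \<open>B\<close> the connection in coordinates and
  \<open>W\<close> the connection in the moving frame: the \<open>B\<close> term will cancel against
  the algebraic part of the covariant derivative, and only the \<open>W\<close> term
  survives.\<close>

lemma has_vector_derivative_pull:
  fixes M :: "real \<Rightarrow> real^'i::finite^'i"
  assumes M: "(M has_vector_derivative (M0 ** B - W ** M0)) (at t)" and "M0 = M t"
  shows "((\<lambda>s. pull (M s) F As) has_vector_derivative
     (form_act B (pull M0 F) As - pull M0 (form_act W F) As)) (at t)"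
proof -
  let ?k = "length As" and ?D = "M0 ** B - W ** M0"
  have e: "((\<lambda>s. M s $ a $ b) has_derivative (\<lambda>h. h * (?D $ a $ b))) (at t)" for a b
    using bounded_linear.has_vector_derivative[OF bounded_linear_vec_nth,
        OF bounded_linear.has_vector_derivative[OF bounded_linear_vec_nth, OF M], of a b]
    by (simp add: has_vector_derivative_def)
  have "((\<lambda>s. \<Prod>j<?k. M s $ (Bs ! j) $ (As ! j)) has_derivative
      (\<lambda>h. h * (\<Sum>j<?k. ?D $ (Bs ! j) $ (As ! j) * (\<Prod>l\<in>{..<?k} - {j}. M0 $ (Bs ! l) $ (As ! l))))) (at t)" for Bs
    using has_derivative_prod[of "{..<?k}" "\<lambda>j s. M s $ (Bs ! j) $ (As ! j)" "\<lambda>j h. h * (?D $ (Bs ! j) $ (As ! j))" t UNIV] e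
    by (simp add: assms(2) sum_distrib_left mult_ac)
  then have "((\<lambda>s. pull (M s) F As) has_derivative (\<lambda>h. \<Sum>Bs\<in>index_lists ?k. F Bs *
      (h * (\<Sum>j<?k. ?D $ (Bs ! j) $ (As ! j) * (\<Prod>l\<in>{..<?k} - {j}. M0 $ (Bs ! l) $ (As ! l)))))) (at t)"
    unfolding pull_def by (intro has_derivative_sum has_derivative_mult_right) auto
  moreover have "(\<Sum>Bs\<in>index_lists ?k. F Bs *
      (h * (\<Sum>j<?k. ?D $ (Bs ! j) $ (As ! j) * (\<Prod>l\<in>{..<?k} - {j}. M0 $ (Bs ! l) $ (As ! l)))))
    = h * (form_act B (pull M0 F) As - pull M0 (form_act W F) As)" for h
    unfolding form_act_pull pull_form_act sum_subtractf[symmetric] sum_distrib_left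
    by (intro sum.cong refl) (simp add: algebra_simps sum_subtractf sum_distrib_left)
  ultimately show ?thesis by (simp add: has_vector_derivative_def)
qed

text \<open>\<open>F\<close> is a multiple of the volume form on the indices in \<open>L\<close>.
  Putting a foreign index \<open>a\<close> into the slot of \<open>b\<close> isolates the entry
  \<open>W $ b $ a\<close>; entries inside the block enter only through their trace, which vanishes
  by the assumption on the diagonal.\<close>

lemma form_act_eq_0_iff:
  fixes L :: "'i::finite list"
  assumes F: "alternating_form k F" "\<And>As. \<not> set As \<subseteq> set L \<Longrightarrow> F As = 0"
    and L: "length L = k" "distinct L" "F L \<noteq> 0"
    and tr: "\<And>a. W $ a $ a = 0"
  shows "(\<forall>As. length As = k \<longrightarrow> form_act W F As = 0) \<longleftrightarrow>
    (\<forall>b\<in>set L. \<forall>a. a \<notin> set L \<longrightarrow> W $ b $ a = 0)"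
proof (intro iffI ballI allI impI)
  fix b a assume H: "\<forall>As. length As = k \<longrightarrow> form_act W F As = 0" and b: "b \<in> set L" and a: "a \<notin> set L"
  obtain i where i: "i < k" "L ! i = b" using b L by (auto simp: in_set_conv_nth)
  \<comment> \<open>The test list contains the foreign index \<open>a\<close> once. It must be
    replaced for \<open>F\<close> to be nonzero, and only \<open>b\<close> can replace it without a
    repetition.\<close>
  have "form_act W F (L[i := a]) = (\<Sum>j\<in>{i}. \<Sum>B\<in>UNIV. W $ B $ (L[i := a] ! j) * F (L[i := a, j := B]))"
    unfolding form_act_def
  proof (intro sum.mono_neutral_right ballI sum.neutral)
    fix j B assume "j \<in> {..<length (L[i := a])} - {i}"
    then have "L[i := a, j := B] ! i = a" "i < length (L[i := a, j := B])" using i L by auto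
    then have "a \<in> set (L[i := a, j := B])" by (metis nth_mem)
    then show "W $ B $ (L[i := a] ! j) * F (L[i := a, j := B]) = 0"
      using a F(2)[of "L[i := a, j := B]"] by auto
  qed (use i L in auto)
  also have "\<dots> = (\<Sum>B\<in>UNIV. W $ B $ a * F (L[i := B]))" using i L by simp
  also have "\<dots> = (\<Sum>B\<in>{b}. W $ B $ a * F (L[i := B]))"
  proof (intro sum.mono_neutral_right ballI)
    fix B assume B: "B \<in> UNIV - {b}"
    have iB: "L[i := B] ! i = B" "B \<in> set (L[i := B])"
      using i L by (auto simp: set_update_memI)
    have "F (L[i := B]) = 0"
    proof (cases "B \<in> set L")
      case True
      then obtain l where l: "l < k" "L ! l = B" using L by (auto simp: in_set_conv_nth)
      then have "l \<noteq> i" using i B by auto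
      then have "L[i := B] ! l = L[i := B] ! i" using l i iB by simp
      then have "\<not> distinct (L[i := B])"
        using \<open>l \<noteq> i\<close> l i L by (metis length_list_update nth_eq_iff_index_eq)
      then show ?thesis using alternating_form_not_distinct[OF F(1)] by blast
    next
      case False
      then show ?thesis using F(2) iB by blast
    qed
    then show "W $ B $ a * F (L[i := B]) = 0" by simp
  qed auto
  also have "\<dots> = W $ b $ a * F L" using i by auto
  finally show "W $ b $ a = 0" using H[rule_format, of "L[i := a]"] L by simp
next
  fix As :: "'i list" assume W: "\<forall>b\<in>set L. \<forall>a. a \<notin> set L \<longrightarrow> W $ b $ a = 0" and l: "length As = k"
  show "form_act W F As = 0"
  proof (cases "set As \<subseteq> set L")
    case False
    then obtain i where i: "i < k" "As ! i \<notin> set L" using l by (metis in_set_conv_nth subsetI)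
    show ?thesis unfolding form_act_def
    proof (intro sum.neutral ballI)
      fix j B assume j: "j \<in> {..<length As}"
      have "As ! j \<in> set L \<Longrightarrow> \<not> set (As[j := B]) \<subseteq> set L"
        using i l j by (metis length_list_update nth_list_update_neq nth_mem subsetD)
      moreover have "B \<notin> set L \<Longrightarrow> \<not> set (As[j := B]) \<subseteq> set L"
        using j set_update_memI by fastforce
      ultimately show "W $ B $ (As ! j) * F (As[j := B]) = 0" using W F(2) by (metis mult_zero_left mult_zero_right)
    qed
  next
    case sub: True
    show ?thesis
    proof (cases "distinct As")
      case True
      have "mset As = mset L" using sub True L l by (intro mset_eq_of_distinct_subset) auto
      then have sL: "set As = set L" by (rule mset_eq_setD)
      show ?thesis unfolding form_act_def
      proof (intro sum.neutral ballI)
        fix j B assume j: "j \<in> {..<length As}"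
        \<comment> \<open>Any \<open>B\<close> other than the old entry produces a foreign or a
          repeated index; the remaining term carries a diagonal entry of \<open>W\<close>.\<close>
        consider "B = As ! j" | "B \<notin> set L" | "B \<in> set L" "B \<noteq> As ! j" by blast
        then show "W $ B $ (As ! j) * F (As[j := B]) = 0"
        proof cases
          case 2
          moreover have "B \<in> set (As[j := B])" using j by (simp add: set_update_memI)
          ultimately have "F (As[j := B]) = 0" using F(2) by blast
          then show ?thesis by simp
        next
          case 3
          then obtain l where l: "l < length As" "As ! l = B" using sL by (metis in_set_conv_nth)
          then have "l \<noteq> j" using 3 by auto
          then have "As[j := B] ! l = As[j := B] ! j" using l j by simp
          then have "\<not> distinct (As[j := B])"
            using \<open>l \<noteq> j\<close> l j by (metis length_list_update lessThan_iff nth_eq_iff_index_eq)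
          then show ?thesis using alternating_form_not_distinct[OF F(1)] by simp
        qed (simp add: tr)
      qed
    next
      case False
      then obtain i j where ij: "i < k" "j < k" "i \<noteq> j" "As ! i = As ! j"
        using l by (auto simp: distinct_conv_nth)
      \<comment> \<open>A repetition survives unless one of its two slots is overwritten, and the
        two resulting terms cancel because \<open>F\<close> alternates.\<close>
      have "form_act W F As = (\<Sum>m\<in>{i, j}. \<Sum>B\<in>UNIV. W $ B $ (As ! m) * F (As[m := B]))"
        unfolding form_act_def
      proof (intro sum.mono_neutral_right ballI sum.neutral)
        fix m B assume "m \<in> {..<length As} - {i, j}"
        then have "As[m := B] ! i = As[m := B] ! j" using ij l by simp
        then have "\<not> distinct (As[m := B])"
          using ij l by (metis length_list_update nth_eq_iff_index_eq)
        then show "W $ B $ (As ! m) * F (As[m := B]) = 0"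
          using alternating_form_not_distinct[OF F(1)] by simp
      qed (use ij l in auto)
      moreover have "F (As[i := B]) = - F (As[j := B])" for B
      proof -
        have "As[i := B] = As[j := B, i := As[j := B] ! j, j := As[j := B] ! i]"
          using ij l by (intro nth_equalityI) (auto simp: nth_list_update)
        then show ?thesis
          using alternating_form_swap[OF F(1), of i "As[j := B]" j] ij l by simp
      qed
      ultimately show ?thesis using ij by (simp add: sum_negf)
    qed
  qed
qed

section \<open>Calculus: closure properties of smooth maps and of covariant operations on
  components\<close>

section \<open>Smooth functions\<close>

lemma ck_on_cong:
  assumes "open S" "\<And>x. x \<in> S \<Longrightarrow> f x = g x" "ck_on k S f"
  shows "ck_on k S g"
  using assms(2,3)
proof (induction k arbitrary: f g)
  case 0
  then show ?case by (metis ck_on.simps(1) continuous_on_cong)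
next
  case (Suc k)
  have d: "(g has_derivative frechet_derivative f (at x)) (at x)" if "x \<in> S" for x
  proof (rule has_derivative_transform_within_open[OF _ assms(1) that])
    show "(f has_derivative frechet_derivative f (at x)) (at x)"
      using Suc.prems(2) that by (simp add: frechet_derivative_works[symmetric])
  qed (rule Suc.prems(1))
  have fd: "frechet_derivative f (at x) = frechet_derivative g (at x)" if "x \<in> S" for x
    using d[OF that] by (rule frechet_derivative_at)
  show ?case
    unfolding ck_on.simps
  proof (intro conjI ballI allI)
    show "g differentiable at x" if "x \<in> S" for x
      using d[OF that] by (rule differentiableI)
    show "ck_on k S (\<lambda>x. frechet_derivative g (at x) v)" for v
    proof (rule Suc.IH)
      show "ck_on k S (\<lambda>x. frechet_derivative f (at x) v)" using Suc.prems(2) by simp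
    qed (simp only: fd)
  qed
qed

text \<open>Lets any explicit formula for the derivative stand in for the chosen function
  \<open>frechet_derivative\<close>, which is what makes the inductions on \<open>k\<close> below
  possible.\<close>

lemma ck_on_SucI:
  assumes "open S" "\<And>x. x \<in> S \<Longrightarrow> (f has_derivative D x) (at x)" "\<And>v. ck_on k S (\<lambda>x. D x v)"
  shows "ck_on (Suc k) S f"
proof -
  have fd: "D x = frechet_derivative f (at x)" if "x \<in> S" for x
    using assms(2)[OF that] by (rule frechet_derivative_at)
  show ?thesis unfolding ck_on.simps
  proof (intro conjI ballI allI)
    show "f differentiable at x" if "x \<in> S" for x
      using assms(2)[OF that] by (rule differentiableI)
    show "ck_on k S (\<lambda>x. frechet_derivative f (at x) v)" for v
      by (rule ck_on_cong[OF assms(1) _ assms(3)]) (simp add: fd)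
  qed
qed

lemma ck_on_SucD:
  assumes "ck_on (Suc k) S f"
  shows "\<And>x. x \<in> S \<Longrightarrow> (f has_derivative frechet_derivative f (at x)) (at x)"
    "\<And>v. ck_on k S (\<lambda>x. frechet_derivative f (at x) v)"
  using assms by (auto simp: frechet_derivative_works[symmetric])

lemma ck_on_Suc_imp: "ck_on (Suc k) S f \<Longrightarrow> ck_on k S f"
proof (induction k arbitrary: f)
  case 0
  then show ?case
    by (auto intro!: differentiable_imp_continuous_on simp: differentiable_on_def differentiable_at_withinI)
next
  case (Suc k)
  then show ?case by simp
qed

lemma ck_on_const: "open S \<Longrightarrow> ck_on k S (\<lambda>x. c)"
proof (induction k arbitrary: c)
  case (Suc k)
  then show ?case by (intro ck_on_SucI[where D="\<lambda>x v. 0"]) auto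
qed simp

lemma ck_on_bounded_linear:
  assumes L: "bounded_linear L" and S: "open S"
  shows "ck_on k S f \<Longrightarrow> ck_on k S (\<lambda>x. L (f x))"
proof (induction k arbitrary: f)
  case 0
  then show ?case by (auto intro!: linear_continuous_on_compose bounded_linear.linear L
        bounded_linear.continuous_on[OF L])
next
  case (Suc k)
  note D = ck_on_SucD[OF Suc.prems]
  show ?case
    by (rule ck_on_SucI[OF S bounded_linear.has_derivative[OF L D(1)]]) (auto intro: Suc.IH D(2))
qed

lemma ck_on_add:
  assumes S: "open S"
  shows "ck_on k S f \<Longrightarrow> ck_on k S g \<Longrightarrow> ck_on k S (\<lambda>x. f x + g x)"
proof (induction k arbitrary: f g)
  case 0
  then show ?case by (auto intro!: continuous_on_add)
next
  case (Suc k)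
  note D = ck_on_SucD[OF Suc.prems(1)] ck_on_SucD[OF Suc.prems(2)]
  show ?case
    by (rule ck_on_SucI[OF S has_derivative_add[OF D(1) D(3)]]) (auto intro: Suc.IH D(2,4))
qed

lemma ck_on_bounded_bilinear:
  assumes B: "bounded_bilinear B" and S: "open S"
  shows "ck_on k S f \<Longrightarrow> ck_on k S g \<Longrightarrow> ck_on k S (\<lambda>x. B (f x) (g x))"
proof (induction k arbitrary: f g)
  case 0
  then show ?case by (auto intro: bounded_bilinear.continuous_on[OF B])
next
  case (Suc k)
  note D = ck_on_SucD[OF Suc.prems(1)] ck_on_SucD[OF Suc.prems(2)]
  have "ck_on k S (\<lambda>x. B (f x) (frechet_derivative g (at x) v) + B (frechet_derivative f (at x) v) (g x))" for v
    by (intro ck_on_add[OF S] Suc.IH D ck_on_Suc_imp[OF Suc.prems(1)] ck_on_Suc_imp[OF Suc.prems(2)])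
  then show ?case
    by (intro ck_on_SucI[OF S bounded_bilinear.FDERIV[OF B D(1) D(3)]]) assumption+
qed

lemma ck_on_sum:
  assumes "open S" "\<And>i. i \<in> I \<Longrightarrow> ck_on k S (f i)"
  shows "ck_on k S (\<lambda>x. \<Sum>i\<in>I. f i x)"
  using assms(2)
  by (induction I rule: infinite_finite_induct) (auto intro: ck_on_const ck_on_add assms(1))

text \<open>The derivative contains the inverse itself, which is already of class \<open>k\<close>
  by the induction hypothesis. The square root below works in the same way.\<close>

lemma ck_on_inverse:
  fixes f :: "'x::euclidean_space \<Rightarrow> real"
  assumes S: "open S" and nz: "\<And>x. x \<in> S \<Longrightarrow> f x \<noteq> 0"
  shows "ck_on k S f \<Longrightarrow> ck_on k S (\<lambda>x. inverse (f x))"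
proof (induction k)
  case 0
  then show ?case using nz by (auto intro: continuous_on_inverse)
next
  case (Suc k)
  note D = ck_on_SucD[OF Suc.prems] and m = ck_on_bounded_bilinear[OF bounded_bilinear_mult S]
  have i: "ck_on k S (\<lambda>x. inverse (f x))" using Suc ck_on_Suc_imp by blast
  have "ck_on k S (\<lambda>x. (-1) * (inverse (f x) * frechet_derivative f (at x) v * inverse (f x)))" for v
    by (intro m i D(2) ck_on_const[OF S])
  then show ?case
    by (intro ck_on_SucI[OF S Deriv.has_derivative_inverse[OF nz D(1)]]) simp_all
qed

lemma ck_on_sqrt:
  assumes S: "open S" and nz: "\<And>x. x \<in> S \<Longrightarrow> f x > 0"
  shows "ck_on k S f \<Longrightarrow> ck_on k S (\<lambda>x. sqrt (f x))"
proof (induction k)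
  case 0
  then show ?case by (auto intro: continuous_on_real_sqrt)
next
  case (Suc k)
  note D = ck_on_SucD[OF Suc.prems] and m = ck_on_bounded_bilinear[OF bounded_bilinear_mult S]
  have i: "ck_on k S (\<lambda>x. inverse (sqrt (f x)))"
    using Suc ck_on_Suc_imp[OF Suc.prems] nz by (intro ck_on_inverse[OF S]) force+
  have "((\<lambda>x. sqrt (f x)) has_derivative (\<lambda>v. 1/2 * (inverse (sqrt (f x)) * frechet_derivative f (at x) v))) (at x)"
    if "x \<in> S" for x
  proof -
    have "a * (b / 2) = 1/2 * (b * a)" for a b :: real by simp
    with has_derivative_real_sqrt[OF nz[OF that] D(1)[OF that]] show ?thesis
      by (simp only:)
  qed
  moreover have "ck_on k S (\<lambda>x. 1/2 * (inverse (sqrt (f x)) * frechet_derivative f (at x) v))" for v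
    by (intro m i D(2) ck_on_const[OF S])
  ultimately show ?case by (rule ck_on_SucI[OF S])
qed

lemma ck_on_compose:
  fixes f :: "'x::euclidean_space \<Rightarrow> 'y::real_normed_vector" and x :: "'t::euclidean_space \<Rightarrow> 'x"
  assumes S: "open S" and U: "open U" and x: "x ` S \<subseteq> U"
  shows "ck_on k U f \<Longrightarrow> ck_on k S x \<Longrightarrow> ck_on k S (\<lambda>t. f (x t))"
proof (induction k arbitrary: f)
  case 0
  then show ?case using x by (auto intro: continuous_on_compose2)
next
  case (Suc k)
  note D = ck_on_SucD[OF Suc.prems(1)] ck_on_SucD[OF Suc.prems(2)]
  \<comment> \<open>\<open>ck_on\<close> controls derivatives in fixed directions only, whereas the
    chain rule differentiates \<open>f\<close> in a direction that moves with \<open>t\<close>.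
    Expanding this direction in \<open>Basis\<close> leaves fixed directions with moving
    coefficients.\<close>
  have "((\<lambda>t. f (x t)) has_derivative (\<lambda>v. \<Sum>b\<in>Basis.
      (frechet_derivative x (at t) v \<bullet> b) *\<^sub>R frechet_derivative f (at (x t)) b)) (at t)"
    if "t \<in> S" for t
  proof (rule has_derivative_eq_rhs)
    show "((\<lambda>t. f (x t)) has_derivative (\<lambda>v. frechet_derivative f (at (x t)) (frechet_derivative x (at t) v))) (at t)"
      using has_derivative_compose[OF D(3)[OF that] D(1)] that x by blast
    have "linear (frechet_derivative f (at (x t)))"
      using D(1)[of "x t"] that x has_derivative_linear by blast
    then have "frechet_derivative f (at (x t)) w = (\<Sum>b\<in>Basis. (w \<bullet> b) *\<^sub>R frechet_derivative f (at (x t)) b)" for w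
      using linear_sum[of "frechet_derivative f (at (x t))" "\<lambda>b. (w \<bullet> b) *\<^sub>R b" Basis]
      by (simp only: euclidean_representation linear_scale)
    then show "(\<lambda>v. frechet_derivative f (at (x t)) (frechet_derivative x (at t) v)) =
       (\<lambda>v. \<Sum>b\<in>Basis. (frechet_derivative x (at t) v \<bullet> b) *\<^sub>R frechet_derivative f (at (x t)) b)"
      by (rule ext)
  qed
  moreover have "ck_on k S (\<lambda>t. \<Sum>b\<in>Basis.
      (frechet_derivative x (at t) v \<bullet> b) *\<^sub>R frechet_derivative f (at (x t)) b)" for v
    by (intro ck_on_sum[OF S] ck_on_bounded_bilinear[OF bounded_bilinear_scaleR S]
        ck_on_bounded_linear[OF bounded_linear_inner_left S] D(4) Suc.IH[OF D(2)]
        ck_on_Suc_imp[OF Suc.prems(2)])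
  ultimately show ?case by (rule ck_on_SucI[OF S])
qed

named_theorems smooth_intros

lemma smooth_on_cong: "open S \<Longrightarrow> (\<And>x. x \<in> S \<Longrightarrow> f x = g x) \<Longrightarrow> smooth_on S f \<Longrightarrow> smooth_on S g"
  unfolding smooth_on_def using ck_on_cong by blast

lemma smooth_on_const [smooth_intros]: "open S \<Longrightarrow> smooth_on S (\<lambda>x. c)"
  by (simp add: smooth_on_def ck_on_const)

lemma smooth_on_add [smooth_intros]:
  "open S \<Longrightarrow> smooth_on S f \<Longrightarrow> smooth_on S g \<Longrightarrow> smooth_on S (\<lambda>x. f x + g x)"
  by (simp add: smooth_on_def ck_on_add)

lemma smooth_on_bounded_linear:
  "bounded_linear L \<Longrightarrow> open S \<Longrightarrow> smooth_on S f \<Longrightarrow> smooth_on S (\<lambda>x. L (f x))"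
  by (simp add: smooth_on_def ck_on_bounded_linear)

lemma smooth_on_bounded_bilinear:
  "bounded_bilinear B \<Longrightarrow> open S \<Longrightarrow> smooth_on S f \<Longrightarrow> smooth_on S g \<Longrightarrow> smooth_on S (\<lambda>x. B (f x) (g x))"
  by (simp add: smooth_on_def ck_on_bounded_bilinear)

lemmas smooth_on_minus [smooth_intros] = smooth_on_bounded_linear[OF bounded_linear_minus[OF bounded_linear_ident]]
lemmas smooth_on_vec_nth [smooth_intros] = smooth_on_bounded_linear[OF bounded_linear_vec_nth]
lemmas smooth_on_mult [smooth_intros] = smooth_on_bounded_bilinear[OF bounded_bilinear_mult[where 'a = real]]
lemmas smooth_on_scaleR [smooth_intros] = smooth_on_bounded_bilinear[OF bounded_bilinear_scaleR]
lemmas smooth_on_inner [smooth_intros] = smooth_on_bounded_bilinear[OF bounded_bilinear_inner]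

lemma smooth_on_diff [smooth_intros]:
  "open S \<Longrightarrow> smooth_on S f \<Longrightarrow> smooth_on S g \<Longrightarrow> smooth_on S (\<lambda>x. f x - g x)"
  using smooth_on_add[of S f "\<lambda>x. - g x"] smooth_on_minus[of S g] by simp

lemma smooth_on_sum [smooth_intros]:
  "open S \<Longrightarrow> (\<And>i. i \<in> I \<Longrightarrow> smooth_on S (f i)) \<Longrightarrow> smooth_on S (\<lambda>x. \<Sum>i\<in>I. f i x)"
  by (simp add: smooth_on_def ck_on_sum)

lemma smooth_on_prod [smooth_intros]:
  fixes f :: "'i \<Rightarrow> 'x::euclidean_space \<Rightarrow> real"
  assumes "open S" "\<And>i. i \<in> I \<Longrightarrow> smooth_on S (f i)"
  shows "smooth_on S (\<lambda>x. \<Prod>i\<in>I. f i x)"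
  using assms(2)
  by (induction I rule: infinite_finite_induct) (auto intro: smooth_on_const smooth_on_mult assms(1))

lemma smooth_on_divide [smooth_intros]:
  fixes f g :: "'x::euclidean_space \<Rightarrow> real"
  assumes "open S" "smooth_on S f" "smooth_on S g" "\<And>x. x \<in> S \<Longrightarrow> g x \<noteq> 0"
  shows "smooth_on S (\<lambda>x. f x / g x)"
proof -
  have "smooth_on S (\<lambda>x. inverse (g x))"
    using assms by (simp add: smooth_on_def ck_on_inverse)
  then show ?thesis using smooth_on_mult assms by (simp add: divide_inverse)
qed

lemma smooth_on_sqrt [smooth_intros]:
  "open S \<Longrightarrow> smooth_on S f \<Longrightarrow> (\<And>x. x \<in> S \<Longrightarrow> f x > 0) \<Longrightarrow> smooth_on S (\<lambda>x. sqrt (f x))"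
  by (simp add: smooth_on_def ck_on_sqrt)

lemma smooth_on_compose:
  "open S \<Longrightarrow> open U \<Longrightarrow> x ` S \<subseteq> U \<Longrightarrow> smooth_on U f \<Longrightarrow> smooth_on S x \<Longrightarrow> smooth_on S (\<lambda>t. f (x t))"
  by (simp add: smooth_on_def ck_on_compose)

lemma bounded_linear_axis: "bounded_linear (\<lambda>y. axis i y :: ('y::real_normed_vector)^'i::finite)"
proof (rule bounded_linear_intro[where K=1])
  fix y :: 'y
  have "norm (axis i y :: 'y^'i) \<le> (\<Sum>j\<in>UNIV. norm ((axis i y :: 'y^'i) $ j))"
    unfolding norm_vec_def by (rule L2_set_le_sum) simp
  also have "\<dots> = (\<Sum>j\<in>UNIV. if j = i then norm y else 0)"
    by (rule sum.cong) (auto simp: axis_def)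
  finally show "norm (axis i y :: 'y^'i) \<le> norm y * 1" by simp
qed (auto simp: vec_eq_iff axis_def)

lemma smooth_on_vec_lambda [smooth_intros]:
  fixes f :: "'i::finite \<Rightarrow> 'x::euclidean_space \<Rightarrow> 'y::real_normed_vector"
  assumes S: "open S" and f: "\<And>i. smooth_on S (f i)"
  shows "smooth_on S (\<lambda>x. \<chi> i. f i x)"
proof -
  have "(\<chi> i. f i x) = (\<Sum>i\<in>UNIV. axis i (f i x))" for x
    by (simp add: vec_eq_iff axis_def sum.delta)
  then show ?thesis
    by (simp only:) (intro smooth_on_sum S smooth_on_bounded_linear[OF bounded_linear_axis] f)
qed

lemma smooth_on_matrix_vector_mult [smooth_intros]:
  fixes M :: "'x::euclidean_space \<Rightarrow> real^'n::finite^'m::finite"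
  assumes "open S" "smooth_on S M" "smooth_on S v"
  shows "smooth_on S (\<lambda>x. M x *v v x)"
  unfolding matrix_vector_mult_def using assms by (intro smooth_intros) auto

lemma smooth_on_det [smooth_intros]:
  fixes M :: "'x::euclidean_space \<Rightarrow> real^'n::finite^'n"
  assumes "open S" "smooth_on S M"
  shows "smooth_on S (\<lambda>x. det (M x))"
  unfolding det_def using assms by (intro smooth_intros) auto

lemma matrix_inv_right_left:
  fixes M :: "real^'n::finite^'n"
  assumes "invertible M"
  shows "M ** matrix_inv M = mat 1" "matrix_inv M ** M = mat 1"
  using assms unfolding invertible_def matrix_inv_def by (metis (mono_tags, lifting) someI_ex)+

text \<open>\<open>matrix_inv\<close> is a choice operator; Cramer's rule exhibits its entries as
  quotients of determinants, from which smoothness can be read off.\<close>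

lemma matrix_inv_cramer:
  fixes M :: "real^'n::finite^'n"
  assumes "det M \<noteq> 0"
  shows "matrix_inv M $ k $ l = det (\<chi> i j. if j = k then of_bool (i = l) else M $ i $ j) / det M"
proof -
  have "M *v (matrix_inv M *v axis l 1) = axis l 1"
    using assms by (simp add: matrix_vector_mul_assoc matrix_inv_right_left invertible_det_nz)
  then have "matrix_inv M *v axis l 1 = (\<chi> k. det (\<chi> i j. if j = k then axis l 1 $ i else M $ i $ j) / det M)"
    by (simp only: cramer[OF assms])
  then have "(matrix_inv M *v axis l 1) $ k = det (\<chi> i j. if j = k then axis l 1 $ i else M $ i $ j) / det M"
    by simp
  moreover have "axis l (1::real) $ i = of_bool (i = l)" for i by (simp add: axis_def)
  ultimately show ?thesis by (simp only: matrix_vector_mult_basis column_def vec_lambda_beta)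
qed

lemma smooth_on_matrix_inv [smooth_intros]:
  fixes M :: "'x::euclidean_space \<Rightarrow> real^'n::finite^'n"
  assumes S: "open S" and M: "smooth_on S M" and d: "\<And>x. x \<in> S \<Longrightarrow> det (M x) \<noteq> 0"
  shows "smooth_on S (\<lambda>x. matrix_inv (M x))"
proof (rule smooth_on_cong[OF S])
  have "smooth_on S (\<lambda>x. if j = k then of_bool (i = l) else M x $ i $ j)" for i j k l
    using S M by (cases "j = k") (auto intro!: smooth_intros)
  then show "smooth_on S (\<lambda>x. \<chi> k l. det (\<chi> i j. if j = k then of_bool (i = l) else M x $ i $ j) / det (M x))"
    using S M d by (intro smooth_intros) auto
qed (auto simp: vec_eq_iff matrix_inv_cramer d)

lemma smooth_on_frechet_derivative:
  "smooth_on S f \<Longrightarrow> smooth_on S (\<lambda>x. frechet_derivative f (at x) v)"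
  unfolding smooth_on_def using ck_on.simps(2) by blast

lemma smooth_on_pderiv_at: "smooth_on S f \<Longrightarrow> smooth_on S (pderiv_at a f)"
  using smooth_on_frechet_derivative by (auto simp: pderiv_at_def[abs_def])

lemma smooth_on_has_derivative:
  "smooth_on S f \<Longrightarrow> x \<in> S \<Longrightarrow> (f has_derivative frechet_derivative f (at x)) (at x)"
  unfolding smooth_on_def using ck_on_SucD(1) by blast

lemma smooth_on_has_vector_derivative:
  fixes f :: "real \<Rightarrow> 'y::real_normed_vector"
  shows "smooth_on S f \<Longrightarrow> t \<in> S \<Longrightarrow> (f has_vector_derivative vector_derivative f (at t)) (at t)"
  using smooth_on_has_derivative by (metis differentiableI vector_derivative_works)

lemma smooth_on_vector_derivative:
  fixes f :: "real \<Rightarrow> 'y::real_normed_vector"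
  assumes S: "open S" and f: "smooth_on S f"
  shows "smooth_on S (\<lambda>t. vector_derivative f (at t))"
proof (rule smooth_on_cong[OF S _ smooth_on_frechet_derivative[OF f, of 1]])
  fix t assume "t \<in> S"
  then have "(f has_derivative (\<lambda>h. h *\<^sub>R vector_derivative f (at t))) (at t)"
    using smooth_on_has_vector_derivative[OF f] by (simp add: has_vector_derivative_def)
  from frechet_derivative_at[OF this] show "frechet_derivative f (at t) 1 = vector_derivative f (at t)"
    by (metis scaleR_one)
qed

section \<open>Bilinear forms and derivatives of vector functions\<close>

lemma bilin_simps:
  "bilin B (v + v') w = bilin B v w + bilin B v' w"
  "bilin B v (w + w') = bilin B v w + bilin B v w'"
  "bilin B (v - v') w = bilin B v w - bilin B v' w"
  "bilin B v (w - w') = bilin B v w - bilin B v w'"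
  "bilin B (- v) w = - bilin B v w"
  "bilin B v (- w) = - bilin B v w"
  "bilin B (c *\<^sub>R v) w = c * bilin B v w"
  "bilin B v (c *\<^sub>R w) = c * bilin B v w"
  "bilin B 0 w = 0"
  "bilin B v 0 = 0"
  for v v' w w' :: "real^'m::finite"
  using matrix_vector_mult_scaleR[of B "-1" w]
  by (simp_all add: bilin_def inner_add inner_diff matrix_vector_right_distrib
      matrix_vector_mult_diff_distrib matrix_vector_mult_scaleR)

lemma bilin_sum:
  "bilin B (\<Sum>i\<in>I. f i) w = (\<Sum>i\<in>I. bilin B (f i) w)"
  "bilin B v (\<Sum>i\<in>I. f i) = (\<Sum>i\<in>I. bilin B v (f i))"
  for v w :: "real^'m::finite"
  by (induction I rule: infinite_finite_induct) (simp_all add: bilin_simps)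

lemma bilin_commute: "transpose B = B \<Longrightarrow> bilin B v w = bilin B w v"
  for v w :: "real^'m::finite"
  unfolding bilin_def by (metis dot_lmul_matrix inner_commute transpose_matrix_vector vector_transpose_matrix)

lemma bounded_bilinear_matrix_vector_mult:
  "bounded_bilinear ((*v) :: real^'n::finite^'m::finite \<Rightarrow> real^'n \<Rightarrow> real^'m)"
  unfolding bilinear_conv_bounded_bilinear[symmetric] bilinear_def
  by (auto intro!: linearI simp: matrix_vector_right_distrib matrix_vector_mult_add_rdistrib
      scaleR_matrix_vector_assoc matrix_vector_mult_scaleR)

lemma bounded_bilinear_matrix_matrix_mult:
  "bounded_bilinear ((**) :: real^'n::finite^'m::finite \<Rightarrow> real^'k::finite^'n \<Rightarrow> real^'k^'m)"
  unfolding bilinear_conv_bounded_bilinear[symmetric] bilinear_def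
  by (auto intro!: linearI simp: matrix_add_ldistrib matrix_scalar_ac scalar_matrix_assoc
      vec_eq_iff matrix_matrix_mult_def algebra_simps sum.distrib sum_distrib_left)

lemmas has_vector_derivative_matrix_vector_mult =
  bounded_bilinear.has_vector_derivative[OF bounded_bilinear_matrix_vector_mult]
lemmas has_vector_derivative_matrix_matrix_mult =
  bounded_bilinear.has_vector_derivative[OF bounded_bilinear_matrix_matrix_mult]
lemmas has_vector_derivative_inner =
  bounded_bilinear.has_vector_derivative[OF bounded_bilinear_inner]
lemmas has_vector_derivative_vec_nth =
  bounded_linear.has_vector_derivative[OF bounded_linear_vec_nth]

lemma has_vector_derivative_vecI:
  fixes f :: "real \<Rightarrow> 'y::real_normed_vector^'i::finite"
  assumes "\<And>i. ((\<lambda>s. f s $ i) has_vector_derivative f' $ i) F"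
  shows "(f has_vector_derivative f') F"
proof -
  have e: "y = (\<Sum>i\<in>UNIV. axis i (y $ i))" for y :: "'y^'i"
    by (simp add: vec_eq_iff axis_def sum.delta)
  have "((\<lambda>s. \<Sum>i\<in>UNIV. axis i (f s $ i)) has_vector_derivative (\<Sum>i\<in>UNIV. axis i (f' $ i))) F"
    by (intro has_vector_derivative_sum bounded_linear.has_vector_derivative[OF bounded_linear_axis] assms)
  then show ?thesis by (simp flip: e)
qed

section \<open>Positive definite matrices\<close>

definition spd :: "real^'n::finite^'n \<Rightarrow> bool" where
  "spd B \<longleftrightarrow> transpose B = B \<and> (\<forall>v. v \<noteq> 0 \<longrightarrow> bilin B v v > 0)"

lemma spd_commute: "spd B \<Longrightarrow> bilin B v w = bilin B w v"
  unfolding spd_def by (blast intro: bilin_commute)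

lemma spd_pos: "spd B \<Longrightarrow> v \<noteq> 0 \<Longrightarrow> bilin B v v > 0"
  by (simp add: spd_def)

lemma spd_nth: "spd B \<Longrightarrow> B $ i $ j = B $ j $ i"
  unfolding spd_def transpose_def by (simp add: vec_eq_iff)

lemma spd_eq_0_iff: "spd B \<Longrightarrow> bilin B v v = 0 \<longleftrightarrow> v = 0"
  by (cases "v = 0") (use spd_pos[of B v] in \<open>auto simp: bilin_simps\<close>)

lemma spd_invertible: "spd B \<Longrightarrow> invertible B"
proof -
  assume B: "spd B"
  have "v = 0" if "B *v v = 0" for v
    using B that spd_pos[of B v] by (force simp: bilin_def)
  then show ?thesis
    by (metis invertible_left_inverse matrix_left_invertible_ker)
qed

lemma spd_matrix_inv:
  assumes "spd B"
  shows "B ** matrix_inv B = mat 1" "matrix_inv B ** B = mat 1"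
  using matrix_inv_right_left[OF spd_invertible[OF assms]] by auto

text \<open>Two candidates differ by an element of \<open>S\<close> that is orthogonal to itself.
  Anisotropy is asked on \<open>S\<close> alone, because the tractor metric is indefinite on the
  whole space.\<close>

lemma orth_proj_eqI:
  fixes v :: "real^'m::finite"
  assumes "\<And>s s'. s \<in> S \<Longrightarrow> s' \<in> S \<Longrightarrow> s - s' \<in> S"
    and "\<And>s. s \<in> S \<Longrightarrow> bilin B s s = 0 \<Longrightarrow> s = 0"
    and "w \<in> S" "\<And>s. s \<in> S \<Longrightarrow> bilin B (v - w) s = 0"
  shows "orth_proj B S v = w"
  unfolding orth_proj_def
proof (rule the_equality)
  fix w' assume w': "w' \<in> S \<and> (\<forall>s\<in>S. bilin B (v - w') s = 0)"
  have "w' - w \<in> S" using assms(1,3) w' by blast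
  then have "bilin B (v - w) (w' - w) = 0" "bilin B (v - w') (w' - w) = 0"
    using assms(4) w' by blast+
  then have "bilin B (w' - w) (w' - w) = 0" by (simp add: bilin_simps)
  with assms(2) \<open>w' - w \<in> S\<close> show "w' = w" by force
qed (use assms in blast)

section \<open>Riemannian geometry along a curve, up to the normal part of the circle
  equation\<close>

section \<open>Curves in a coordinate region\<close>

definition conn_matrix :: "(real^'n \<Rightarrow> real^'n^'n::finite) \<Rightarrow> (real \<Rightarrow> real^'n) \<Rightarrow> real \<Rightarrow> real^'n^'n" where
  "conn_matrix G x t = (\<chi> c b. \<Sum>a\<in>UNIV. christoffel G (x t) c a b * velocity x t $ a)"

lemma cov_deriv_conn_matrix:
  "cov_deriv G x X t = vector_derivative X (at t) + conn_matrix G x t *v X t"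
  unfolding cov_deriv_def conn_matrix_def matrix_vector_mult_def
  by (simp add: vec_eq_iff sum_distrib_right) (subst sum.swap, simp)

text \<open>One chart, one scale and one parametrisation. The conditions collected by
  \<open>holds_along\<close> are pointwise in all three, so most of the proof can take place here
  without mentioning the manifold.\<close>

locale curve_in_metric =
  fixes G :: "real^'n::finite \<Rightarrow> real^'n^'n" and U :: "(real^'n) set"
    and x :: "real \<Rightarrow> real^'n" and T :: "real set"
  assumes open_U: "open U" and smooth_G: "smooth_on U G" and spd_G: "\<And>y. y \<in> U \<Longrightarrow> spd (G y)"
    and open_T: "open T" and smooth_x: "smooth_on T x" and x_in_U: "\<And>t. t \<in> T \<Longrightarrow> x t \<in> U"
    and velocity_nonzero: "\<And>t. t \<in> T \<Longrightarrow> velocity x t \<noteq> 0"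
begin

abbreviation "ip t \<equiv> bilin (G (x t))"
abbreviation "u \<equiv> velocity x"
abbreviation "D \<equiv> cov_deriv G x"
abbreviation "H \<equiv> mean_curvature G x"

lemma spd_x: "t \<in> T \<Longrightarrow> spd (G (x t))"
  using spd_G x_in_U by blast

lemmas ip_commute = spd_commute[OF spd_x]

lemma speed_pos: "t \<in> T \<Longrightarrow> ip t (u t) (u t) > 0"
  using spd_pos[OF spd_x velocity_nonzero] by blast

lemma eventually_T: "t \<in> T \<Longrightarrow> eventually (\<lambda>s. s \<in> T) (nhds t)"
  using open_T by (rule eventually_nhds_in_open)

lemma smooth_along: "smooth_on U f \<Longrightarrow> smooth_on T (\<lambda>t. f (x t))"
  by (rule smooth_on_compose[OF open_T open_U _ _ smooth_x]) (auto simp: x_in_U)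

lemma smooth_inv_G: "smooth_on U (\<lambda>y. matrix_inv (G y))"
  using open_U smooth_G spd_G spd_invertible invertible_det_nz
  by (intro smooth_intros) blast+

lemma smooth_christoffel: "smooth_on U (\<lambda>y. christoffel G y c a b)"
  unfolding christoffel_def
  by (intro smooth_intros open_U smooth_inv_G smooth_on_pderiv_at smooth_G)

lemma smooth_u: "smooth_on T u"
  unfolding velocity_def[abs_def] by (rule smooth_on_vector_derivative[OF open_T smooth_x])

lemma smooth_conn_matrix: "smooth_on T (conn_matrix G x)"
  unfolding conn_matrix_def
  by (intro smooth_intros open_T smooth_along[OF smooth_christoffel] smooth_u)

lemma smooth_D: "smooth_on T X \<Longrightarrow> smooth_on T (D X)"
  unfolding cov_deriv_conn_matrix[abs_def]
  by (intro smooth_intros open_T smooth_conn_matrix smooth_on_vector_derivative)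

lemma smooth_ip: "smooth_on T X \<Longrightarrow> smooth_on T Y \<Longrightarrow> smooth_on T (\<lambda>t. ip t (X t) (Y t))"
  unfolding bilin_def by (intro smooth_intros open_T smooth_along[OF smooth_G])

lemma smooth_acceleration: "smooth_on T (acceleration G x)"
  unfolding acceleration_def by (intro smooth_D smooth_u)

text \<open>Lowering the upper index cancels \<open>matrix_inv\<close> and leaves the Christoffel
  symbols of the first kind.\<close>

lemma lower_christoffel:
  assumes y: "y \<in> U"
  shows "(\<Sum>c\<in>UNIV. G y $ e $ c * christoffel G y c a b) = 1/2 *
    (pderiv_at a (\<lambda>z. G z $ b $ e) y + pderiv_at b (\<lambda>z. G z $ a $ e) y - pderiv_at e (\<lambda>z. G z $ a $ b) y)"
proof -
  let ?d = "\<lambda>d. pderiv_at a (\<lambda>z. G z $ b $ d) y + pderiv_at b (\<lambda>z. G z $ a $ d) y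
       - pderiv_at d (\<lambda>z. G z $ a $ b) y"
  have "(\<Sum>c\<in>UNIV. G y $ e $ c * christoffel G y c a b)
      = 1/2 * (\<Sum>c\<in>UNIV. \<Sum>d\<in>UNIV. (G y $ e $ c * matrix_inv (G y) $ c $ d) * ?d d)"
    unfolding christoffel_def sum_distrib_left by (simp add: mult_ac)
  also have "\<dots> = 1/2 * (\<Sum>d\<in>UNIV. (G y ** matrix_inv (G y)) $ e $ d * ?d d)"
    by (subst sum.swap) (simp only: matrix_matrix_mult_def sum_distrib_right vec_lambda_beta)
  also have "\<dots> = 1/2 * (\<Sum>d\<in>UNIV. if d = e then ?d d else 0)"
    unfolding spd_matrix_inv(1)[OF spd_G[OF y]] by (intro arg_cong2[where f="(*)"] sum.cong refl) (auto simp: mat_def)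
  finally show ?thesis by simp
qed

lemma pderiv_at_G_commute:
  assumes y: "y \<in> U"
  shows "pderiv_at a (\<lambda>z. G z $ b $ c) y = pderiv_at a (\<lambda>z. G z $ c $ b) y"
proof -
  have s: "smooth_on U (\<lambda>z. G z $ b $ c)" by (intro smooth_intros open_U smooth_G)
  have "((\<lambda>z. G z $ c $ b) has_derivative frechet_derivative (\<lambda>z. G z $ b $ c) (at y)) (at y)"
    by (rule has_derivative_transform_within_open[OF smooth_on_has_derivative[OF s y] open_U y])
      (use spd_G spd_nth in blast)
  from frechet_derivative_at[OF this] show ?thesis by (simp add: pderiv_at_def)
qed

lemma has_vector_derivative_x: "t \<in> T \<Longrightarrow> (x has_vector_derivative u t) (at t)"
  unfolding velocity_def by (rule smooth_on_has_vector_derivative[OF smooth_x])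

lemma has_vector_derivative_along:
  fixes f :: "real^'n \<Rightarrow> real"
  assumes f: "smooth_on U f" and t: "t \<in> T"
  shows "((\<lambda>s. f (x s)) has_vector_derivative (\<Sum>a\<in>UNIV. u t $ a * pderiv_at a f (x t))) (at t)"
proof -
  have d: "(f has_derivative frechet_derivative f (at (x t))) (at (x t))"
    using smooth_on_has_derivative[OF f x_in_U[OF t]] .
  have "((\<lambda>s. f (x s)) has_vector_derivative frechet_derivative f (at (x t)) (u t)) (at t)"
    using has_derivative_compose[OF has_vector_derivative_x[OF t, unfolded has_vector_derivative_def] d]
    by (simp add: has_vector_derivative_def linear_scale[OF has_derivative_linear[OF d]])
  moreover have "frechet_derivative f (at (x t)) (u t) = (\<Sum>a\<in>UNIV. u t $ a * pderiv_at a f (x t))"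
  proof -
    have lin: "linear (frechet_derivative f (at (x t)))" using d has_derivative_linear by blast
    have "u t = (\<Sum>a\<in>UNIV. u t $ a *\<^sub>R axis a 1)"
      by (simp add: vec_eq_iff axis_def if_distrib cong: if_cong)
    then have "frechet_derivative f (at (x t)) (u t)
        = frechet_derivative f (at (x t)) (\<Sum>a\<in>UNIV. u t $ a *\<^sub>R axis a 1)" by simp
    also have "\<dots> = (\<Sum>a\<in>UNIV. u t $ a * pderiv_at a f (x t))"
      by (simp add: linear_sum[OF lin] linear_scale[OF lin] pderiv_at_def)
    finally show ?thesis .
  qed
  ultimately show ?thesis by simp
qed

text \<open>Metric compatibility of the Levi-Civita connection in matrix form. When the lowered
  Christoffel symbols are added to their transpose, all derivatives cancel in pairs except the one
  in the direction of the velocity.\<close>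

lemma has_vector_derivative_G:
  assumes t: "t \<in> T"
  shows "((\<lambda>s. G (x s)) has_vector_derivative
    transpose (conn_matrix G x t) ** G (x t) + G (x t) ** conn_matrix G x t) (at t)"
proof (intro has_vector_derivative_vecI)
  fix a b
  let ?y = "x t" and ?p = "\<lambda>c a b. pderiv_at c (\<lambda>z. G z $ a $ b) (x t)"
  note y = x_in_U[OF t]
  have s: "smooth_on U (\<lambda>z. G z $ a $ b)" by (intro smooth_intros open_U smooth_G)
  have low: "(G ?y ** conn_matrix G x t) $ e $ b = (\<Sum>a\<in>UNIV. u t $ a *
      (1/2 * (?p a b e + ?p b a e - ?p e a b)))" for e b
  proof -
    have "(G ?y ** conn_matrix G x t) $ e $ b
        = (\<Sum>c\<in>UNIV. \<Sum>a\<in>UNIV. u t $ a * (G ?y $ e $ c * christoffel G ?y c a b))"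
      by (simp add: matrix_matrix_mult_def conn_matrix_def sum_distrib_left mult_ac)
    also have "\<dots> = (\<Sum>a\<in>UNIV. u t $ a * (\<Sum>c\<in>UNIV. G ?y $ e $ c * christoffel G ?y c a b))"
      by (subst sum.swap) (simp add: sum_distrib_left)
    finally show ?thesis unfolding lower_christoffel[OF y] .
  qed
  have tr: "(transpose (conn_matrix G x t) ** G ?y) $ a $ b = (G ?y ** conn_matrix G x t) $ b $ a" for a b
    unfolding matrix_matrix_mult_def transpose_def
    by (simp add: spd_nth[OF spd_G[OF y], of _ b] mult.commute)
  have "(transpose (conn_matrix G x t) ** G ?y + G ?y ** conn_matrix G x t) $ a $ b
      = (\<Sum>c\<in>UNIV. u t $ c * ?p c a b)"
    unfolding vector_add_component tr low sum.distrib[symmetric]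
    by (intro sum.cong refl)
      (simp add: pderiv_at_G_commute[OF y, of _ b a] algebra_simps)
  then show "((\<lambda>s. G (x s) $ a $ b) has_vector_derivative
      (transpose (conn_matrix G x t) ** G ?y + G ?y ** conn_matrix G x t) $ a $ b) (at t)"
    using has_vector_derivative_along[OF s t] by simp
qed

lemma has_vector_derivative_lower:
  assumes t: "t \<in> T" and X: "(X has_vector_derivative X') (at t)"
  shows "((\<lambda>s. G (x s) *v X s) has_vector_derivative
    transpose (conn_matrix G x t) *v (G (x t) *v X t) + G (x t) *v (X' + conn_matrix G x t *v X t)) (at t)"
  using has_vector_derivative_matrix_vector_mult[OF has_vector_derivative_G[OF t] X]
  by (simp add: matrix_vector_mult_add_rdistrib matrix_vector_right_distrib matrix_vector_mul_assoc add_ac)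

lemma has_vector_derivative_ip:
  assumes t: "t \<in> T" and X: "(X has_vector_derivative X') (at t)" and Y: "(Y has_vector_derivative Y') (at t)"
  shows "((\<lambda>s. ip s (X s) (Y s)) has_vector_derivative
    ip t (X' + conn_matrix G x t *v X t) (Y t) + ip t (X t) (Y' + conn_matrix G x t *v Y t)) (at t)"
proof -
  have "X t \<bullet> (transpose M *v w) = (M *v X t) \<bullet> w" for M :: "real^'n^'n" and w
    by (metis dot_lmul_matrix transpose_matrix_vector vector_transpose_matrix)
  then show ?thesis
    using has_vector_derivative_inner[OF X has_vector_derivative_lower[OF t Y]]
    by (simp add: bilin_def inner_add algebra_simps)
qed

lemma normal_proj_eq:
  assumes t: "t \<in> T"
  shows "normal_proj G x t v = v - (ip t v (u t) / ip t (u t) (u t)) *\<^sub>R u t"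
  unfolding normal_proj_def normal_space_def
  by (rule orth_proj_eqI)
    (use t spd_eq_0_iff[OF spd_x[OF t]] speed_pos[OF t] ip_commute[OF t] in \<open>auto simp: bilin_simps\<close>)

lemma normal_proj_normal: "t \<in> T \<Longrightarrow> ip t (normal_proj G x t v) (u t) = 0"
  using speed_pos by (force simp: normal_proj_eq bilin_simps)

lemma H_normal: "t \<in> T \<Longrightarrow> ip t (H t) (u t) = 0"
  by (simp add: mean_curvature_def second_fund_form_def bilin_simps normal_proj_normal)

lemma acceleration_eq:
  assumes t: "t \<in> T"
  shows "acceleration G x t = ip t (u t) (u t) *\<^sub>R H t
    + (ip t (acceleration G x t) (u t) / ip t (u t) (u t)) *\<^sub>R u t"
  using speed_pos[OF t] t
  by (simp add: mean_curvature_def second_fund_form_def normal_proj_eq)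

lemma smooth_H: "smooth_on T H"
proof (rule smooth_on_cong[OF open_T])
  let ?a = "acceleration G x"
  show "smooth_on T (\<lambda>t. (1 / ip t (u t) (u t)) *\<^sub>R (?a t - (ip t (?a t) (u t) / ip t (u t) (u t)) *\<^sub>R u t))"
    using speed_pos
    by (intro smooth_intros open_T smooth_ip smooth_u smooth_acceleration) force+
qed (simp add: mean_curvature_def second_fund_form_def normal_proj_eq)

text \<open>Write \<open>a = q H + r u\<close> with \<open>q = |u|^2\<close> and
  \<open>r = g(a,u)/q\<close>, so that \<open>q' = 2 r q\<close>. The normal part of
  \<open>D a\<close> is then \<open>q N(D H) + 3 r q H\<close>: two of the three multiples of
  \<open>r q H\<close> come from \<open>q'\<close>, one from \<open>r D u\<close>. The coefficient 3
  in the circle equation removes exactly these, leaving \<open>q N(D H) - q N(P u)\<close>.\<close>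

lemma normal_proj_circle_defect:
  assumes t: "t \<in> T"
  shows "normal_proj G x t (circle_defect G x t) = - ip t (u t) (u t) *\<^sub>R conformal_curvature G x t"
proof -
  let ?a = "acceleration G x" and ?M = "conn_matrix G x t"
  define q where "q = (\<lambda>s. ip s (u s) (u s))"
  define r where "r = (\<lambda>s. ip s (?a s) (u s) / q s)"
  define P where "P = schouten_endo G (x t) (u t)"
  have q0: "q t > 0" using speed_pos[OF t] by (simp add: q_def)
  have sr: "smooth_on T r" unfolding r_def q_def
    using speed_pos by (intro smooth_intros open_T smooth_ip smooth_u smooth_acceleration) force+
  note hu = smooth_on_has_vector_derivative[OF smooth_u t]
    and hH = smooth_on_has_vector_derivative[OF smooth_H t]
    and hr = smooth_on_has_vector_derivative[OF sr t]
  have a: "?a t = vector_derivative u (at t) + ?M *v u t"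
    by (simp add: acceleration_def cov_deriv_conn_matrix)
  have hq: "(q has_vector_derivative 2 * ip t (?a t) (u t)) (at t)"
    using has_vector_derivative_ip[OF t hu hu] unfolding q_def a[symmetric]
    by (simp add: ip_commute[OF t, of "u t"])
  have "((\<lambda>s. q s *\<^sub>R H s + r s *\<^sub>R u s) has_vector_derivative
      (q t *\<^sub>R vector_derivative H (at t) + (2 * ip t (?a t) (u t)) *\<^sub>R H t)
      + (r t *\<^sub>R vector_derivative u (at t) + vector_derivative r (at t) *\<^sub>R u t)) (at t)"
    by (intro has_vector_derivative_add has_vector_derivative_scaleR hq hH hu
        hr[unfolded has_real_derivative_iff_has_vector_derivative[symmetric]]
        hq[unfolded has_real_derivative_iff_has_vector_derivative[symmetric]])
  then have "(?a has_vector_derivative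
      (q t *\<^sub>R vector_derivative H (at t) + (2 * ip t (?a t) (u t)) *\<^sub>R H t)
      + (r t *\<^sub>R vector_derivative u (at t) + vector_derivative r (at t) *\<^sub>R u t)) (at t)"
    by (rule has_vector_derivative_transform_within_open[OF _ open_T t])
      (simp add: q_def r_def acceleration_eq[symmetric])
  then have va: "vector_derivative ?a (at t) =
      (q t *\<^sub>R vector_derivative H (at t) + (2 * ip t (?a t) (u t)) *\<^sub>R H t)
      + (r t *\<^sub>R vector_derivative u (at t) + vector_derivative r (at t) *\<^sub>R u t)"
    by (rule vector_derivative_at)
  have at: "?a t = q t *\<^sub>R H t + r t *\<^sub>R u t"
    unfolding q_def r_def by (rule acceleration_eq[OF t])
  have "?M *v ?a t = q t *\<^sub>R (?M *v H t) + r t *\<^sub>R (?M *v u t)"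
    unfolding at by (simp add: matrix_vector_right_distrib matrix_vector_mult_scaleR)
  then have Da: "D ?a t = q t *\<^sub>R D H t + (2 * r t * q t) *\<^sub>R H t + r t *\<^sub>R ?a t
      + vector_derivative r (at t) *\<^sub>R u t"
    unfolding cov_deriv_conn_matrix va using q0 
    by (simp add: a scaleR_add_right r_def mult.commute)
  have N: "normal_proj G x t (c *\<^sub>R v + w) = c *\<^sub>R normal_proj G x t v + normal_proj G x t w"
    "normal_proj G x t (v - w) = normal_proj G x t v - normal_proj G x t w"
    "normal_proj G x t (c *\<^sub>R v) = c *\<^sub>R normal_proj G x t v"
    "normal_proj G x t (v + w) = normal_proj G x t v + normal_proj G x t w" for c v w
    using t by (simp_all add: normal_proj_eq bilin_simps add_divide_distrib diff_divide_distrib algebra_simps)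
  have Nu: "normal_proj G x t (u t) = 0" using t speed_pos[OF t] by (simp add: normal_proj_eq)
  have NH: "normal_proj G x t (H t) = H t" using t H_normal[OF t] by (simp add: normal_proj_eq)
  have ua: "ip t (u t) (?a t) = r t * q t" using q0 by (simp add: r_def ip_commute[OF t])
  have qt: "ip t (u t) (u t) = q t" by (simp add: q_def)
  show ?thesis
    unfolding circle_defect_def conformal_curvature_def Let_def Da ua P_def[symmetric] qt
    using q0 by (simp add: N Nu NH at scaleR_diff_right algebra_simps flip: scaleR_add_left)
qed

lemma circle_iff_conformal_curvature:
  "t \<in> T \<Longrightarrow> normal_proj G x t (circle_defect G x t) = 0 \<longleftrightarrow> conformal_curvature G x t = 0"
  using normal_proj_circle_defect speed_pos by fastforce

end

section \<open>Linear algebra of a single tractor fibre in an adapted frame\<close>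

section \<open>Tractor components\<close>

lemma tractor_nth [simp]:
  "tractor \<sigma> \<mu> \<rho> $ Hi = \<sigma>" "tractor \<sigma> \<mu> \<rho> $ Mid a = \<mu> $ a" "tractor \<sigma> \<mu> \<rho> $ Lo = \<rho>"
  by (simp_all add: tractor_def)

lemma mid_tractor [simp]: "mid (tractor \<sigma> \<mu> \<rho>) = \<mu>"
  by (simp add: mid_def vec_eq_iff)

lemma UNIV_tractor_index: "(UNIV :: 'n tractor_index set) = insert Hi (insert Lo (range Mid))"
  by (auto intro: tractor_index.exhaust)

lemma sum_tractor_index:
  fixes f :: "'n::finite tractor_index \<Rightarrow> 'b::comm_monoid_add"
  shows
  "(\<Sum>A\<in>UNIV. f A) = f Hi + (\<Sum>a\<in>UNIV. f (Mid a)) + f Lo"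
proof -
  have "(\<Sum>A\<in>range Mid. f A) = (\<Sum>a\<in>UNIV. f (Mid a))"
    by (subst sum.reindex) (auto simp: inj_on_def)
  moreover have "sum f UNIV = sum f (insert Hi (insert Lo (range Mid)))"
    by (simp only: UNIV_tractor_index[symmetric])
  moreover have "\<dots> = f Hi + (f Lo + sum f (range Mid))"
    using sum.insert[of "insert Lo (range Mid)" Hi f] sum.insert[of "range Mid" Lo f]
    by (simp add: image_iff del: sum.insert_if)
  ultimately show ?thesis by (simp add: ac_simps)
qed

lemma tractor_eqI:
  assumes "V $ Hi = W $ Hi" "\<And>a. V $ Mid a = W $ Mid a" "V $ Lo = W $ Lo"
  shows "V = W"
  unfolding vec_eq_iff using assms by (metis tractor_index.exhaust)

lemma inner_tractor:
  "V \<bullet> W = V $ Hi * W $ Hi + mid V \<bullet> mid W + V $ Lo * W $ Lo" for V W :: "'n::finite tractor"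
  by (simp add: inner_vec_def sum_tractor_index mid_def)

lemma tractor_metric_mult:
  "tractor_metric g *v V = tractor (V $ Lo) (matrix_inv g *v mid V) (V $ Hi)"
  by (rule tractor_eqI)
    (simp_all add: matrix_vector_mult_def sum_tractor_index tractor_metric_def mid_def)

fun flip_index :: "'n tractor_index \<Rightarrow> 'n tractor_index" where
  "flip_index Hi = Lo" | "flip_index (Mid a) = Mid a" | "flip_index Lo = Hi"

lemma flip_flip [simp]: "flip_index (flip_index A) = A"
  by (cases A) auto

text \<open>The Gram matrix of the tractor metric in an adapted frame: \<open>Hi\<close> and
  \<open>Lo\<close> are null and dual to each other, the rest is orthonormal. It is constant along
  the curve and its own inverse.\<close>

definition flat :: "real^('n::finite tractor_index)^('n tractor_index)" where
  "flat = (\<chi> A B. of_bool (B = flip_index A))"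

lemma flat_flat: "flat ** flat = (mat 1 :: real^('n::finite tractor_index)^('n tractor_index))"
proof -
  have "(\<Sum>C\<in>UNIV. of_bool (C = flip_index A) * of_bool (B = flip_index C)) = (of_bool (A = B) :: real)"
    for A B :: "'n tractor_index"
  proof -
    have "(\<Sum>C\<in>UNIV. of_bool (C = flip_index A) * of_bool (B = flip_index C))
      = (\<Sum>C\<in>{flip_index A}. of_bool (C = flip_index A) * of_bool (B = flip_index C) :: real)"
      by (rule sum.mono_neutral_right) auto
    then show ?thesis by auto
  qed
  then show ?thesis by (simp add: vec_eq_iff flat_def matrix_matrix_mult_def mat_def)
qed

section \<open>Adapted frames of the tractor bundle\<close>

text \<open>In the \<open>Hi\<close> column the middle slot \<open>-h\<close> gives orthogonality to
  all \<open>Mid\<close> columns, and the last slot then makes it null. Every middle slot is written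
  as \<open>g *v v\<close>, even for \<open>v = 0\<close>, so that one derivative rule will serve
  all columns.\<close>

definition frame_col :: "real^'n^'n \<Rightarrow> real^'n \<Rightarrow> ('n \<Rightarrow> real^'n) \<Rightarrow> 'n::finite tractor_index \<Rightarrow> 'n tractor" where
  "frame_col g h e A = (case A of
      Hi \<Rightarrow> tractor 1 (g *v (- h)) (- (bilin g h h / 2))
    | Mid b \<Rightarrow> tractor 0 (g *v e b) (bilin g (e b) h)
    | Lo \<Rightarrow> tractor 0 (g *v 0) 1)"

text \<open>These are the frame columns lowered with the tractor metric, with \<open>Hi\<close> and
  \<open>Lo\<close> exchanged. The inverse frame is thus available in closed form.\<close>

definition coframe_row :: "real^'n^'n \<Rightarrow> real^'n \<Rightarrow> ('n \<Rightarrow> real^'n) \<Rightarrow> 'n::finite tractor_index \<Rightarrow> 'n tractor" where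
  "coframe_row g h e A = (case A of
      Hi \<Rightarrow> tractor 1 0 0
    | Mid b \<Rightarrow> tractor (bilin g (e b) h) (e b) 0
    | Lo \<Rightarrow> tractor (- (bilin g h h / 2)) (- h) 1)"

definition frame_matrix where "frame_matrix g h e = (\<chi> A B. frame_col g h e B $ A)"
definition coframe_matrix where "coframe_matrix g h e = (\<chi> A. coframe_row g h e A)"

lemma coframe_mult: "(coframe_matrix g h e *v V) $ A = coframe_row g h e A \<bullet> V"
  by (simp add: coframe_matrix_def matrix_vector_mul_component)

lemma column_frame_matrix: "column A (frame_matrix g h e) = frame_col g h e A"
  by (simp add: frame_matrix_def column_def vec_eq_iff)

lemma coframe_values:
  "coframe_row g h e Hi \<bullet> tractor \<sigma> (g *v v) \<rho> = \<sigma>"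
  "coframe_row g h e (Mid b) \<bullet> tractor \<sigma> (g *v v) \<rho> = bilin g (e b) v + bilin g (e b) h * \<sigma>"
  "coframe_row g h e Lo \<bullet> tractor \<sigma> (g *v v) \<rho> = \<rho> - bilin g h v - bilin g h h / 2 * \<sigma>"
  by (simp_all add: coframe_row_def inner_tractor bilin_def)

locale orthonormal_basis =
  fixes g :: "real^'n::finite^'n" and h :: "real^'n" and e :: "'n \<Rightarrow> real^'n"
  assumes spd_g: "spd g" and orthonormal: "\<And>b c. bilin g (e b) (e c) = of_bool (b = c)"
begin

abbreviation "Q \<equiv> frame_matrix g h e"
abbreviation "Qi \<equiv> coframe_matrix g h e"

lemma coframe_frame: "Qi ** Q = mat 1"
proof -
  have he: "bilin g h (e b) = bilin g (e b) h" for b by (rule spd_commute[OF spd_g])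
  have "coframe_row g h e A \<bullet> frame_col g h e B = of_bool (A = B)" for A B
    by (cases A; cases B)
      (auto simp: frame_col_def coframe_values coframe_values[where v=0, simplified]
        orthonormal bilin_simps he)
  then show ?thesis
    by (simp add: vec_eq_iff coframe_matrix_def frame_matrix_def
        matrix_matrix_mult_def inner_vec_def mat_def)
qed

lemma frame_coframe: "Q ** Qi = mat 1"
  using coframe_frame matrix_left_right_inverse by blast

lemma frame_coframe_vec [simp]: "Q *v (Qi *v V) = V" "Qi *v (Q *v V) = V"
  by (simp_all add: matrix_vector_mul_assoc frame_coframe coframe_frame)

lemma metric_frame_col: "tractor_metric g *v frame_col g h e A = coframe_row g h e (flip_index A)"
  by (cases A) (simp_all add: tractor_metric_mult frame_col_def coframe_row_def
      matrix_vector_mul_assoc spd_matrix_inv[OF spd_g])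

lemma metric_frame: "tractor_metric g ** Q = transpose Qi ** flat"
proof -
  have "(tractor_metric g ** Q) $ A $ B = coframe_row g h e (flip_index B) $ A" for A B
    using metric_frame_col[of B] by (simp add: vec_eq_iff matrix_matrix_mult_def matrix_vector_mult_def frame_matrix_def)
  moreover have "(transpose Qi ** flat) $ A $ B = coframe_row g h e (flip_index B) $ A" for A B
  proof -
    have "(transpose Qi ** flat) $ A $ B = (\<Sum>C\<in>{flip_index B}. coframe_row g h e C $ A)"
      unfolding matrix_matrix_mult_def transpose_def coframe_matrix_def flat_def vec_lambda_beta
      by (rule sum.mono_neutral_cong_right) auto
    then show ?thesis by simp
  qed
  ultimately show ?thesis by (simp add: vec_eq_iff)
qed

lemma matrix_inv_tractor_metric: "matrix_inv (tractor_metric g) = Q ** flat ** transpose Q"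
proof (rule matrix_inv_eqI)
  have "tractor_metric g ** (Q ** flat ** transpose Q) = transpose Qi ** (flat ** flat) ** transpose Q"
    using metric_frame by (simp add: matrix_mul_assoc)
  also have "\<dots> = transpose (Q ** Qi)" by (simp add: flat_flat matrix_transpose_mul)
  finally show "tractor_metric g ** (Q ** flat ** transpose Q) = mat 1"
    by (simp add: frame_coframe transpose_mat)
qed

lemma bilin_tractor_metric:
  "bilin (tractor_metric g) V W = (\<Sum>A\<in>UNIV. (Qi *v V) $ flip_index A * (Qi *v W) $ A)"
proof -
  have "tractor_metric g *v W = tractor_metric g *v (\<Sum>A\<in>UNIV. (Qi *v W) $ A *\<^sub>R frame_col g h e A)"
    using frame_coframe_vec(1)[of W] unfolding matrix_mult_sum[of Q] column_frame_matrix scalar_mult_eq_scaleR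
    by simp
  also have "\<dots> = (\<Sum>A\<in>UNIV. (Qi *v W) $ A *\<^sub>R coframe_row g h e (flip_index A))"
    by (simp add: vec.linear_sum[OF matrix_vector_mul_linear_gen] linear_sum[OF matrix_vector_mul_linear]
        matrix_vector_mult_scaleR metric_frame_col)
  finally show ?thesis
    by (simp add: bilin_def inner_sum_right coframe_mult inner_commute mult.commute)
qed

lemma pull_frame_coframe [simp]: "pull Q (pull Qi F) = F" "pull Qi (pull Q F) = F"
  by (simp_all add: pull_pull frame_coframe coframe_frame)

text \<open>In the frame the inverse metric is the permutation matrix of \<open>flip_index\<close>,
  so the double sum collapses to a single one.\<close>

lemma form_contract_frame:
  "form_contract (tractor_metric g) k E F =
    (\<Sum>As\<in>index_lists k. pull Q E As * pull Q F (map flip_index As))"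
proof -
  have "(\<Sum>Bs\<in>index_lists k. (\<Prod>j<k. flat $ (As ! j) $ (Bs ! j)) * pull Q E As * pull Q F Bs)
     = pull Q E As * pull Q F (map flip_index As)" if "As \<in> index_lists k" for As
  proof -
    have P: "(\<Prod>j<k. flat $ (As ! j) $ (Bs ! j)) = (of_bool (Bs = map flip_index As) :: real)"
      if "length Bs = k" for Bs
      using prod_of_bool_eq_nth[of Bs "map flip_index As"] that \<open>As \<in> index_lists k\<close>
      by (simp add: flat_def)
    have "(\<Sum>Bs\<in>index_lists k. (\<Prod>j<k. flat $ (As ! j) $ (Bs ! j)) * pull Q E As * pull Q F Bs)
      = (\<Sum>Bs\<in>{map flip_index As}. pull Q E As * pull Q F Bs)"
    proof (rule sum.mono_neutral_cong_right, goal_cases)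
      case (4 Bs)
      then show ?case using P[of Bs] that by (simp only: singleton_iff length_map in_index_lists) simp
    qed (use that P in auto)
    then show ?thesis by simp
  qed
  then show ?thesis unfolding form_contract_pull[OF matrix_inv_tractor_metric] by simp
qed

end

section \<open>The volume form in an adapted frame\<close>

definition tractor_order :: "'n::finite tractor_index list" where
  "tractor_order = Hi # map Mid coord_order @ [Lo]"

lemma tractor_order: "distinct (tractor_order :: 'n::finite tractor_index list)"
    "set (tractor_order :: 'n tractor_index list) = UNIV"
  using coord_order[where 'n='n]
  by (auto simp: tractor_order_def distinct_map inj_on_def UNIV_tractor_index)

lemma CARD_tractor_index: "CARD('n tractor_index) = CARD('n::finite) + 2"
  using length_enum[OF tractor_order[where 'n='n]] by (simp add: tractor_order_def)

lemma alternating_vol_tractor: "alternating_form (CARD('n::finite) + 2) (vol (tractor_order :: 'n tractor_index list))"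
  using alternating_vol[OF tractor_order] by (simp add: CARD_tractor_index)

lemma alternating_form_map:
  fixes f :: "'b \<Rightarrow> 'i"
  assumes "alternating_form k F"
  shows "alternating_form k (\<lambda>As. F (map f As))"
proof (rule alternating_formI)
  fix As :: "'b list" and i j assume "length As = k" "i < j" "j < k"
  then show "F (map f (As[i := As ! j, j := As ! i])) = - F (map f As)"
    using alternating_form_swap[OF assms, of i "map f As" j] by (simp add: map_update)
qed (use assms in \<open>simp add: alternating_form_def\<close>)

text \<open>\<open>flip_index\<close> exchanges the first and the last entry of
  \<open>tractor_order\<close> and fixes the others, hence acts as one transposition. This sign
  reflects the one negative direction of the tractor metric and is the source of the minus in the
  normalisation by \<open>-(n+2)!\<close>.\<close>

lemma vol_map_flip: "vol (tractor_order :: 'n::finite tractor_index list) (map flip_index As) = - vol tractor_order As"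
proof -
  let ?L = "tractor_order :: 'n tractor_index list" and ?n = "CARD('n)"
  have "map flip_index ?L = ?L[0 := ?L ! (?n + 1), ?n + 1 := ?L ! 0]"
    by (simp add: tractor_order_def list_update_append nth_append comp_def)
  then have "vol ?L (map flip_index ?L) = - 1"
    using alternating_form_swap[OF alternating_vol_tractor, of 0 ?L "?n + 1"] vol_enum[OF tractor_order]
    by (simp add: tractor_order_def)
  moreover have "alternating_form CARD('n tractor_index) (\<lambda>As. vol ?L (map flip_index As))"
    using alternating_form_map[OF alternating_vol[OF tractor_order]] .
  from alternating_form_top[OF tractor_order this]
  have "vol ?L (map flip_index As) = vol ?L (map flip_index ?L) * vol ?L As" by metis
  ultimately show ?thesis by simp
qed

context orthonormal_basis
begin

text \<open>The space of top forms is a line; the normalisation fixes the multiple up to sign and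
  the coordinate frame fixes the sign. That sign is left as \<open>sgn\<close> of a component, which
  later is only required to be locally constant.\<close>

lemma tractor_volume_frame:
  defines "V \<equiv> pull Qi (vol tractor_order)"
  shows "V tractor_order \<noteq> 0" "tractor_volume g = (\<lambda>As. sgn (V tractor_order) * V As)"
proof -
  let ?L = "tractor_order :: 'n tractor_index list" and ?n = "CARD('n) + 2"
  have alt: "alternating_form ?n V"
    unfolding V_def by (rule alternating_form_pull[OF alternating_vol_tractor])
  have top: "F = (\<lambda>As. F ?L * vol ?L As)" if "alternating_form ?n F" for F
    using alternating_form_top[OF tractor_order] that unfolding CARD_tractor_index by blast
  have c: "form_contract (tractor_metric g) ?n (\<lambda>As. c * V As) (\<lambda>As. c * V As) = - (c * c) * fact ?n" for c
  proof -
    have "form_contract (tractor_metric g) ?n (\<lambda>As. c * V As) (\<lambda>As. c * V As)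
      = - (c * c) * (\<Sum>As\<in>index_lists ?n. vol ?L As * vol ?L As)"
      unfolding form_contract_frame pull_cmult V_def
      by (simp add: vol_map_flip sum_distrib_left sum_negf mult_ac)
    also have "(\<Sum>As\<in>index_lists ?n. vol ?L As * vol ?L As) = fact ?n"
      using sum_square_alternating[OF alternating_vol_tractor _ alternating_vol_tractor, of ?L]
      by (simp add: tractor_order vol_enum[OF tractor_order] length_enum[OF tractor_order] CARD_tractor_index)
    finally show ?thesis .
  qed
  show nz: "V ?L \<noteq> 0"
  proof
    assume "V ?L = 0"
    then have "V = (\<lambda>As. 0)" using top[OF alt] by simp
    then have "pull Q V ?L = 0" by (simp add: pull_def)
    then show False by (simp add: V_def vol_enum[OF tractor_order])
  qed
  show "tractor_volume g = (\<lambda>As. sgn (V ?L) * V As)"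
    unfolding tractor_volume_def
  proof (rule the_equality, intro conjI)
    show "alternating_form ?n (\<lambda>As. sgn (V ?L) * V As)"
      using alt by (simp add: alternating_form_def)
    show "form_contract (tractor_metric g) ?n (\<lambda>As. sgn (V ?L) * V As) (\<lambda>As. sgn (V ?L) * V As) = - fact ?n"
      unfolding c using nz by (simp add: sgn_if)
    show "0 < sgn (V ?L) * V (Hi # map Mid coord_order @ [Lo])"
      using nz unfolding tractor_order_def[symmetric] by (simp add: sgn_if)
  next
    fix E assume E: "alternating_form ?n E \<and> form_contract (tractor_metric g) ?n E E = - fact ?n
       \<and> 0 < E (Hi # map Mid coord_order @ [Lo])"
    define k where "k = pull Q E ?L"
    have "pull Q E = (\<lambda>As. k * vol ?L As)"
      unfolding k_def using E by (intro top alternating_form_pull) simp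
    then have "pull Qi (pull Q E) = (\<lambda>As. k * V As)" by (simp add: pull_cmult V_def)
    then have EV: "E = (\<lambda>As. k * V As)" by simp
    then have "- (k * k) * fact ?n = (- fact ?n :: real)" using E c by metis
    then have "k * k = 1" by simp
    moreover have "k * V ?L > 0" using E EV unfolding tractor_order_def[symmetric] by metis
    ultimately have "k = sgn (V ?L)"
      by (auto simp: square_eq_1_iff sgn_if zero_less_mult_iff)
    then show "E = (\<lambda>As. sgn (V ?L) * V As)" using EV by simp
  qed
qed

end

section \<open>The normal tractor bundle in an adapted frame\<close>

lemma coord_order_Cons: "hd coord_order # tl coord_order = (coord_order :: 'n::finite list)"
  by (metis coord_order(2) UNIV_not_empty list.exhaust_sel list.set(1))

text \<open>The head of \<open>coord_order\<close> is reserved for the unit tangent. Orientation is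
  tested on frames that begin with the velocity, so this keeps all orderings aligned.\<close>

definition normal_indices :: "'n::finite tractor_index list" where
  "normal_indices = map Mid (tl coord_order)"

lemma length_normal_indices: "length (normal_indices :: 'n::finite tractor_index list) = CARD('n) - 1"
  by (simp add: normal_indices_def)

lemma distinct_normal_indices: "distinct (normal_indices :: 'n::finite tractor_index list)"
  using coord_order(1)[where 'n='n] by (simp add: normal_indices_def distinct_map inj_on_def distinct_tl)

lemma set_normal_indices: "A \<in> set normal_indices \<longleftrightarrow> (\<exists>b. A = Mid b \<and> b \<noteq> hd (coord_order :: 'n::finite list))"
proof -
  have "distinct (hd coord_order # tl coord_order :: 'n list)" "set (hd coord_order # tl coord_order :: 'n list) = UNIV"
    unfolding coord_order_Cons by (rule coord_order)+
  then have "set (tl coord_order) = - {hd coord_order :: 'n}" by auto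
  then show ?thesis by (auto simp: normal_indices_def)
qed

lemma flip_normal [simp]: "A \<in> set normal_indices \<Longrightarrow> flip_index A = A"
  by (auto simp: set_normal_indices)

definition unmid :: "'n tractor_index \<Rightarrow> 'n" where
  "unmid A = (case A of Mid a \<Rightarrow> a)"

lemma unmid_Mid [simp]: "unmid (Mid a) = a"
  by (simp add: unmid_def)

text \<open>The interior product of the determinant form with the tangent direction, transported to
  \<open>Mid\<close> indices. A tangential index among \<open>Bs\<close> needs no case of its own:
  it repeats the head and is killed by alternation.\<close>

definition normal_volume :: "'n::finite tractor_index form" where
  "normal_volume Bs = (if set Bs \<subseteq> range Mid then vol coord_order (hd coord_order # map unmid Bs) else 0)"

lemma alternating_normal_volume: "alternating_form (CARD('n) - 1) (normal_volume :: 'n::finite tractor_index form)"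
proof (rule alternating_formI)
  fix Bs :: "'n tractor_index list" assume "length Bs \<noteq> CARD('n) - 1"
  then show "normal_volume Bs = 0" by (auto simp: normal_volume_def vol_def)
next
  fix Bs :: "'n tractor_index list" and i j :: nat assume l: "length Bs = CARD('n) - 1" and ij: "i < j" "j < CARD('n) - 1"
  have "set (Bs[i := Bs ! j, j := Bs ! i]) = set Bs"
    using ij l by (intro set_swap) auto
  moreover have "vol coord_order (hd coord_order # map unmid (Bs[i := Bs ! j, j := Bs ! i]))
      = - vol coord_order (hd coord_order # map unmid Bs)"
    using alternating_form_swap[OF alternating_vol[OF coord_order], of "Suc i" "hd coord_order # map unmid Bs" "Suc j"] l ij
    by (simp add: map_update)
  ultimately show "normal_volume (Bs[i := Bs ! j, j := Bs ! i]) = - normal_volume Bs"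
    by (simp add: normal_volume_def)
qed

lemma normal_volume_support: "\<not> set Bs \<subseteq> set normal_indices \<Longrightarrow> normal_volume Bs = 0"
proof -
  assume "\<not> set Bs \<subseteq> set normal_indices"
  then obtain A where A: "A \<in> set Bs" "A \<notin> set normal_indices" by blast
  show "normal_volume Bs = 0"
  proof (cases "set Bs \<subseteq> range Mid")
    case True
    then have "A = Mid (hd coord_order)" using A set_normal_indices by blast
    then have "hd coord_order \<in> set (map unmid Bs)" using A(1) by force
    then have "\<not> distinct (hd coord_order # map unmid Bs)" by simp
    then show ?thesis
      unfolding normal_volume_def using alternating_form_not_distinct[OF alternating_vol[OF coord_order]] by metis
  qed (simp add: normal_volume_def)
qed

lemma normal_volume_normal_indices: "normal_volume (normal_indices :: 'n::finite tractor_index list) = 1"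
  by (simp add: normal_volume_def normal_indices_def comp_def image_subset_iff coord_order_Cons vol_enum[OF coord_order])

text \<open>The volume form of the frame with the normal directions inserted first; up to sign these
  will be the frame components of the dual of \<open>N\<close>.\<close>

definition conormal_volume :: "'n::finite tractor_index form" where
  "conormal_volume Es = vol tractor_order (normal_indices @ Es)"

definition conormal_indices :: "'n::finite tractor_index list" where
  "conormal_indices = [Hi, Mid (hd coord_order), Lo]"

lemma set_conormal_indices: "set conormal_indices = - set (normal_indices :: 'n::finite tractor_index list)"
proof (rule set_eqI)
  show "A \<in> set conormal_indices \<longleftrightarrow> A \<in> - set normal_indices" for A :: "'n tractor_index"
    by (cases A) (auto simp: conormal_indices_def set_normal_indices)
qed

lemma CARD_minus_1_plus_3: "CARD('n::finite) - 1 + 3 = CARD('n) + 2"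
  using zero_less_card_finite[where 'a='n] by linarith

lemma alternating_conormal_volume: "alternating_form 3 (conormal_volume :: 'n::finite tractor_index form)"
proof (rule alternating_formI)
  fix Bs :: "'n tractor_index list" assume "length Bs \<noteq> 3"
  then show "conormal_volume Bs = 0"
    using CARD_minus_1_plus_3[where 'n='n] length_normal_indices[where 'n='n]
    unfolding conormal_volume_def
    by (intro alternating_form_length[OF alternating_vol_tractor]) simp
next
  fix Bs :: "'n tractor_index list" and i j :: nat assume l: "length Bs = 3" and ij: "i < j" "j < 3"
  let ?k = "length (normal_indices :: 'n tractor_index list)"
  show "conormal_volume (Bs[i := Bs ! j, j := Bs ! i]) = - conormal_volume Bs"
    using alternating_form_swap[OF alternating_vol_tractor, of "?k + i" "normal_indices @ Bs" "?k + j"] l ij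
    by (simp add: conormal_volume_def list_update_append)
qed

lemma conormal_volume_support: "\<not> set Bs \<subseteq> set conormal_indices \<Longrightarrow> conormal_volume Bs = 0"
  unfolding conormal_volume_def set_conormal_indices
  by (rule alternating_form_not_distinct[OF alternating_vol_tractor]) auto

lemma conormal_volume_nonzero: "conormal_volume (conormal_indices :: 'n::finite tractor_index list) \<noteq> 0"
  unfolding conormal_volume_def
proof (rule vol_distinct_nonzero[OF tractor_order])
  show "distinct (normal_indices @ conormal_indices :: 'n tractor_index list)"
    using distinct_normal_indices set_conormal_indices[where 'n='n]
    by (auto simp: conormal_indices_def)
qed (simp add: set_conormal_indices)

definition normal_diag :: "real^('n::finite tractor_index)^('n tractor_index)" where
  "normal_diag = (\<chi> A B. of_bool (A = B \<and> A \<in> set normal_indices))"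

lemma normal_diag_mult: "(normal_diag *v V) $ A = (if A \<in> set normal_indices then V $ A else 0)"
proof -
  have "(normal_diag *v V) $ A = (\<Sum>B\<in>{A}. of_bool (A \<in> set normal_indices) * V $ B)"
    unfolding normal_diag_def matrix_vector_mult_def vec_lambda_beta
    by (rule sum.mono_neutral_cong_right) auto
  then show ?thesis by simp
qed

lemma (in orthonormal_basis) expand: "v = (\<Sum>b\<in>UNIV. bilin g (e b) v *\<^sub>R e b)"
proof -
  define E where "E = (\<chi> i b. e b $ i)"
  have "transpose E ** (g ** E) = mat 1"
    using orthonormal unfolding bilin_def
    by (simp add: vec_eq_iff E_def matrix_matrix_mult_def transpose_def
        mat_def inner_vec_def matrix_vector_mult_def of_bool_def)
  then have "(transpose E ** g) ** E = mat 1" by (simp add: matrix_mul_assoc)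
  then have "E ** (transpose E ** g) = mat 1" using matrix_left_right_inverse by blast
  then have "v = E *v (transpose E *v (g *v v))"
    by (metis matrix_vector_mul_assoc matrix_vector_mul_lid)
  also have "transpose E *v (g *v v) = (\<chi> b. bilin g (e b) v)"
    unfolding bilin_def inner_vec_def
    by (subst matrix_vector_mult_def) (simp add: vec_eq_iff transpose_def E_def)
  also have "E *v (\<chi> b. bilin g (e b) v) = (\<Sum>b\<in>UNIV. bilin g (e b) v *\<^sub>R e b)"
    by (subst matrix_vector_mult_def) (simp add: vec_eq_iff E_def sum_component mult.commute)
  finally show ?thesis .
qed

text \<open>The frame of the tractor bundle uses the mean curvature as its vector \<open>h\<close>.
  The determinant condition makes the frame positive, so that \<open>N\<close> has frame components
  \<open>normal_volume\<close> with no sign.\<close>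

locale adapted_basis = orthonormal_basis "G (x t)" "mean_curvature G x t" e
  for G :: "real^'n::finite \<Rightarrow> real^'n^'n" and x t and e :: "'n \<Rightarrow> real^'n" +
  assumes velocity_nz: "velocity x t \<noteq> 0"
    and H_normal: "bilin (G (x t)) (mean_curvature G x t) (velocity x t) = 0"
    and tangent: "e (hd coord_order) =
      (1 / sqrt (bilin (G (x t)) (velocity x t) (velocity x t))) *\<^sub>R velocity x t"
    and positive: "det (\<chi> i b. e b $ i) > 0"
begin

abbreviation "gt \<equiv> G (x t)"
abbreviation "b0 \<equiv> hd (coord_order :: 'n list)"
abbreviation "speed \<equiv> sqrt (bilin gt (velocity x t) (velocity x t))"

lemma speed_gt_0: "speed > 0"
  using spd_pos[OF spd_g velocity_nz] by simp

lemma velocity_eq: "velocity x t = speed *\<^sub>R e b0"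
  unfolding tangent using speed_gt_0 by simp

lemma normal_space_iff: "v \<in> normal_space G x t \<longleftrightarrow> bilin gt (e b0) v = 0"
  unfolding normal_space_def tangent using speed_gt_0
  by (auto simp: bilin_simps spd_commute[OF spd_g, of v])

lemma coframe_normal_tractor:
  "(Qi *v normal_tractor G x t v) $ Hi = 0"
  "(Qi *v normal_tractor G x t v) $ Mid b = bilin gt (e b) v"
  "(Qi *v normal_tractor G x t v) $ Lo = 0"
  unfolding coframe_mult normal_tractor_def
  by (simp_all add: coframe_values spd_commute[OF spd_g, of v])

lemma normal_tractors_iff: "V \<in> normal_tractors G x t \<longleftrightarrow> (\<forall>A. A \<notin> set normal_indices \<longrightarrow> (Qi *v V) $ A = 0)"
proof
  assume "V \<in> normal_tractors G x t"
  then obtain v where v: "bilin gt (e b0) v = 0" "V = normal_tractor G x t v"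
    by (auto simp: normal_tractors_def normal_space_iff)
  show "\<forall>A. A \<notin> set normal_indices \<longrightarrow> (Qi *v V) $ A = 0"
  proof (intro allI impI)
    fix A :: "'n tractor_index" assume "A \<notin> set normal_indices"
    then show "(Qi *v V) $ A = 0"
      using v by (cases A) (auto simp: coframe_normal_tractor set_normal_indices)
  qed
next
  assume V: "\<forall>A. A \<notin> set normal_indices \<longrightarrow> (Qi *v V) $ A = 0"
  define v where "v = (\<Sum>b\<in>UNIV. (Qi *v V) $ Mid b *\<^sub>R e b)"
  have ev: "bilin gt (e b) v = (Qi *v V) $ Mid b" for b
  proof -
    have "bilin gt (e b) v = (\<Sum>c\<in>UNIV. if c = b then (Qi *v V) $ Mid c else 0)"
      unfolding v_def bilin_sum bilin_simps orthonormal by (intro sum.cong) auto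
    then show ?thesis by simp
  qed
  have "Qi *v normal_tractor G x t v = Qi *v V"
    using V by (intro tractor_eqI) (auto simp: coframe_normal_tractor ev set_normal_indices)
  then have "V = normal_tractor G x t v" by (metis frame_coframe_vec(1))
  moreover have "v \<in> normal_space G x t"
    using V by (auto simp: normal_space_iff ev set_normal_indices)
  ultimately show "V \<in> normal_tractors G x t" by (auto simp: normal_tractors_def)
qed

lemma normal_tractors_perp_iff: "V \<in> normal_tractors_perp G x t \<longleftrightarrow> (\<forall>A\<in>set normal_indices. (Qi *v V) $ A = 0)"
proof
  assume V: "V \<in> normal_tractors_perp G x t"
  show "\<forall>A\<in>set normal_indices. (Qi *v V) $ A = 0"
  proof
    fix A :: "'n tractor_index" assume A: "A \<in> set normal_indices"
    have "Q *v axis A 1 \<in> normal_tractors G x t"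
      using A by (auto simp: normal_tractors_iff axis_def)
    then have "0 = (\<Sum>B\<in>UNIV. (Qi *v V) $ flip_index B * axis A 1 $ B)"
      using V by (auto simp: normal_tractors_perp_def bilin_tractor_metric)
    also have "\<dots> = (\<Sum>B\<in>{A}. (Qi *v V) $ flip_index B)"
      by (rule sum.mono_neutral_cong_right) (auto simp: axis_def)
    finally show "(Qi *v V) $ A = 0" using flip_normal[OF A] by simp
  qed
next
  assume V: "\<forall>A\<in>set normal_indices. (Qi *v V) $ A = 0"
  have "(Qi *v V) $ flip_index A * (Qi *v W) $ A = 0" if "W \<in> normal_tractors G x t" for W A
    using that V by (cases "A \<in> set normal_indices") (auto simp: normal_tractors_iff)
  then show "V \<in> normal_tractors_perp G x t"
    unfolding normal_tractors_perp_def bilin_tractor_metric by (auto intro!: sum.neutral)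
qed

text \<open>\<open>flip_index\<close> fixes the normal indices, so there the tractor metric is a sum
  of squares. This supplies the anisotropy that \<open>orth_proj_eqI\<close> asks for, although the
  full metric is indefinite.\<close>

lemma tractor_normal_proj_frame:
  "tractor_normal_proj G x t V = Q *v (normal_diag *v (Qi *v V))"
  unfolding tractor_normal_proj_def
proof (rule orth_proj_eqI)
  fix s s' assume "s \<in> normal_tractors G x t" "s' \<in> normal_tractors G x t"
  then show "s - s' \<in> normal_tractors G x t"
    by (simp add: normal_tractors_iff matrix_vector_mult_diff_distrib)
next
  fix s assume s: "s \<in> normal_tractors G x t" "bilin (tractor_metric gt) s s = 0"
  have "(Qi *v s) $ flip_index A * (Qi *v s) $ A = (Qi *v s) $ A * (Qi *v s) $ A" for A
    using s by (cases "A \<in> set normal_indices") (auto simp: normal_tractors_iff)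
  with s(2) have "(\<Sum>A\<in>UNIV. (Qi *v s) $ A * (Qi *v s) $ A) = 0"
    by (simp add: bilin_tractor_metric)
  then have "(Qi *v s) \<bullet> (Qi *v s) = 0" by (simp add: inner_vec_def)
  then show "s = 0" by (metis frame_coframe_vec(1) inner_eq_zero_iff matrix_vector_mult_0_right)
next
  show "Q *v (normal_diag *v (Qi *v V)) \<in> normal_tractors G x t"
    by (simp add: normal_tractors_iff normal_diag_mult)
next
  fix s assume s: "s \<in> normal_tractors G x t"
  have "(Qi *v (V - Q *v (normal_diag *v (Qi *v V)))) $ flip_index A * (Qi *v s) $ A = 0" for A
    using s by (cases "A \<in> set normal_indices")
      (auto simp: normal_tractors_iff matrix_vector_mult_diff_distrib normal_diag_mult)
  then show "bilin (tractor_metric gt) (V - Q *v (normal_diag *v (Qi *v V))) s = 0"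
    unfolding bilin_tractor_metric by (intro sum.neutral) blast
qed

lemma tractor_normal_proj_matrix_frame:
  "tractor_normal_proj_matrix G x t = Q ** normal_diag ** Qi"
proof -
  have "tractor_normal_proj G x t = (*v) (Q ** normal_diag ** Qi)"
    by (simp add: fun_eq_iff tractor_normal_proj_frame matrix_vector_mul_assoc matrix_mul_assoc)
  then show ?thesis by (simp add: tractor_normal_proj_matrix_def matrix_of_matrix_vector_mul)
qed

text \<open>Passing to frame components multiplies by the determinant of the frame, and the velocity
  contributes its length as a factor. Both are positive, so orientation can be tested on frame
  components.\<close>

lemma frame_det_positive:
  assumes vs: "length vs = CARD('n) - 1"
  shows "frame_det (velocity x t # vs) = det (\<chi> i b. e b $ i) * speed *
    list_det coord_order (axis b0 1 # map (\<lambda>v. \<chi> b. bilin gt (e b) v) vs)"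
proof -
  let ?E = "\<chi> i b. e b $ i" and ?y = "\<lambda>v. \<chi> b. bilin gt (e b) v"
  have len: "length (y # map f vs) = CARD('n)" for y :: "real^'n" and f :: "real^'n \<Rightarrow> real^'n"
    using vs by simp
  have E: "?E *v ?y v = v" for v
    using expand[of v] by (simp add: vec_eq_iff matrix_vector_mult_def[of ?E] sum_component mult.commute)
  have "velocity x t # vs = map ((*v) ?E) (?y (velocity x t) # map ?y vs)"
    by (simp add: E comp_def)
  then have "frame_det (velocity x t # vs) = det ?E * list_det coord_order (?y (velocity x t) # map ?y vs)"
    unfolding frame_det_eq_list_det using list_det_map_mult[OF coord_order len] by metis
  also have "?y (velocity x t) = speed *\<^sub>R axis b0 1"
    by (subst velocity_eq) (auto simp: vec_eq_iff bilin_simps orthonormal axis_def)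
  also have "list_det coord_order (speed *\<^sub>R axis b0 1 # map ?y vs)
      = speed * list_det coord_order (axis b0 1 # map ?y vs)"
  proof -
    have sc: "(\<Prod>j<CARD('n). ((c *\<^sub>R y # ys) ! j) $ (As ! j)) = c * (\<Prod>j<CARD('n). ((y # ys) ! j) $ (As ! j))"
      for c and y :: "real^'n" and ys As
    proof -
      obtain m where "CARD('n) = Suc m" using zero_less_card_finite[where 'a='n] gr0_implies_Suc by blast
      then show ?thesis by (simp only: prod.lessThan_Suc_shift) (simp add: comp_def)
    qed
    show ?thesis
      unfolding form_eval_vol[OF coord_order len, symmetric] form_eval_def len sc
      by (simp add: sum_distrib_left mult_ac)
  qed
  finally show ?thesis by (simp add: mult.assoc)
qed

text \<open>A normal tractor has the \<open>Mid\<close> components \<open>g(e_b, v)\<close> and no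
  others. The value is therefore the same determinant as in the previous lemma, which turns the
  positivity clause of \<open>normal_form\<close> into an identity up to positive factors.\<close>

lemma form_eval_normal_volume:
  assumes vs: "length vs = CARD('n) - 1"
  shows "form_eval (pull Qi normal_volume) (map (normal_tractor G x t) vs) =
    list_det coord_order (axis b0 1 # map (\<lambda>v. \<chi> b. bilin gt (e b) v) vs)"
proof -
  let ?y = "\<lambda>v. \<chi> b. bilin gt (e b) v" and ?n = "CARD('n) - 1"
  have n: "CARD('n) = Suc ?n" using zero_less_card_finite[where 'a='n] by linarith
  have len: "length (axis b0 1 # map ?y vs) = CARD('n)" using vs n by simp
  have "form_eval (pull Qi normal_volume) (map (normal_tractor G x t) vs)
    = (\<Sum>As\<in>index_lists ?n. normal_volume As * (\<Prod>j<?n. (Qi *v normal_tractor G x t (vs ! j)) $ (As ! j)))"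
    using vs by (subst form_eval_map_mult[symmetric]) (simp add: form_eval_def)
  also have "\<dots> = (\<Sum>As\<in>map Mid ` index_lists ?n. normal_volume As * (\<Prod>j<?n. (Qi *v normal_tractor G x t (vs ! j)) $ (As ! j)))"
  proof (rule sum.mono_neutral_right)
    show "\<forall>As\<in>index_lists ?n - map Mid ` index_lists ?n.
      normal_volume As * (\<Prod>j<?n. (Qi *v normal_tractor G x t (vs ! j)) $ (As ! j)) = 0"
    proof
      fix As :: "'n tractor_index list" assume As: "As \<in> index_lists ?n - map Mid ` index_lists ?n"
      have "\<not> set As \<subseteq> range Mid"
      proof
        assume "set As \<subseteq> range Mid"
        then have "Mid (unmid A) = A" if "A \<in> set As" for A using that by force
        then have "As = map Mid (map unmid As)" by (simp add: map_idI)
        with As show False by (metis Diff_iff image_eqI in_index_lists length_map)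
      qed
      then show "normal_volume As * (\<Prod>j<?n. (Qi *v normal_tractor G x t (vs ! j)) $ (As ! j)) = 0"
        by (simp add: normal_volume_def)
    qed
  qed auto
  also have "\<dots> = (\<Sum>As\<in>index_lists ?n. vol coord_order (b0 # As) * (\<Prod>j<?n. (?y (vs ! j)) $ (As ! j)))"
    by (subst sum.reindex)
      (auto simp: inj_on_def normal_volume_def comp_def coframe_normal_tractor intro!: sum.cong prod.cong dest: map_injective)
  also have "\<dots> = (\<Sum>a\<in>{b0}. \<Sum>As\<in>index_lists ?n. vol coord_order (a # As) * (axis b0 1 $ a * (\<Prod>j<?n. (?y (vs ! j)) $ (As ! j))))"
    by simp
  also have "\<dots> = (\<Sum>a\<in>UNIV. \<Sum>As\<in>index_lists ?n. vol coord_order (a # As) * (axis b0 1 $ a * (\<Prod>j<?n. (?y (vs ! j)) $ (As ! j))))"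
    by (rule sum.mono_neutral_left) (auto simp: axis_def)
  also have "\<dots> = form_eval (vol coord_order) (axis b0 1 # map ?y vs)"
  proof -
    have "form_eval (vol coord_order) (axis b0 1 # map ?y vs) = (\<Sum>As\<in>index_lists (Suc ?n).
        vol coord_order As * (\<Prod>j<Suc ?n. ((axis b0 1 # map ?y vs) ! j) $ (As ! j)))"
      unfolding form_eval_def len n[symmetric] ..
    then show ?thesis
      unfolding sum_index_lists_Suc prod.lessThan_Suc_shift using vs by simp
  qed
  also have "\<dots> = list_det coord_order (axis b0 1 # map ?y vs)"
    by (rule form_eval_vol[OF coord_order len])
  finally show ?thesis .
qed

lemma form_contract_normal:
  fixes k defines "k \<equiv> CARD('n) - 1"
  assumes F: "alternating_form k (pull Q E)" "\<And>As. \<not> set As \<subseteq> set normal_indices \<Longrightarrow> pull Q E As = 0"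
  shows "form_contract (tractor_metric gt) k E E = fact k * (pull Q E normal_indices * pull Q E normal_indices)"
proof -
  have eq: "pull Q E As * pull Q E (map flip_index As) = pull Q E As * pull Q E As" for As
  proof (cases "set As \<subseteq> set normal_indices")
    case True
    then have "map flip_index As = As" using flip_normal by (metis map_idI subsetD)
    then show ?thesis by simp
  qed (simp add: F(2))
  then show ?thesis
    unfolding form_contract_frame eq
    using sum_square_alternating[OF F F(1), of normal_indices]
    by (simp add: length_normal_indices distinct_normal_indices k_def)
qed

text \<open>For uniqueness, vanishing on the complement confines a competitor to the normal indices,
  which makes it a multiple \<open>k\<close> of \<open>normal_volume\<close>; the normalisation
  gives \<open>k * k = 1\<close> and positivity gives \<open>k > 0\<close>.\<close>

lemma normal_form_frame: "normal_form G x t = pull Qi normal_volume"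
  unfolding normal_form_def
proof (rule the_equality)
  let ?F = "pull Qi normal_volume" and ?k = "CARD('n) - 1"
  show "alternating_form ?k ?F \<and>
     (\<forall>V\<in>normal_tractors_perp G x t. \<forall>As. (\<Sum>A\<in>UNIV. V $ A * ?F (A # As)) = 0) \<and>
     form_contract (tractor_metric gt) ?k ?F ?F = fact ?k \<and>
     (\<forall>vs. length vs = ?k \<and> set vs \<subseteq> normal_space G x t \<and> frame_det (velocity x t # vs) > 0 \<longrightarrow>
        form_eval ?F (map (normal_tractor G x t) vs) > 0)"
  proof (intro conjI ballI allI impI)
    show "alternating_form ?k ?F" by (rule alternating_form_pull[OF alternating_normal_volume])
    show "form_contract (tractor_metric gt) ?k ?F ?F = fact ?k"
      by (subst form_contract_normal)
        (simp_all add: alternating_normal_volume[simplified] normal_volume_support normal_volume_normal_indices)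
    fix vs assume "length vs = ?k \<and> set vs \<subseteq> normal_space G x t \<and> frame_det (velocity x t # vs) > 0"
    moreover have "det (\<chi> i b. e b $ i) * speed > 0" using positive speed_gt_0 by (rule mult_pos_pos)
    ultimately show "form_eval ?F (map (normal_tractor G x t) vs) > 0"
      using form_eval_normal_volume[of vs] frame_det_positive[of vs] zero_less_mult_pos by metis
  next
    fix V As assume V: "V \<in> normal_tractors_perp G x t"
    have "(\<Sum>A\<in>UNIV. V $ A * ?F (A # As)) = (\<Sum>A\<in>UNIV. \<Sum>B\<in>UNIV. \<Sum>Bs\<in>index_lists (length As).
        Qi $ B $ A * V $ A * (normal_volume (B # Bs) * (\<Prod>j<length As. Qi $ (Bs ! j) $ (As ! j))))"
      unfolding pull_def
      by (simp add: sum_index_lists_Suc prod.lessThan_Suc_shift sum_distrib_left mult_ac del: prod.lessThan_Suc)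
    also have "\<dots> = (\<Sum>B\<in>UNIV. \<Sum>Bs\<in>index_lists (length As).
        (Qi *v V) $ B * (normal_volume (B # Bs) * (\<Prod>j<length As. Qi $ (Bs ! j) $ (As ! j))))"
      by (subst sum.swap, intro sum.cong refl, subst sum.swap)
        (simp add: matrix_vector_mult_def sum_distrib_right)
    also have "\<dots> = 0"
    proof (intro sum.neutral ballI)
      fix B Bs
      show "(Qi *v V) $ B * (normal_volume (B # Bs) * (\<Prod>j<length As. Qi $ (Bs ! j) $ (As ! j))) = 0"
        using V normal_volume_support[of "B # Bs"]
        by (cases "B \<in> set normal_indices") (auto simp: normal_tractors_perp_iff)
    qed
    finally show "(\<Sum>A\<in>UNIV. V $ A * ?F (A # As)) = 0" .
  qed
next
  let ?k = "CARD('n) - 1"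
  fix F assume F: "alternating_form ?k F \<and>
     (\<forall>V\<in>normal_tractors_perp G x t. \<forall>As. (\<Sum>A\<in>UNIV. V $ A * F (A # As)) = 0) \<and>
     form_contract (tractor_metric gt) ?k F F = fact ?k \<and>
     (\<forall>vs. length vs = ?k \<and> set vs \<subseteq> normal_space G x t \<and> frame_det (velocity x t # vs) > 0 \<longrightarrow>
        form_eval F (map (normal_tractor G x t) vs) > 0)"
  have alt: "alternating_form ?k (pull Q F)" using F alternating_form_pull by blast
  have head: "pull Q F (A # Bs) = 0" if A: "A \<notin> set normal_indices" for A Bs
  proof -
    have "frame_col gt (mean_curvature G x t) e A = Q *v axis A 1"
      by (simp add: matrix_vector_mult_basis column_frame_matrix)
    then have "frame_col gt (mean_curvature G x t) e A \<in> normal_tractors_perp G x t"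
      using A by (auto simp: normal_tractors_perp_iff axis_def)
    then have z: "(\<Sum>B\<in>UNIV. Q $ B $ A * F (B # As)) = 0" for As
      using F by (simp add: frame_matrix_def)
    have "pull Q F (A # Bs) = (\<Sum>B\<in>UNIV. \<Sum>As\<in>index_lists (length Bs).
       (\<Prod>j<length Bs. Q $ (As ! j) $ (Bs ! j)) * (Q $ B $ A * F (B # As)))"
      unfolding pull_def
      by (simp add: sum_index_lists_Suc prod.lessThan_Suc_shift mult_ac del: prod.lessThan_Suc)
    also have "\<dots> = (\<Sum>As\<in>index_lists (length Bs). (\<Prod>j<length Bs. Q $ (As ! j) $ (Bs ! j))
       * (\<Sum>B\<in>UNIV. Q $ B $ A * F (B # As)))"
      by (subst sum.swap) (simp add: sum_distrib_left)
    finally show ?thesis by (simp add: z)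
  qed
  \<comment> \<open>The condition on the complement concerns the first slot only; a swap carries it
    to every other slot.\<close>
  have support: "pull Q F As = 0" if sub: "\<not> set As \<subseteq> set normal_indices" for As
  proof -
    obtain A where "A \<in> set As" and A: "A \<notin> set normal_indices" using sub by blast
    then obtain i where "i < length As" "As ! i = A" by (auto simp: in_set_conv_nth[of A As])
    with A have i: "i < length As" "As ! i \<notin> set normal_indices" by simp_all
    obtain B Bs where As: "As = B # Bs" using i by (cases As) auto
    show ?thesis
    proof (cases "i = 0")
      case True
      then show ?thesis using i head As by simp
    next
      case False
      then have "pull Q F (As[0 := As ! i, i := As ! 0]) = - pull Q F As"
        using i As alternating_form_swap[OF alt, of 0 As i] by auto
      moreover have "As[0 := As ! i, i := As ! 0] = As ! i # tl (As[0 := As ! i, i := As ! 0])"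
        using False i As by (cases i) auto
      ultimately show ?thesis using head i by (metis add.inverse_inverse add.inverse_neutral)
    qed
  qed
  define k where "k = pull Q F normal_indices"
  have "pull Q F As = k * normal_volume As" for As
    using alternating_form_unique[OF alt support alternating_normal_volume normal_volume_support
        length_normal_indices distinct_normal_indices, of As]
    by (simp add: k_def normal_volume_normal_indices)
  then have QF: "pull Q F = (\<lambda>As. k * normal_volume As)" by blast
  then have F_eq: "F = (\<lambda>As. k * pull Qi normal_volume As)"
    using pull_cmult by (metis pull_frame_coframe(2))
  have "form_contract (tractor_metric gt) ?k F F = fact ?k * (k * k)"
    using form_contract_normal[OF alt support] by (simp add: k_def)
  then have "k * k = 1" using F by simp
  moreover have "k > 0"
  proof -
    \<comment> \<open>The normal part of the adapted frame is itself the test frame: its components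
      are coordinate vectors, with determinant 1.\<close>
    let ?vs = "map e (tl coord_order)"
    have y: "(\<chi> b. bilin gt (e b) (e c)) = axis c 1" for c
      by (simp add: vec_eq_iff orthonormal axis_def)
    have "map (\<lambda>v. \<chi> b. bilin gt (e b) v) ?vs = map (\<lambda>a. axis a 1) (tl coord_order)"
      by (simp add: y)
    then have "axis b0 1 # map (\<lambda>v. \<chi> b. bilin gt (e b) v) ?vs = map (\<lambda>a. axis a 1) coord_order"
      by (metis coord_order_Cons list.simps(9))
    then have d: "list_det coord_order (axis b0 1 # map (\<lambda>v. \<chi> b. bilin gt (e b) v) ?vs) = 1"
      using vol_enum[OF coord_order[where 'n='n]] by (simp add: vol_def)
    have "set (tl coord_order) \<subseteq> - {b0}"
      using coord_order(1)[where 'n='n] by (metis coord_order_Cons ComplI distinct.simps(2) singletonD subsetI)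
    then have "set ?vs \<subseteq> normal_space G x t"
      by (auto simp: normal_space_iff orthonormal)
    moreover have "frame_det (velocity x t # ?vs) > 0"
      using frame_det_positive[of ?vs] d positive speed_gt_0 by simp
    moreover have "length ?vs = ?k" by simp
    ultimately have "form_eval F (map (normal_tractor G x t) ?vs) > 0" using F by blast
    also have "form_eval F (map (normal_tractor G x t) ?vs) = k * form_eval (pull Qi normal_volume) (map (normal_tractor G x t) ?vs)"
      unfolding F_eq form_eval_def by (simp add: sum_distrib_left mult.assoc)
    finally show "k > 0" using form_eval_normal_volume[of ?vs] d by simp
  qed
  ultimately have "k = 1" by (auto simp: square_eq_1_iff)
  then show "F = pull Qi normal_volume" using F_eq by simp
qed

text \<open>Contracting \<open>normal_volume\<close> with the volume form over the normal indices
  gives \<open>k!\<close> equal terms, which cancel the factor in \<open>hodge\<close> and leave the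
  remaining indices in \<open>conormal_volume\<close>.\<close>

lemma star_normal_form_frame:
  "star_normal_form G x t = (\<lambda>Bs. sgn (pull Qi (vol tractor_order) tractor_order) * pull Qi conormal_volume Bs)"
proof
  fix Bs :: "'n tractor_index list"
  let ?k = "CARD('n) - 1" and ?V = "vol tractor_order"
  define s where "s = sgn (pull Qi ?V tractor_order)"
  have inner: "form_contract (tractor_metric gt) ?k (pull Qi normal_volume) (pull Qi (\<lambda>Ds. ?V (Ds @ Es)))
      = fact ?k * conormal_volume Es" for Es
  proof -
    let ?E = "\<lambda>Ds. ?V (Ds @ Es)"
    show ?thesis
    \<comment> \<open>The identity is between functions on lists of every length; away from length 3
      both sides vanish because \<open>n - 1 + 3 = n + 2\<close>.\<close>
    proof (cases "length Es = 3")
      case True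
      have alt: "alternating_form ?k ?E"
      proof (rule alternating_formI)
        fix As :: "'n tractor_index list" assume "length As \<noteq> ?k"
        then show "?V (As @ Es) = 0"
          using True CARD_minus_1_plus_3[where 'n='n]
          by (intro alternating_form_length[OF alternating_vol_tractor]) simp
      next
        fix As :: "'n tractor_index list" and i j :: nat assume "length As = ?k" "i < j" "j < ?k"
        then show "?V (As[i := As ! j, j := As ! i] @ Es) = - ?V (As @ Es)"
          using alternating_form_swap[OF alternating_vol_tractor, of i "As @ Es" j]
          by (simp add: list_update_append nth_append)
      qed
      have eq: "normal_volume As * ?E (map flip_index As) = normal_volume As * ?E As" for As
      proof (cases "set As \<subseteq> set normal_indices")
        case True
        then have "map flip_index As = As" using flip_normal by (metis map_idI subsetD)
        then show ?thesis by simp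
      qed (simp add: normal_volume_support)
      then show ?thesis
        unfolding form_contract_frame pull_frame_coframe eq
        using sum_square_alternating[OF alternating_normal_volume normal_volume_support alt
            length_normal_indices distinct_normal_indices]
        by (simp add: normal_volume_normal_indices conormal_volume_def)
    next
      case False
      have "?E (map flip_index As) = 0" if "length As = ?k" for As
        using that False CARD_minus_1_plus_3[where 'n='n]
        by (intro alternating_form_length[OF alternating_vol_tractor]) simp
      moreover have "conormal_volume Es = 0"
        using alternating_form_length[OF alternating_conormal_volume False] .
      ultimately show ?thesis unfolding form_contract_frame pull_frame_coframe by simp
    qed
  qed
  have lin: "form_contract hh k E (\<lambda>Cs. c * (\<Sum>Es\<in>I. w Es * F Es Cs))
     = c * (\<Sum>Es\<in>I. w Es * form_contract hh k E (F Es))"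
    for hh :: "real^('n tractor_index)^('n tractor_index)" and k E c and I :: "'n tractor_index list set" and w F
  proof -
    have "form_contract hh k E (\<lambda>Cs. c * (\<Sum>Es\<in>I. w Es * F Es Cs)) = (\<Sum>As\<in>index_lists k. \<Sum>Bs\<in>index_lists k.
       \<Sum>Es\<in>I. c * (w Es * ((\<Prod>j<k. matrix_inv hh $ (As ! j) $ (Bs ! j)) * E As * F Es Bs)))"
      unfolding form_contract_def sum_distrib_left by (simp add: mult_ac)
    also have "\<dots> = (\<Sum>Es\<in>I. \<Sum>As\<in>index_lists k. \<Sum>Bs\<in>index_lists k.
       c * (w Es * ((\<Prod>j<k. matrix_inv hh $ (As ! j) $ (Bs ! j)) * E As * F Es Bs)))"
      by (subst (2) sum.swap, subst sum.swap) simp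
    finally show ?thesis unfolding form_contract_def by (simp add: sum_distrib_left)
  qed
  have "star_normal_form G x t Bs = 1 / fact ?k *
      form_contract (tractor_metric gt) ?k (pull Qi normal_volume) (\<lambda>Cs. s * pull Qi ?V (Cs @ Bs))"
    unfolding star_normal_form_def hodge_def normal_form_frame tractor_volume_frame(2) form_contract_def s_def
    by (simp add: mult_ac)
  also have "\<dots> = s * (\<Sum>Es\<in>index_lists (length Bs). (\<Prod>j<length Bs. Qi $ (Es ! j) $ (Bs ! j)) * conormal_volume Es)"
    unfolding pull_append lin inner by (simp add: sum_distrib_left mult_ac)
  also have "\<dots> = s * pull Qi conormal_volume Bs" by (simp add: pull_def mult.commute)
  finally show "star_normal_form G x t Bs = sgn (pull Qi ?V tractor_order) * pull Qi conormal_volume Bs"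
    by (simp add: s_def)
qed

end

section \<open>Frames moving along the curve and the matrix of the tractor connection in
  them\<close>

section \<open>Moving frames along a curve\<close>

context curve_in_metric
begin

lemma differentiable_ip:
  assumes "t \<in> T" "X differentiable at t" "Y differentiable at t"
  shows "(\<lambda>s. ip s (X s) (Y s)) differentiable at t"
  by (rule differentiableI_vector[OF has_vector_derivative_ip[OF assms(1)
        assms(2)[unfolded vector_derivative_works] assms(3)[unfolded vector_derivative_works]]])

lemma smooth_differentiable: "smooth_on T f \<Longrightarrow> t \<in> T \<Longrightarrow> f differentiable at t"
  for f :: "real \<Rightarrow> 'y::real_normed_vector"
  using smooth_on_has_derivative differentiableI by blast

lemma eventually_pos:
  fixes f :: "real \<Rightarrow> real"
  assumes "f differentiable at t" "f t > 0"
  shows "eventually (\<lambda>s. f s > 0) (nhds t)"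
proof -
  have "isCont f t" using assms(1) by (rule differentiable_imp_continuous_within)
  then have "eventually (\<lambda>s. f s > 0) (at t)"
    unfolding isCont_def using assms(2) by (rule order_tendstoD(1))
  then show ?thesis using assms(2) by (simp add: eventually_nhds_conv_at)
qed

lemma smooth_unit_tangent: "smooth_on T (\<lambda>t. (1 / sqrt (ip t (u t) (u t))) *\<^sub>R u t)"
  using speed_pos by (intro smooth_intros open_T smooth_ip smooth_u) force+

text \<open>Orthonormality is needed on a neighbourhood, since it will be differentiated, but
  differentiability only at \<open>t0\<close>.\<close>

lemma gram_schmidt:
  assumes t: "t0 \<in> T" and k: "Suc k \<le> CARD('n)"
  shows "\<exists>es :: nat \<Rightarrow> real \<Rightarrow> real^'n. es 0 = (\<lambda>t. (1 / sqrt (ip t (u t) (u t))) *\<^sub>R u t) \<and>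
    (\<forall>i\<le>k. es i differentiable at t0) \<and>
    (\<forall>\<^sub>F t in nhds t0. \<forall>i\<le>k. \<forall>j\<le>k. ip t (es i t) (es j t) = of_bool (i = j))"
  using k
proof (induction k)
  case 0
  let ?e = "\<lambda>t. (1 / sqrt (ip t (u t) (u t))) *\<^sub>R u t"
  have "?e differentiable at t0" by (rule smooth_differentiable[OF smooth_unit_tangent t])
  moreover have "eventually (\<lambda>t. ip t (?e t) (?e t) = 1) (nhds t0)"
    using eventually_T[OF t]
  proof eventually_elim
    case (elim t)
    then show ?case using speed_pos[OF elim] by (simp add: bilin_simps)
  qed
  ultimately show ?case by (intro exI[of _ "\<lambda>i. ?e"]) auto
next
  case (Suc k)
  then obtain es :: "nat \<Rightarrow> real \<Rightarrow> real^'n" where es: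
    "es 0 = (\<lambda>t. (1 / sqrt (ip t (u t) (u t))) *\<^sub>R u t)"
    "\<And>i. i \<le> k \<Longrightarrow> es i differentiable at t0"
    "\<forall>\<^sub>F t in nhds t0. \<forall>i\<le>k. \<forall>j\<le>k. ip t (es i t) (es j t) = of_bool (i = j)"
    by auto
  have "dim ((\<lambda>i. es i t0) ` {..k}) \<le> card ((\<lambda>i. es i t0) ` {..k})" by (rule dim_le_card') simp
  also have "\<dots> \<le> Suc k" using card_image_le[of "{..k}" "\<lambda>i. es i t0"] by simp
  also have "\<dots> < DIM(real^'n)" using Suc.prems by simp
  finally have "span ((\<lambda>i. es i t0) ` {..k}) \<noteq> UNIV" by (metis dim_UNIV dim_span less_irrefl)
  \<comment> \<open>A vector constant in the coordinates and independent of the frame at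
    \<open>t0\<close>. Its orthogonal remainder \<open>w\<close> is nonzero there, hence also nearby
    by continuity.\<close>
  then obtain v where v: "v \<notin> span ((\<lambda>i. es i t0) ` {..k})" by blast
  define w where "w = (\<lambda>t. v - (\<Sum>i\<le>k. ip t v (es i t) *\<^sub>R es i t))"
  have dw: "w differentiable at t0"
    unfolding w_def
    by (intro differentiable_diff differentiable_sum ballI differentiable_scaleR differentiable_const
        differentiable_ip[OF t]) (auto intro: es(2))
  have "w t0 \<noteq> 0"
  proof
    assume "w t0 = 0"
    then have "v = (\<Sum>i\<le>k. ip t0 v (es i t0) *\<^sub>R es i t0)" by (simp add: w_def)
    also have "\<dots> \<in> span ((\<lambda>i. es i t0) ` {..k})"
      by (intro span_sum span_scale span_base) auto
    finally show False using v by blast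
  qed
  then have w0: "ip t0 (w t0) (w t0) > 0" using spd_pos[OF spd_x[OF t]] by blast
  have dww: "(\<lambda>t. ip t (w t) (w t)) differentiable at t0" by (rule differentiable_ip[OF t dw dw])
  define es' where "es' = es(Suc k := (\<lambda>t. (1 / sqrt (ip t (w t) (w t))) *\<^sub>R w t))"
  have "(\<lambda>t. sqrt (ip t (w t) (w t))) differentiable at t0"
    using has_derivative_real_sqrt[OF w0 dww[unfolded frechet_derivative_works]] by (rule differentiableI)
  then have "(\<lambda>t. (1 / sqrt (ip t (w t) (w t))) *\<^sub>R w t) differentiable at t0"
    using w0 dw by (intro differentiable_scaleR differentiable_divide differentiable_const) auto
  then have "\<forall>i\<le>Suc k. es' i differentiable at t0"
    using es(2) by (auto simp: es'_def le_Suc_eq)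
  moreover have "\<forall>\<^sub>F t in nhds t0. \<forall>i\<le>Suc k. \<forall>j\<le>Suc k. ip t (es' i t) (es' j t) = of_bool (i = j)"
    using es(3) eventually_T[OF t] eventually_pos[OF dww w0]
  proof eventually_elim
    case (elim t)
    note sym = ip_commute[OF elim(2)]
    have o: "ip t (w t) (es j t) = 0" if "j \<le> k" for j
    proof -
      have "(\<Sum>i\<le>k. ip t v (es i t) * ip t (es i t) (es j t)) = (\<Sum>i\<le>k. if i = j then ip t v (es i t) else 0)"
        using elim(1) that by (intro sum.cong) auto
      then show ?thesis using that by (simp add: w_def bilin_simps bilin_sum)
    qed
    then have o': "ip t (es j t) (w t) = 0" if "j \<le> k" for j
      using that sym[of "es j t" "w t"] by simp
    show ?case
    proof (intro allI impI)
      fix i j assume "i \<le> Suc k" "j \<le> Suc k"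
      then show "ip t (es' i t) (es' j t) = of_bool (i = j)"
        using elim(1,3) o o' by (cases "i = Suc k"; cases "j = Suc k") (auto simp: es'_def bilin_simps)
    qed
  qed
  ultimately show ?case using es(1) by (intro exI[of _ es']) (simp add: es'_def)
qed

lemma det_differentiable:
  fixes M :: "real \<Rightarrow> real^'m::finite^'m"
  assumes "\<And>i j. (\<lambda>t. M t $ i $ j) differentiable at t0"
  shows "(\<lambda>t. det (M t)) differentiable at t0"
proof -
  have "(\<lambda>t. \<Prod>i\<in>I. M t $ i $ p i) differentiable at t0" for p and I :: "'m set"
    by (induction I rule: infinite_finite_induct) (auto intro: differentiable_mult assms)
  then show ?thesis unfolding det_def
    by (intro differentiable_sum differentiable_mult differentiable_const) auto
qed

lemma exists_moving_frame:
  assumes t: "t0 \<in> T" and n: "CARD('n) \<ge> 2"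
  shows "\<exists>e :: real \<Rightarrow> 'n \<Rightarrow> real^'n. (\<forall>b. (\<lambda>t. e t b) differentiable at t0) \<and>
    (\<forall>\<^sub>F t in nhds t0. t \<in> T \<and> adapted_basis G x t (e t))"
proof -
  let ?k = "CARD('n) - 1" and ?b0 = "hd (coord_order :: 'n list)" and ?b1 = "(coord_order :: 'n list) ! 1"
  have "Suc ?k \<le> CARD('n)" using n by simp
  from gram_schmidt[OF t this] obtain es :: "nat \<Rightarrow> real \<Rightarrow> real^'n" where es:
    "es 0 = (\<lambda>t. (1 / sqrt (ip t (u t) (u t))) *\<^sub>R u t)"
    "\<And>i. i \<le> ?k \<Longrightarrow> es i differentiable at t0"
    "\<forall>\<^sub>F t in nhds t0. \<forall>i\<le>?k. \<forall>j\<le>?k. ip t (es i t) (es j t) = of_bool (i = j)"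
    by blast
  let ?pos = "list_pos (coord_order :: 'n list)"
  have pos: "?pos b \<le> ?k" "coord_order ! ?pos b = b" for b :: 'n
    using list_pos[OF coord_order, of b] by auto
  have pos_eq: "?pos b = ?pos c \<longleftrightarrow> b = c" for b c by (metis pos(2))
  have ne: "coord_order \<noteq> ([] :: 'n list)" by (metis coord_order_Cons list.distinct(1))
  have pos0: "?pos ?b0 = 0" and pos1: "?pos ?b1 = 1"
    using list_pos_nth[OF coord_order[where 'n='n], of 0] list_pos_nth[OF coord_order[where 'n='n], of 1] n ne by (simp_all add: hd_conv_nth)
  then have b01: "?b1 \<noteq> ?b0" using pos_eq by auto
  define f where "f = (\<lambda>t b. es (?pos b) t)"
  define d where "d = (\<lambda>f :: 'n \<Rightarrow> real^'n. det (\<chi> i b. f b $ i))"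
  \<comment> \<open>The orientation is corrected on the vector at position 1, because position 0
    holds the tangent. The sign is chosen once, at \<open>t0\<close>, and continuity of the
    determinant keeps the frame positive nearby.\<close>
  define s where "s = (if d (f t0) > 0 then 1 else -1 :: real)"
  define e where "e = (\<lambda>t b. (if b = ?b1 then s else 1) *\<^sub>R f t b)"
  have ss: "s * s = 1" by (simp add: s_def)
  have de: "(\<lambda>t. e t b) differentiable at t0" for b
    unfolding e_def f_def by (intro differentiable_scaleR differentiable_const es(2) pos)
  have on: "\<forall>\<^sub>F t in nhds t0. \<forall>b c. ip t (e t b) (e t c) = of_bool (b = c)"
    using es(3)
  proof eventually_elim
    case (elim t)
    then have f: "ip t (f t b) (f t c) = of_bool (b = c)" for b c
      unfolding f_def using pos(1)[of b] pos(1)[of c] pos_eq[of b c] by simp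
    show ?case by (auto simp: e_def bilin_simps f ss)
  qed
  have "d (e t0) \<noteq> 0"
  proof
    assume z: "d (e t0) = 0"
    from on have "\<forall>b c. ip t0 (e t0 b) (e t0 c) = of_bool (b = c)" by (rule eventually_nhds_x_imp_x)
    then interpret orthonormal_basis "G (x t0)" 0 "e t0"
      using spd_x[OF t] by unfold_locales auto
    \<comment> \<open>A covector that kills all frame vectors kills everything they span, in
      particular \<open>y\<close> itself.\<close>
    from z obtain y where y: "y \<noteq> 0" "y v* (\<chi> i b. e t0 b $ i) = 0"
      by (metis d_def det_transpose invertible_det_nz invertible_left_inverse matrix_left_invertible_ker
          vector_transpose_matrix transpose_transpose)
    have "y \<bullet> e t0 b = 0" for b
      using y(2) by (simp add: vec_eq_iff vector_matrix_mult_def inner_vec_def mult.commute)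
    then have "y \<bullet> y = 0" by (subst (2) expand) (simp add: inner_sum_right)
    then show False using y(1) by simp
  qed
  moreover have "d (e t0) = s * d (f t0)"
  proof -
    have "d (e t0) = det (transpose (\<chi> i. if i = ?b1 then s *s f t0 i else f t0 i))"
      unfolding d_def e_def
      by (rule arg_cong[where f=det]) (auto simp: vec_eq_iff transpose_def)
    also have "\<dots> = s * det (\<chi> i. if i = ?b1 then f t0 i else f t0 i)"
      unfolding det_transpose by (rule det_row_mul)
    also have "\<dots> = s * d (f t0)"
      unfolding d_def by (subst det_transpose[symmetric]) (auto simp: transpose_def intro!: arg_cong[where f=det])
    finally show ?thesis .
  qed
  ultimately have "d (e t0) > 0" by (auto simp: s_def split: if_splits)
  moreover have "(\<lambda>t. d (e t)) differentiable at t0"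
    unfolding d_def
  proof (rule det_differentiable)
    fix i j
    show "(\<lambda>t. (\<chi> i b. e t b $ i) $ i $ j) differentiable at t0"
      using differentiable_compose[OF bounded_linear_imp_differentiable[OF bounded_linear_vec_nth[of i]] de[of j]]
      by simp
  qed
  ultimately have pos: "\<forall>\<^sub>F t in nhds t0. d (e t) > 0" using eventually_pos by blast
  have "\<forall>\<^sub>F t in nhds t0. t \<in> T \<and> adapted_basis G x t (e t)"
    using on eventually_T[OF t] pos
  proof eventually_elim
    case (elim t)
    then show ?case
      using spd_x[of t] velocity_nonzero[of t] H_normal[of t] b01
      by (intro conjI adapted_basis.intro orthonormal_basis.intro adapted_basis_axioms.intro)
        (auto simp: d_def e_def f_def pos0 es(1))
  qed
  then show ?thesis using de by blast
qed

end

section \<open>The connection in a moving frame\<close>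

lemma linear_tractor_conn: "linear (tractor_conn G y w)"
proof (rule linearI)
  show "tractor_conn G y w (V + W) = tractor_conn G y w V + tractor_conn G y w W" for V W
    by (rule tractor_eqI)
      (simp_all add: tractor_conn_def mid_def inner_vec_def bilin_def matrix_vector_mult_def
        algebra_simps sum.distrib sum_subtractf sum_distrib_left)
  show "tractor_conn G y w (c *\<^sub>R V) = c *\<^sub>R tractor_conn G y w V" for c V
    by (rule tractor_eqI)
      (simp_all add: tractor_conn_def mid_def inner_vec_def bilin_def matrix_vector_mult_def
        algebra_simps sum.distrib sum_subtractf sum_distrib_left)
qed

lemma tractor_conn_matrix_mult: "tractor_conn_matrix G x t *v V = tractor_conn G (x t) (velocity x t) V"
  unfolding tractor_conn_matrix_def using linear_tractor_conn by (intro matrix_works) (simp add: linear_matrix_vector_mul_eq)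

lemma has_vector_derivative_tractor:
  assumes "(\<sigma> has_vector_derivative \<sigma>') (at t)" "(\<mu> has_vector_derivative \<mu>') (at t)"
    "(\<rho> has_vector_derivative \<rho>') (at t)"
  shows "((\<lambda>s. tractor (\<sigma> s) (\<mu> s) (\<rho> s)) has_vector_derivative tractor \<sigma>' \<mu>' \<rho>') (at t)"
proof (rule has_vector_derivative_vecI)
  fix A :: "'a tractor_index"
  show "((\<lambda>s. tractor (\<sigma> s) (\<mu> s) (\<rho> s) $ A) has_vector_derivative tractor \<sigma>' \<mu>' \<rho>' $ A) (at t)"
    using assms has_vector_derivative_vec_nth[OF assms(2)] by (cases A) auto
qed

context curve_in_metric
begin

lemma lower_schouten_endo:
  assumes t: "t \<in> T"
  shows "(\<Sum>a\<in>UNIV. w $ a * schouten G (x t) $ a $ b) = (G (x t) *v schouten_endo G (x t) w) $ b"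
proof -
  let ?g = "G (x t)" and ?z = "transpose (schouten G (x t)) *v w"
  have "schouten_endo G (x t) w = transpose (matrix_inv ?g) *v ?z"
    unfolding schouten_endo_def
    by (simp add: vec_eq_iff matrix_vector_mult_def transpose_def sum_distrib_left mult_ac)
      (subst sum.swap, simp)
  then have "?g *v schouten_endo G (x t) w = (?g ** transpose (matrix_inv ?g)) *v ?z"
    by (simp only: matrix_vector_mul_assoc matrix_mul_assoc)
  also have "?g ** transpose (matrix_inv ?g) = transpose ?g ** transpose (matrix_inv ?g)"
    using spd_x[OF t] by (simp add: spd_def)
  also have "\<dots> = mat 1"
    by (simp add: spd_matrix_inv[OF spd_x[OF t]] transpose_mat flip: matrix_transpose_mul)
  also have "mat 1 *v ?z = ?z" by (rule matrix_vector_mul_lid)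
  finally show ?thesis by (simp add: matrix_vector_mult_def transpose_def mult.commute)
qed

text \<open>The tractor connection, with the middle slot written as a vector \<open>v\<close> instead of a covector.\<close>

lemma has_tractor_derivative:
  fixes t defines "p \<equiv> schouten_endo G (x t) (u t)"
  assumes t: "t \<in> T" and \<sigma>: "(\<sigma> has_vector_derivative \<sigma>') (at t)"
    and v: "(v has_vector_derivative v') (at t)" and \<rho>: "(\<rho> has_vector_derivative \<rho>') (at t)"
  obtains W where "((\<lambda>s. tractor (\<sigma> s) (G (x s) *v v s) (\<rho> s)) has_vector_derivative W) (at t)"
    "W + tractor_conn_matrix G x t *v tractor (\<sigma> t) (G (x t) *v v t) (\<rho> t) =
      tractor (\<sigma>' - ip t (u t) (v t))
        (G (x t) *v (v' + conn_matrix G x t *v v t + \<sigma> t *\<^sub>R p + \<rho> t *\<^sub>R u t))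
        (\<rho>' - ip t p (v t))"
proof
  let ?g = "G (x t)" and ?M = "conn_matrix G x t" and ?P = "schouten G (x t)"
  let ?W = "tractor \<sigma>' (transpose ?M *v (?g *v v t) + ?g *v (v' + ?M *v v t)) \<rho>'"
  show "((\<lambda>s. tractor (\<sigma> s) (G (x s) *v v s) (\<rho> s)) has_vector_derivative ?W) (at t)"
    by (intro has_vector_derivative_tractor \<sigma> \<rho> has_vector_derivative_lower t v)
  have "bilin ?P (u t) (matrix_inv ?g *v (?g *v v t)) = ip t p (v t)"
  proof -
    have "bilin ?P (u t) (v t) = (\<Sum>b\<in>UNIV. (\<Sum>a\<in>UNIV. u t $ a * ?P $ a $ b) * v t $ b)"
      unfolding bilin_def inner_vec_def matrix_vector_mult_def sum_distrib_right
      by (subst sum.swap) (simp add: sum_distrib_left mult.assoc)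
    also have "\<dots> = (?g *v p) \<bullet> v t"
      unfolding lower_schouten_endo[OF t] p_def by (simp add: inner_vec_def)
    also have "\<dots> = ip t p (v t)"
      using ip_commute[OF t, of p] by (simp add: bilin_def inner_commute)
    finally show ?thesis by (simp add: matrix_vector_mul_assoc spd_matrix_inv[OF spd_x[OF t]])
  qed
  moreover have "(\<Sum>a\<in>UNIV. u t $ a * (?P $ a $ b * \<sigma> t + ?g $ a $ b * \<rho> t
        - (\<Sum>c\<in>UNIV. christoffel G (x t) c a b * (?g *v v t) $ c)))
      = (?g *v (\<sigma> t *\<^sub>R p + \<rho> t *\<^sub>R u t)) $ b - (transpose ?M *v (?g *v v t)) $ b" for b
  proof -
    have "(transpose ?M *v (?g *v v t)) $ b
       = (\<Sum>a\<in>UNIV. u t $ a * (\<Sum>c\<in>UNIV. christoffel G (x t) c a b * (?g *v v t) $ c))"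
      by (subst matrix_vector_mult_def)
        (simp add: transpose_def conn_matrix_def sum_distrib_left sum_distrib_right mult_ac, subst sum.swap, simp)
    moreover have "(?g *v u t) $ b = (\<Sum>a\<in>UNIV. u t $ a * ?g $ a $ b)"
      by (simp add: matrix_vector_mult_def spd_nth[OF spd_x[OF t], of b] mult.commute)
    ultimately show ?thesis
      by (simp add: matrix_vector_right_distrib matrix_vector_mult_scaleR
          lower_schouten_endo[OF t, symmetric] p_def sum_distrib_left algebra_simps sum.distrib sum_subtractf)
  qed
  ultimately show "?W + tractor_conn_matrix G x t *v tractor (\<sigma> t) (?g *v v t) (\<rho> t) =
      tractor (\<sigma>' - ip t (u t) (v t)) (?g *v (v' + ?M *v v t + \<sigma> t *\<^sub>R p + \<rho> t *\<^sub>R u t)) (\<rho>' - ip t p (v t))"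
    unfolding tractor_conn_matrix_mult
    by (intro tractor_eqI) (simp_all add: tractor_conn_def matrix_vector_right_distrib bilin_def)
qed

end

lemma has_vector_derivative_cong_nhds:
  assumes "\<forall>\<^sub>F s in nhds t. f s = g s" "(g has_vector_derivative d) (at t)"
  shows "(f has_vector_derivative d) (at t)"
  using assms has_vector_derivative_cong_ev[where x=t and S=UNIV and f=f and g=g and f'=d] eventually_nhds_x_imp_x[OF assms(1)] by simp

lemmas matrix_diff_ldistrib = bounded_bilinear.diff_right[OF bounded_bilinear_matrix_matrix_mult]
lemmas matrix_diff_rdistrib = bounded_bilinear.diff_left[OF bounded_bilinear_matrix_matrix_mult]

lemma pull_eq_0_iff:
  assumes "M ** N = mat 1"
  shows "(\<forall>As. length As = k \<longrightarrow> pull M F As = 0) \<longleftrightarrow> (\<forall>As. length As = k \<longrightarrow> F As = 0)"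
proof
  assume *: "\<forall>As. length As = k \<longrightarrow> pull M F As = 0"
  show "\<forall>As. length As = k \<longrightarrow> F As = 0"
  proof (intro allI impI)
    fix As :: "'a list" assume "length As = k"
    then have "pull N (pull M F) As = 0"
      using * unfolding pull_def[of N] by (intro sum.neutral) auto
    then show "F As = 0" by (simp add: pull_pull assms)
  qed
qed (auto simp: pull_def)

locale moving_frame = curve_in_metric G U x T
  for G :: "real^'n::finite \<Rightarrow> real^'n^'n" and U x T +
  fixes t0 :: real and e :: "real \<Rightarrow> 'n \<Rightarrow> real^'n"
  assumes t0: "t0 \<in> T" and differentiable_e: "\<And>b. (\<lambda>t. e t b) differentiable at t0"
    and adapted: "\<forall>\<^sub>F t in nhds t0. adapted_basis G x t (e t)"
begin

sublocale adapted_basis G x t0 "e t0"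
  using adapted by (rule eventually_nhds_x_imp_x)

abbreviation "Qt t \<equiv> frame_matrix (G (x t)) (H t) (e t)"
abbreviation "Qit t \<equiv> coframe_matrix (G (x t)) (H t) (e t)"
abbreviation "M \<equiv> conn_matrix G x t0"
abbreviation "A \<equiv> tractor_conn_matrix G x t0"
abbreviation "cc \<equiv> conformal_curvature G x t0"
abbreviation "g0 \<equiv> bilin (G (x t0))"

definition "De b = vector_derivative (\<lambda>t. e t b) (at t0) + M *v e t0 b"
definition "DH = vector_derivative H (at t0) + M *v H t0"
definition "p = schouten_endo G (x t0) (u t0)"

lemmas e_deriv = differentiable_e[unfolded vector_derivative_works]

lemma H_deriv: "(H has_vector_derivative vector_derivative H (at t0)) (at t0)"
  by (rule smooth_on_has_vector_derivative[OF smooth_H t0])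

lemmas commute0 = ip_commute[OF t0]

text \<open>Both sides of the orthonormality relations are differentiated; this is possible because
  they hold near \<open>t0\<close>.\<close>

lemma De_skew: "g0 (De b) (e t0 c) + g0 (e t0 b) (De c) = 0"
proof -
  have "\<forall>\<^sub>F t in nhds t0. ip t (e t b) (e t c) = of_bool (b = c)"
    using adapted by eventually_elim (rule orthonormal_basis.orthonormal[OF adapted_basis.axioms(1)])
  then have "((\<lambda>t. ip t (e t b) (e t c)) has_vector_derivative 0) (at t0)"
    by (rule has_vector_derivative_cong_nhds) simp
  moreover have "((\<lambda>t. ip t (e t b) (e t c)) has_vector_derivative g0 (De b) (e t0 c) + g0 (e t0 b) (De c)) (at t0)"
    unfolding De_def by (rule has_vector_derivative_ip[OF t0 e_deriv e_deriv])
  ultimately show ?thesis by (rule vector_derivative_unique_at[symmetric])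
qed

lemma De_diag: "g0 (e t0 b) (De b) = 0"
  using De_skew[of b b] commute0[of "De b" "e t0 b"] by simp

lemma normal_e: "b \<noteq> b0 \<Longrightarrow> g0 (e t0 b) (u t0) = 0"
  by (subst velocity_eq) (simp add: bilin_simps orthonormal)

lemma tangent_e: "g0 (e t0 b0) (u t0) = speed"
  by (subst velocity_eq) (simp add: bilin_simps orthonormal)

text \<open>The normal part of the derivative of \<open>u/|u|\<close> is the normal acceleration
  divided by \<open>|u|\<close>, which is \<open>|u| H\<close>. In the connection matrix this
  cancels against the slot \<open>g(e_b,H)\<close>.\<close>

lemma De_tangent:
  assumes b: "b \<noteq> b0"
  shows "g0 (e t0 b) (De b0) = speed * g0 (e t0 b) (H t0)"
proof -
  let ?r = "\<lambda>t. 1 / sqrt (ip t (u t) (u t))"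
  have sr: "smooth_on T ?r"
    using speed_pos by (intro smooth_intros open_T smooth_ip smooth_u) force+
  note hr = smooth_on_has_vector_derivative[OF sr t0] and hu = smooth_on_has_vector_derivative[OF smooth_u t0]
  have "((\<lambda>t. ?r t *\<^sub>R u t) has_vector_derivative
      ?r t0 *\<^sub>R vector_derivative u (at t0) + vector_derivative ?r (at t0) *\<^sub>R u t0) (at t0)"
    by (rule has_vector_derivative_scaleR[OF hr[unfolded has_real_derivative_iff_has_vector_derivative[symmetric]] hu])
  moreover have "\<forall>\<^sub>F t in nhds t0. e t b0 = ?r t *\<^sub>R u t"
    using adapted by eventually_elim (rule adapted_basis.tangent)
  ultimately have "((\<lambda>t. e t b0) has_vector_derivative
      ?r t0 *\<^sub>R vector_derivative u (at t0) + vector_derivative ?r (at t0) *\<^sub>R u t0) (at t0)"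
    by (rule has_vector_derivative_cong_nhds[rotated])
  then have "De b0 = ?r t0 *\<^sub>R acceleration G x t0 + vector_derivative ?r (at t0) *\<^sub>R u t0"
    unfolding De_def tangent
    by (simp add: vector_derivative_at acceleration_def cov_deriv_conn_matrix
        matrix_vector_mult_scaleR scaleR_add_right)
  then have "g0 (e t0 b) (De b0) = ?r t0 * g0 (e t0 b) (acceleration G x t0)"
    by (simp add: bilin_simps normal_e[OF b])
  also have "g0 (e t0 b) (acceleration G x t0) = speed * speed * g0 (e t0 b) (H t0)"
    using speed_pos[OF t0] by (subst acceleration_eq[OF t0]) (simp add: bilin_simps normal_e[OF b])
  also have "1 / r * (r * r * y) = r * y" if "r > 0" for r y :: real using that by simp
  from this[OF speed_gt_0] have "1 / speed * (speed * speed * g0 (e t0 b) (H t0)) = speed * g0 (e t0 b) (H t0)" .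
  finally show ?thesis .
qed

lemma conformal_curvature_e:
  "b \<noteq> b0 \<Longrightarrow> g0 (e t0 b) cc = g0 (e t0 b) p - g0 (e t0 b) DH"
  unfolding conformal_curvature_def normal_proj_eq[OF t0]
  by (simp add: bilin_simps normal_e p_def DH_def cov_deriv_conn_matrix)

lemma conformal_curvature_eq_0_iff: "cc = 0 \<longleftrightarrow> (\<forall>b. b \<noteq> b0 \<longrightarrow> g0 (e t0 b) cc = 0)"
proof
  assume *: "\<forall>b. b \<noteq> b0 \<longrightarrow> g0 (e t0 b) cc = 0"
  have "g0 (u t0) cc = g0 cc (u t0)" by (rule commute0)
  also have "\<dots> = 0" unfolding conformal_curvature_def by (rule normal_proj_normal[OF t0])
  finally have "g0 (e t0 b0) cc = 0" by (simp add: tangent bilin_simps)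
  with * have z: "g0 (e t0 b) cc = 0" for b by metis
  have "cc = (\<Sum>b\<in>UNIV. g0 (e t0 b) cc *\<^sub>R e t0 b)" by (rule expand)
  also have "\<dots> = 0" unfolding z by simp
  finally show "cc = 0" .
qed (simp add: bilin_simps)

text \<open>The covariant derivatives of the frame columns, left exactly in the form produced by
  \<open>has_tractor_derivative\<close>, including the trivial summands and factors, so that the
  rule applies to each case directly.\<close>

definition dcol :: "'n tractor_index \<Rightarrow> 'n tractor" where
  "dcol B = (case B of
      Hi \<Rightarrow> tractor (0 - g0 (u t0) (- H t0)) (gt *v (- DH + 1 *\<^sub>R p + (- (g0 (H t0) (H t0) / 2)) *\<^sub>R u t0))
        (- (g0 (H t0) DH) - g0 p (- H t0))
    | Mid b \<Rightarrow> tractor (0 - g0 (u t0) (e t0 b)) (gt *v (De b + 0 *\<^sub>R p + g0 (e t0 b) (H t0) *\<^sub>R u t0))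
        (g0 (De b) (H t0) + g0 (e t0 b) DH - g0 p (e t0 b))
    | Lo \<Rightarrow> tractor (0 - g0 (u t0) 0) (gt *v (0 + M *v 0 + 0 *\<^sub>R p + 1 *\<^sub>R u t0)) (0 - g0 p 0))"

lemma frame_col_derivative:
  obtains W where "((\<lambda>t. frame_col (G (x t)) (H t) (e t) B) has_vector_derivative W) (at t0)"
    "W + A *v frame_col gt (H t0) (e t0) B = dcol B"
proof (cases B)
  case Hi
  have "((\<lambda>t. - (ip t (H t) (H t) / 2)) has_vector_derivative - ((g0 DH (H t0) + g0 (H t0) DH) / 2)) (at t0)"
    unfolding DH_def
    by (intro has_vector_derivative_minus has_vector_derivative_divide has_vector_derivative_ip t0 H_deriv)
  moreover have "- ((g0 DH (H t0) + g0 (H t0) DH) / 2) = - (g0 (H t0) DH)"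
    using commute0[of DH "H t0"] by simp
  ultimately have r: "((\<lambda>t. - (ip t (H t) (H t) / 2)) has_vector_derivative - (g0 (H t0) DH)) (at t0)"
    by simp
  have DH: "- vector_derivative H (at t0) + M *v (- H t0) = - DH"
    using matrix_vector_mult_scaleR[of M "-1" "H t0"] by (simp add: DH_def)
  show thesis
    by (rule has_tractor_derivative[OF t0 has_vector_derivative_const has_vector_derivative_minus[OF H_deriv] r, of 1,
          unfolded DH], rule that)
      (simp_all add: Hi frame_col_def dcol_def p_def)
next
  case (Mid b)
  have r: "((\<lambda>t. ip t (e t b) (H t)) has_vector_derivative (g0 (De b) (H t0) + g0 (e t0 b) DH)) (at t0)"
    unfolding De_def DH_def by (rule has_vector_derivative_ip[OF t0 e_deriv H_deriv])
  show thesis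
    by (rule has_tractor_derivative[OF t0 has_vector_derivative_const e_deriv[of b] r, of 0], rule that)
      (simp_all add: Mid frame_col_def dcol_def p_def De_def)
next
  case Lo
  show thesis
    by (rule has_tractor_derivative[OF t0 has_vector_derivative_const has_vector_derivative_const
          has_vector_derivative_const, of 0 0 1], rule that)
      (simp_all add: Lo frame_col_def dcol_def p_def)
qed

text \<open>The connection matrix in the moving frame: \<open>\<nabla> Q = Q om\<close>.\<close>

definition om :: "real^('n tractor_index)^('n tractor_index)" where
  "om = (\<chi> a b. coframe_row gt (H t0) (e t0) a \<bullet> dcol b)"

text \<open>In row \<open>Mid b\<close> the \<open>Hi\<close> entry is
  \<open>g(e_b, P u - D H)\<close>, the conformal curvature; the \<open>Mid b0\<close> entry is
  \<open>|u| g(e_b,H)\<close> from the turning tangent minus the same term from the coframe. The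
  other block repeats this with opposite sign, by metricity.\<close>

lemma om_entries:
  "om $ Hi $ Hi = 0" "om $ Lo $ Lo = 0" "om $ Mid b $ Mid b = 0"
  "b \<noteq> b0 \<Longrightarrow> om $ Mid b $ Hi = g0 (e t0 b) cc"
  "b \<noteq> b0 \<Longrightarrow> om $ Mid b $ Mid b0 = 0"
  "b \<noteq> b0 \<Longrightarrow> om $ Mid b $ Lo = 0"
  "b \<noteq> b0 \<Longrightarrow> om $ Hi $ Mid b = 0"
  "b \<noteq> b0 \<Longrightarrow> om $ Mid b0 $ Mid b = 0"
  "b \<noteq> b0 \<Longrightarrow> om $ Lo $ Mid b = - g0 (e t0 b) cc"
proof -
  have uc: "g0 (u t0) (H t0) = g0 (H t0) (u t0)" "g0 (u t0) (e t0 c) = g0 (e t0 c) (u t0)"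
    "g0 p (H t0) = g0 (H t0) p" "g0 p (e t0 c) = g0 (e t0 c) p"
    "g0 (H t0) (e t0 c) = g0 (e t0 c) (H t0)" "g0 (De c) (H t0) = g0 (H t0) (De c)" for c
    by (rule commute0)+
  note s = om_def dcol_def coframe_values bilin_simps orthonormal H_normal uc normal_e De_diag De_tangent
    tangent_e conformal_curvature_e
  show "om $ Hi $ Hi = 0" "om $ Lo $ Lo = 0" "om $ Mid b $ Mid b = 0" by (simp_all add: s)
  assume b: "b \<noteq> b0"
  show "om $ Mid b $ Hi = g0 (e t0 b) cc" "om $ Mid b $ Mid b0 = 0" "om $ Mid b $ Lo = 0"
    "om $ Hi $ Mid b = 0" "om $ Lo $ Mid b = - g0 (e t0 b) cc"
    using b by (simp_all add: s)
  have "g0 (e t0 b0) (De b) = - (speed * g0 (e t0 b) (H t0))"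
    using De_skew[of b0 b] De_tangent[OF b] commute0[of "De b0" "e t0 b"] by simp
  then show "om $ Mid b0 $ Mid b = 0" using b by (simp add: s)
qed

lemma om_diag: "om $ a $ a = 0"
  by (cases a) (auto simp: om_entries)

lemma om_normal_iff:
  "(\<forall>b\<in>set normal_indices. \<forall>a. a \<notin> set normal_indices \<longrightarrow> om $ b $ a = 0) \<longleftrightarrow> cc = 0"
proof
  assume *: "\<forall>b\<in>set normal_indices. \<forall>a. a \<notin> set normal_indices \<longrightarrow> om $ b $ a = 0"
  have "g0 (e t0 b) cc = 0" if "b \<noteq> b0" for b
    using *[rule_format, of "Mid b" Hi] that om_entries(4)[OF that] by (simp add: set_normal_indices)
  then show "cc = 0" using conformal_curvature_eq_0_iff by blast
next
  assume cc: "cc = 0"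
  have "om $ b $ a = 0" if "b \<in> set normal_indices" "a \<notin> set normal_indices" for a b
    using that om_entries(4-6) by (cases a) (auto simp: set_normal_indices cc bilin_simps)
  then show "\<forall>b\<in>set normal_indices. \<forall>a. a \<notin> set normal_indices \<longrightarrow> om $ b $ a = 0" by blast
qed

text \<open>The opposite off-diagonal block from the preceding lemma: here the conformal curvature
  is read off the \<open>Lo\<close> row instead of the \<open>Hi\<close> column.\<close>

lemma om_conormal_iff:
  "(\<forall>b\<in>set conormal_indices. \<forall>a. a \<notin> set conormal_indices \<longrightarrow> om $ b $ a = 0) \<longleftrightarrow> cc = 0"
proof
  assume *: "\<forall>b\<in>set conormal_indices. \<forall>a. a \<notin> set conormal_indices \<longrightarrow> om $ b $ a = 0"
  have "g0 (e t0 b) cc = 0" if "b \<noteq> b0" for b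
    using *[rule_format, of Lo "Mid b"] that om_entries(9)[OF that] by (simp add: conormal_indices_def)
  then show "cc = 0" using conformal_curvature_eq_0_iff by blast
next
  assume cc: "cc = 0"
  have "om $ b $ a = 0" if "b \<in> set conormal_indices" "a \<notin> set conormal_indices" for a b
    using that om_entries(7-9) by (cases a) (auto simp: conormal_indices_def cc bilin_simps)
  then show "\<forall>b\<in>set conormal_indices. \<forall>a. a \<notin> set conormal_indices \<longrightarrow> om $ b $ a = 0" by blast
qed

lemma frame_derivative: "(Qt has_vector_derivative (Q ** om - A ** Q)) (at t0)"
proof (intro has_vector_derivative_vecI)
  fix a b
  obtain W where W: "((\<lambda>t. frame_col (G (x t)) (H t) (e t) b) has_vector_derivative W) (at t0)"
    "W + A *v frame_col gt (H t0) (e t0) b = dcol b"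
    by (rule frame_col_derivative)
  have "(Q ** om) $ a $ b = (Q *v (Qi *v dcol b)) $ a"
    by (simp add: matrix_matrix_mult_def om_def coframe_mult matrix_vector_mult_def[of Q])
  then have "(Q ** om) $ a $ b = dcol b $ a" by simp
  moreover have "(A ** Q) $ a $ b = (A *v frame_col gt (H t0) (e t0) b) $ a"
    by (simp add: matrix_matrix_mult_def matrix_vector_mult_def frame_matrix_def)
  moreover have "(W + A *v frame_col gt (H t0) (e t0) b) $ a = dcol b $ a" by (simp only: W(2))
  ultimately have "(Q ** om - A ** Q) $ a $ b = W $ a" by simp
  then show "((\<lambda>t. Qt t $ a $ b) has_vector_derivative (Q ** om - A ** Q) $ a $ b) (at t0)"
    using has_vector_derivative_vec_nth[OF W(1), of a] by (simp add: frame_matrix_def)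
qed

lemma coframe_differentiable: "Qit differentiable at t0"
proof -
  have row: "\<exists>W. ((\<lambda>t. coframe_row (G (x t)) (H t) (e t) a) has_vector_derivative W) (at t0)" for a
  proof (cases a)
    case Hi
    then show ?thesis unfolding coframe_row_def by (auto intro: has_vector_derivative_const)
  next
    case (Mid b)
    show ?thesis unfolding coframe_row_def Mid tractor_index.case
      using has_vector_derivative_tractor[OF has_vector_derivative_ip[OF t0 e_deriv[of b] H_deriv] e_deriv[of b]
          has_vector_derivative_const] by blast
  next
    case Lo
    show ?thesis unfolding coframe_row_def Lo tractor_index.case
      using has_vector_derivative_tractor[OF has_vector_derivative_minus[OF has_vector_derivative_divide[OF
          has_vector_derivative_ip[OF t0 H_deriv H_deriv]]] has_vector_derivative_minus[OF H_deriv]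
          has_vector_derivative_const] by blast
  qed
  then obtain W where "\<And>a. ((\<lambda>t. coframe_row (G (x t)) (H t) (e t) a) has_vector_derivative W a) (at t0)"
    by metis
  then have "(Qit has_vector_derivative (\<chi> a. W a)) (at t0)"
    by (intro has_vector_derivative_vecI[where f=Qit and f'="\<chi> a. W a"]) (simp add: coframe_matrix_def)
  then show ?thesis by (rule differentiableI_vector)
qed

text \<open>Obtained by differentiating \<open>Qi ** Q = mat 1\<close>, which holds near
  \<open>t0\<close>. Differentiability of the coframe has to be known beforehand and comes from its
  closed form.\<close>

lemma coframe_derivative: "(Qit has_vector_derivative (Qi ** A - om ** Qi)) (at t0)"
proof -
  define Z where "Z = vector_derivative Qit (at t0)"
  have Z: "(Qit has_vector_derivative Z) (at t0)"
    unfolding Z_def using coframe_differentiable by (simp add: vector_derivative_works)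
  have "((\<lambda>t. Qit t ** Qt t) has_vector_derivative (Qi ** (Q ** om - A ** Q) + Z ** Q)) (at t0)"
    by (rule has_vector_derivative_matrix_matrix_mult[OF Z frame_derivative])
  moreover have "((\<lambda>t. Qit t ** Qt t) has_vector_derivative 0) (at t0)"
  proof (rule has_vector_derivative_cong_nhds)
    show "\<forall>\<^sub>F t in nhds t0. Qit t ** Qt t = mat 1"
      using adapted by eventually_elim (rule orthonormal_basis.coframe_frame[OF adapted_basis.axioms(1)])
  qed simp
  ultimately have "Qi ** (Q ** om - A ** Q) + Z ** Q = 0" by (rule vector_derivative_unique_at)
  then have "Z ** Q = - (Qi ** (Q ** om - A ** Q))"
    by (simp add: eq_neg_iff_add_eq_0 add.commute)
  then have "Z ** Q = (Qi ** A) ** Q - (Qi ** Q) ** om"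
    by (simp add: matrix_diff_ldistrib matrix_mul_assoc)
  then have "Z ** Q ** Qi = ((Qi ** A) ** Q - om) ** Qi" by (simp add: coframe_frame)
  then have "Z = Qi ** A - om ** Qi"
    by (simp add: matrix_diff_rdistrib matrix_mul_assoc[symmetric] frame_coframe)
  then show ?thesis using Z by simp
qed

text \<open>With constant frame components \<open>F0\<close> only the coframe is differentiated. Its
  contribution from \<open>A\<close> cancels the connection term of
  \<open>tractor_form_deriv\<close>, so only the frame connection \<open>om\<close> acts.\<close>

lemma form_deriv_frame:
  assumes F: "\<forall>\<^sub>F t in nhds t0. F t = pull (Qit t) F0"
  shows "tractor_form_deriv G x F t0 As = - pull Qi (form_act om F0) As"
proof -
  have F0: "F t0 = pull Qi F0" using eventually_nhds_x_imp_x[OF F] .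
  have "((\<lambda>s. pull (Qit s) F0 As) has_vector_derivative
     (form_act A (pull Qi F0) As - pull Qi (form_act om F0) As)) (at t0)"
    by (rule has_vector_derivative_pull[OF coframe_derivative refl])
  moreover have "\<forall>\<^sub>F s in nhds t0. F s As = pull (Qit s) F0 As"
    using F by eventually_elim simp
  ultimately have "((\<lambda>s. F s As) has_vector_derivative
     (form_act A (pull Qi F0) As - pull Qi (form_act om F0) As)) (at t0)"
    by (rule has_vector_derivative_cong_nhds[rotated])
  then show ?thesis
    unfolding tractor_form_deriv_def by (simp add: vector_derivative_at form_act_def F0)
qed

lemma normal_form_parallel_iff:
  "(\<forall>As. length As = CARD('n) - 1 \<longrightarrow> tractor_form_deriv G x (normal_form G x) t0 As = 0) \<longleftrightarrow> cc = 0"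
proof -
  have "\<forall>\<^sub>F t in nhds t0. normal_form G x t = pull (Qit t) normal_volume"
    using adapted by eventually_elim (rule adapted_basis.normal_form_frame)
  then have "(\<forall>As. length As = CARD('n) - 1 \<longrightarrow> tractor_form_deriv G x (normal_form G x) t0 As = 0) \<longleftrightarrow>
      (\<forall>As. length As = CARD('n) - 1 \<longrightarrow> form_act om normal_volume As = 0)"
    using pull_eq_0_iff[OF coframe_frame] by (simp add: form_deriv_frame)
  also have "\<dots> \<longleftrightarrow> (\<forall>b\<in>set normal_indices. \<forall>a. a \<notin> set normal_indices \<longrightarrow> om $ b $ a = 0)"
    by (rule form_act_eq_0_iff[OF alternating_normal_volume normal_volume_support length_normal_indices
          distinct_normal_indices _ om_diag]) (simp_all add: normal_volume_normal_indices)
  finally show ?thesis unfolding om_normal_iff .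
qed

lemma star_normal_form_parallel_iff:
  "(\<forall>As. length As = 3 \<longrightarrow> tractor_form_deriv G x (star_normal_form G x) t0 As = 0) \<longleftrightarrow> cc = 0"
proof -
  \<comment> \<open>The component whose sign enters the volume form. It is continuous at
    \<open>t0\<close> and nonzero there, so the sign is constant nearby and can be absorbed into a
    constant form.\<close>
  define f where "f = (\<lambda>t. pull (Qit t) (vol tractor_order) tractor_order)"
  define c where "c = sgn (f t0)"
  have f0: "f t0 \<noteq> 0" unfolding f_def by (rule tractor_volume_frame(1))
  have "f differentiable at t0"
    unfolding f_def by (rule differentiableI_vector[OF has_vector_derivative_pull[OF coframe_derivative refl]])
  then have "(\<lambda>t. c * f t) differentiable at t0" by (intro differentiable_mult differentiable_const)
  moreover have "c * f t0 > 0" using f0 by (simp add: c_def sgn_if)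
  ultimately have "\<forall>\<^sub>F t in nhds t0. c * f t > 0" by (rule eventually_pos)
  then have "\<forall>\<^sub>F t in nhds t0. sgn (f t) = c"
    by eventually_elim (use f0 in \<open>auto simp: c_def sgn_if split: if_splits\<close>)
  with adapted have "\<forall>\<^sub>F t in nhds t0. star_normal_form G x t = pull (Qit t) (\<lambda>As. c * conormal_volume As)"
    by eventually_elim (simp add: adapted_basis.star_normal_form_frame pull_cmult f_def)
  then have "(\<forall>As. length As = 3 \<longrightarrow> tractor_form_deriv G x (star_normal_form G x) t0 As = 0) \<longleftrightarrow>
      (\<forall>As. length As = 3 \<longrightarrow> form_act om (\<lambda>As. c * conormal_volume As) As = 0)"
    using pull_eq_0_iff[OF coframe_frame] by (simp add: form_deriv_frame)
  also have "\<dots> \<longleftrightarrow> (\<forall>b\<in>set conormal_indices. \<forall>a. a \<notin> set conormal_indices \<longrightarrow> om $ b $ a = 0)"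
  proof (rule form_act_eq_0_iff)
    show "alternating_form 3 (\<lambda>As :: 'n tractor_index list. c * conormal_volume As)"
      using alternating_conormal_volume[where 'n='n] by (simp add: alternating_form_def)
    show "c * conormal_volume conormal_indices \<noteq> 0"
      using f0 conormal_volume_nonzero by (simp add: c_def sgn_if)
  qed (auto simp: conormal_volume_support om_diag conormal_indices_def)
  finally show ?thesis unfolding om_conormal_iff .
qed

text \<open>In the frame the projection is a constant diagonal matrix, so its derivative is the
  commutator with \<open>om\<close>.\<close>

lemma normal_proj_parallel_iff:
  "tractor_endo_deriv G x (tractor_normal_proj_matrix G x) t0 = 0 \<longleftrightarrow> cc = 0"
proof -
  let ?P = "normal_diag :: real^('n tractor_index)^('n tractor_index)"
  have ev: "\<forall>\<^sub>F t in nhds t0. tractor_normal_proj_matrix G x t = Qt t ** ?P ** Qit t"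
    using adapted by eventually_elim (rule adapted_basis.tractor_normal_proj_matrix_frame)
  have "((\<lambda>t. Qt t ** ?P ** Qit t) has_vector_derivative
      ((Q ** ?P) ** (Qi ** A - om ** Qi) + (Q ** 0 + (Q ** om - A ** Q) ** ?P) ** Qi)) (at t0)"
    by (intro has_vector_derivative_matrix_matrix_mult frame_derivative coframe_derivative has_vector_derivative_const)
  from has_vector_derivative_cong_nhds[OF ev this]
  have "tractor_endo_deriv G x (tractor_normal_proj_matrix G x) t0 = Q ** (om ** ?P - ?P ** om) ** Qi"
    unfolding tractor_endo_deriv_def eventually_nhds_x_imp_x[OF ev]
    by (simp add: vector_derivative_at matrix_diff_ldistrib matrix_diff_rdistrib matrix_mul_assoc
        matrix_add_ldistrib)
  moreover have "Q ** Z ** Qi = 0 \<longleftrightarrow> Z = 0" for Z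
  proof
    assume "Q ** Z ** Qi = 0"
    then have "Qi ** (Q ** Z ** Qi) ** Q = 0" by simp
    then show "Z = 0" by (simp add: matrix_mul_assoc coframe_frame) (simp add: coframe_frame flip: matrix_mul_assoc)
  qed simp
  \<comment> \<open>Commuting with a coordinate projection kills the diagonal blocks and keeps both
    off-diagonal ones up to sign.\<close>
  moreover have "(om ** ?P - ?P ** om) $ a $ b =
      om $ a $ b * (of_bool (b \<in> set normal_indices) - of_bool (a \<in> set normal_indices))" for a b
  proof -
    have "(om ** ?P) $ a $ b = (\<Sum>c\<in>{b}. om $ a $ c * of_bool (b \<in> set normal_indices))"
      unfolding matrix_matrix_mult_def normal_diag_def vec_lambda_beta
      by (rule sum.mono_neutral_cong_right) auto
    moreover have "(?P ** om) $ a $ b = (\<Sum>c\<in>{a}. of_bool (a \<in> set normal_indices) * om $ c $ b)"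
      unfolding matrix_matrix_mult_def normal_diag_def vec_lambda_beta
      by (rule sum.mono_neutral_cong_right) auto
    ultimately show ?thesis by (simp add: algebra_simps)
  qed
  ultimately have "tractor_endo_deriv G x (tractor_normal_proj_matrix G x) t0 = 0 \<longleftrightarrow>
     (\<forall>a b. (a \<in> set normal_indices) \<noteq> (b \<in> set normal_indices) \<longrightarrow> om $ a $ b = 0)"
    unfolding vec_eq_iff[of _ "0 :: real^('n tractor_index)^('n tractor_index)"] vec_eq_iff[of _ "0 :: real^('n tractor_index)"]
    by (simp add: vec_eq_iff) auto
  also have "\<dots> \<longleftrightarrow> (\<forall>b\<in>set normal_indices. \<forall>a. a \<notin> set normal_indices \<longrightarrow> om $ b $ a = 0) \<and>
      (\<forall>b\<in>set conormal_indices. \<forall>a. a \<notin> set conormal_indices \<longrightarrow> om $ b $ a = 0)"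
    unfolding set_conormal_indices by auto
  finally show ?thesis unfolding om_normal_iff om_conormal_iff by simp
qed

text \<open>The normal frame components of \<open>V\<close> vanish near \<open>t0\<close>;
  differentiating this expresses the normal part of its derivative through \<open>om\<close>. The
  rows \<open>Mid b\<close> have zero entries at \<open>Mid b0\<close> and \<open>Lo\<close>, so
  only the first slot of \<open>V\<close> is left, multiplied by the conformal curvature.\<close>

lemma tractor_second_fund_form_iff:
  assumes V: "V differentiable at t0" "\<forall>\<^sub>F t in nhds t0. V t \<in> normal_tractors_perp G x t"
  shows "tractor_second_fund_form G x V t0 = 0 \<longleftrightarrow> V t0 $ Hi = 0 \<or> cc = 0"
proof -
  define V' where "V' = vector_derivative V (at t0)"
  have V': "(V has_vector_derivative V') (at t0)"
    unfolding V'_def using V(1) by (simp add: vector_derivative_works)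
  have perp: "(Qi *v V t0) $ a = 0" if "a \<in> set normal_indices" for a
    using eventually_nhds_x_imp_x[OF V(2)] that by (simp add: normal_tractors_perp_iff)
  have comp: "(Qi *v (V' + A *v V t0)) $ a = (om *v (Qi *v V t0)) $ a" if a: "a \<in> set normal_indices" for a
  proof -
    have "((\<lambda>t. Qit t *v V t) has_vector_derivative (Qi *v V' + (Qi ** A - om ** Qi) *v V t0)) (at t0)"
      by (rule has_vector_derivative_matrix_vector_mult[OF coframe_derivative V'])
    then have "((\<lambda>t. (Qit t *v V t) $ a) has_vector_derivative (Qi *v V' + (Qi ** A - om ** Qi) *v V t0) $ a) (at t0)"
      by (rule has_vector_derivative_vec_nth)
    moreover have "((\<lambda>t. (Qit t *v V t) $ a) has_vector_derivative 0) (at t0)"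
    proof (rule has_vector_derivative_cong_nhds[where g="\<lambda>t. 0"])
      show "\<forall>\<^sub>F t in nhds t0. (Qit t *v V t) $ a = 0"
        using adapted V(2) by eventually_elim (use a in \<open>simp add: adapted_basis.normal_tractors_perp_iff\<close>)
    qed simp
    ultimately have "(Qi *v V' + (Qi ** A - om ** Qi) *v V t0) $ a = 0" by (rule vector_derivative_unique_at)
    then show ?thesis
      by (simp add: matrix_vector_mult_diff_rdistrib matrix_vector_right_distrib matrix_vector_mul_assoc)
  qed
  have om_V: "(om *v (Qi *v V t0)) $ Mid b = g0 (e t0 b) cc * V t0 $ Hi" if b: "b \<noteq> b0" for b
  proof -
    have "(om *v (Qi *v V t0)) $ Mid b = (\<Sum>a\<in>{Hi :: 'n tractor_index}. g0 (e t0 b) cc * V t0 $ Hi)"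
      unfolding matrix_vector_mult_def[of om] vec_lambda_beta
    proof (rule sum.mono_neutral_cong_right)
      show "\<forall>a\<in>UNIV - {Hi}. om $ Mid b $ a * (Qi *v V t0) $ a = 0"
      proof
        fix a :: "'n tractor_index" assume "a \<in> UNIV - {Hi}"
        then show "om $ Mid b $ a * (Qi *v V t0) $ a = 0"
          using om_entries(5,6)[OF b] perp[of a] by (cases a) (auto simp: set_normal_indices)
      qed
      show "om $ Mid b $ a * (Qi *v V t0) $ a = g0 (e t0 b) cc * V t0 $ Hi" if "a \<in> {Hi}" for a
        using that by (simp add: om_entries(4)[OF b] coframe_mult coframe_row_def inner_tractor)
    qed auto
    then show ?thesis by simp
  qed
  have "tractor_second_fund_form G x V t0 = 0 \<longleftrightarrow> normal_diag *v (Qi *v (V' + A *v V t0)) = 0"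
    unfolding tractor_second_fund_form_def tractor_normal_proj_frame tractor_deriv_def
      V'_def[symmetric] tractor_conn_matrix_mult[symmetric]
    by (metis frame_coframe_vec(2) matrix_vector_mult_0_right)
  also have "\<dots> \<longleftrightarrow> (\<forall>a\<in>set normal_indices. (om *v (Qi *v V t0)) $ a = 0)"
    by (auto simp: vec_eq_iff normal_diag_mult comp)
  also have "\<dots> \<longleftrightarrow> (\<forall>b. b \<noteq> b0 \<longrightarrow> g0 (e t0 b) cc * V t0 $ Hi = 0)"
    using om_V by (auto simp: set_normal_indices)
  finally show ?thesis unfolding conformal_curvature_eq_0_iff by auto
qed

end

context curve_in_metric
begin

lemma obtain_moving_frame:
  assumes "t \<in> T" "CARD('n) \<ge> 2"
  obtains e where "moving_frame G U x T t e"
proof -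
  from exists_moving_frame[OF assms] obtain e :: "real \<Rightarrow> 'n \<Rightarrow> real^'n" where
    "\<And>b. (\<lambda>t. e t b) differentiable at t" "\<forall>\<^sub>F s in nhds t. adapted_basis G x s (e s)"
    by (auto simp: eventually_conj_iff)
  then have "moving_frame G U x T t e"
    using assms(1) by unfold_locales auto
  then show thesis by (rule that)
qed

end

section \<open>An invariant test section, and its behaviour under change of scale\<close>

section \<open>The acceleration tractor\<close>

text \<open>
  The null tractor with first slot \<open>|u|\<close> and middle slot as below is conformally invariant.  It is a
  section of the orthogonal complement of the normal tractor bundle whose first slot has no zeros,
  so that the tractor second fundamental form, which maps it to a multiple of the conformal
  curvature by \<open>|u|\<close>, detects the latter.
\<close>

definition acceleration_vector ::
  "(real^'n \<Rightarrow> real^'n^'n::finite) \<Rightarrow> (real \<Rightarrow> real^'n) \<Rightarrow> real \<Rightarrow> real^'n" where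
  "acceleration_vector G x t = (let u = velocity x t; a = acceleration G x t; ip = bilin (G (x t)); s = sqrt (ip u u)
    in (2 * ip u a / s ^ 3) *\<^sub>R u - (1 / s) *\<^sub>R a)"

text \<open>The first two slots are minus those of the second tractor derivative along the curve of
  \<open>(0, 0, 1/|u|)\<close>. The last slot is chosen to make the tractor null.\<close>

definition acceleration_tractor ::
  "(real^'n \<Rightarrow> real^'n^'n::finite) \<Rightarrow> (real \<Rightarrow> real^'n) \<Rightarrow> real \<Rightarrow> 'n tractor" where
  "acceleration_tractor G x t = (let s = sqrt (bilin (G (x t)) (velocity x t) (velocity x t)); m = acceleration_vector G x t
    in tractor s (G (x t) *v m) (- (bilin (G (x t)) m m / (2 * s))))"

lemma smooth_on_tractor [smooth_intros]:
  assumes "open S" "smooth_on S \<sigma>" "smooth_on S \<mu>" "smooth_on S \<rho>"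
  shows "smooth_on S (\<lambda>t. tractor (\<sigma> t) (\<mu> t) (\<rho> t))"
proof -
  have "smooth_on S (\<lambda>t. case A of Hi \<Rightarrow> \<sigma> t | Mid a \<Rightarrow> \<mu> t $ a | Lo \<Rightarrow> \<rho> t)" for A
    by (cases A) (auto intro!: smooth_intros assms)
  then show ?thesis unfolding tractor_def by (intro smooth_intros assms(1))
qed

context curve_in_metric
begin

lemma smooth_acceleration_tractor: "smooth_on T (acceleration_tractor G x)"
proof -
  have s: "sqrt (ip t (u t) (u t)) ^ 3 = ip t (u t) (u t) * sqrt (ip t (u t) (u t))" if "t \<in> T" for t
    using speed_pos[OF that] by (simp add: power3_eq_cube)
  have "smooth_on T (\<lambda>t. (2 * ip t (u t) (acceleration G x t) / (ip t (u t) (u t) * sqrt (ip t (u t) (u t)))) *\<^sub>R u t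
      - (1 / sqrt (ip t (u t) (u t))) *\<^sub>R acceleration G x t)"
    using speed_pos by (intro smooth_intros open_T smooth_ip smooth_u smooth_acceleration) force+
  then have m: "smooth_on T (acceleration_vector G x)"
    by (rule smooth_on_cong[OF open_T, rotated]) (simp add: acceleration_vector_def Let_def s)
  show ?thesis
    unfolding acceleration_tractor_def[abs_def] Let_def
    using speed_pos by (intro smooth_intros open_T smooth_ip smooth_u m smooth_along smooth_G) force+
qed

text \<open>The normal part of \<open>acceleration_vector\<close> is \<open>-|u| H\<close>. Paired
  with a normal tractor it cancels the product of the first slot \<open>|u|\<close> with the third
  slot \<open>g(v,H)\<close>.\<close>

lemma acceleration_tractor_perp:
  assumes t: "t \<in> T"
  shows "acceleration_tractor G x t \<in> normal_tractors_perp G x t"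
  unfolding normal_tractors_perp_def
proof (intro CollectI ballI)
  fix W assume "W \<in> normal_tractors G x t"
  then obtain v where v: "ip t v (u t) = 0" and W: "W = normal_tractor G x t v"
    by (auto simp: normal_tractors_def normal_space_def)
  let ?s = "sqrt (ip t (u t) (u t))" and ?m = "acceleration_vector G x t"
  have s: "?s > 0" "ip t (u t) (u t) = ?s * ?s" using speed_pos[OF t] by simp_all
  have "ip t v (acceleration G x t) = ip t (u t) (u t) * ip t v (H t)"
    by (subst acceleration_eq[OF t]) (simp add: bilin_simps v)
  then have "ip t v ?m = - ?s * ip t v (H t)"
    unfolding acceleration_vector_def Let_def bilin_simps v using s by (simp add: field_simps)
  moreover have "bilin (tractor_metric (G (x t))) (acceleration_tractor G x t) W = ?s * ip t v (H t) + ip t v ?m"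
    unfolding W bilin_def[of "tractor_metric (G (x t))"] tractor_metric_mult
    by (simp add: acceleration_tractor_def normal_tractor_def Let_def inner_tractor matrix_vector_mul_assoc
        spd_matrix_inv[OF spd_x[OF t]] inner_commute[of _ v] flip: bilin_def)
  ultimately show "bilin (tractor_metric (G (x t))) (acceleration_tractor G x t) W = 0" by simp
qed

lemma acceleration_tractor_Hi: "t \<in> T \<Longrightarrow> acceleration_tractor G x t $ Hi > 0"
  using speed_pos by (simp add: acceleration_tractor_def Let_def)

end

section \<open>Conformal rescaling\<close>

locale conformal_change = curve_in_metric G U x T
  for G :: "real^'n::finite \<Rightarrow> real^'n^'n" and U x T +
  fixes G' :: "real^'n \<Rightarrow> real^'n^'n" and w :: "real^'n \<Rightarrow> real"
  assumes smooth_w: "smooth_on U w" and w_pos: "\<And>y. y \<in> U \<Longrightarrow> w y > 0"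
    and G': "\<And>y. y \<in> U \<Longrightarrow> G' y = (w y)\<^sup>2 *\<^sub>R G y"
begin

definition "Y y = (\<chi> a. pderiv_at a w y / w y)"
definition "Ys y = matrix_inv (G y) *v Y y"

lemma bilin_G': "y \<in> U \<Longrightarrow> bilin (G' y) v v' = (w y)\<^sup>2 * bilin (G y) v v'"
  by (simp add: G' bilin_def flip: scaleR_matrix_vector_assoc)

lemma matrix_inv_G':
  assumes y: "y \<in> U"
  shows "matrix_inv (G' y) = (1 / (w y)\<^sup>2) *\<^sub>R matrix_inv (G y)"
proof (rule matrix_inv_eqI)
  have "G' y ** ((1 / (w y)\<^sup>2) *\<^sub>R matrix_inv (G y)) = G y ** matrix_inv (G y)"
    using w_pos[OF y] by (simp add: G'[OF y] vec_eq_iff matrix_matrix_mult_def)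
  then show "G' y ** ((1 / (w y)\<^sup>2) *\<^sub>R matrix_inv (G y)) = mat 1"
    by (simp add: spd_matrix_inv[OF spd_G[OF y]])
qed

lemma pderiv_at_G':
  assumes y: "y \<in> U"
  shows "pderiv_at a (\<lambda>z. G' z $ b $ c) y
    = (w y)\<^sup>2 * (pderiv_at a (\<lambda>z. G z $ b $ c) y + 2 * Y y $ a * G y $ b $ c)"
proof -
  let ?f = "\<lambda>z. G z $ b $ c"
  have s: "smooth_on U ?f" by (intro smooth_intros open_U smooth_G)
  note dw = smooth_on_has_derivative[OF smooth_w y] and df = smooth_on_has_derivative[OF s y]
  have "((\<lambda>z. w z * w z * ?f z) has_derivative (\<lambda>v. w y * w y * frechet_derivative ?f (at y) v
      + (w y * frechet_derivative w (at y) v + frechet_derivative w (at y) v * w y) * ?f y)) (at y)"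
    by (intro has_derivative_mult dw df)
  then have "((\<lambda>z. G' z $ b $ c) has_derivative (\<lambda>v. w y * w y * frechet_derivative ?f (at y) v
      + (w y * frechet_derivative w (at y) v + frechet_derivative w (at y) v * w y) * ?f y)) (at y)"
    by (rule has_derivative_transform_within_open[OF _ open_U y]) (simp add: G' power2_eq_square)
  from frechet_derivative_at[OF this, symmetric] show ?thesis
    using w_pos[OF y] by (simp add: pderiv_at_def Y_def power2_eq_square field_simps)
qed

lemma christoffel_G':
  assumes y: "y \<in> U"
  shows "christoffel G' y c a b = christoffel G y c a b
    + of_bool (c = b) * Y y $ a + of_bool (c = a) * Y y $ b - G y $ a $ b * Ys y $ c"
proof -
  let ?i = "matrix_inv (G y)"
  let ?d = "\<lambda>d. pderiv_at a (\<lambda>z. G z $ b $ d) y + pderiv_at b (\<lambda>z. G z $ a $ d) y - pderiv_at d (\<lambda>z. G z $ a $ b) y"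
  have inv: "(\<Sum>d\<in>UNIV. ?i $ c $ d * G y $ e $ d) = of_bool (c = e)" for e
  proof -
    have "(?i ** G y) $ c $ e = mat 1 $ c $ e" by (simp add: spd_matrix_inv[OF spd_G[OF y]])
    then show ?thesis by (simp add: matrix_matrix_mult_def mat_def spd_nth[OF spd_G[OF y], of e])
  qed
  have "christoffel G' y c a b = (1/2) * (\<Sum>d\<in>UNIV. ?i $ c $ d * ?d d
      + 2 * (Y y $ a * (?i $ c $ d * G y $ b $ d) + Y y $ b * (?i $ c $ d * G y $ a $ d) - G y $ a $ b * (?i $ c $ d * Y y $ d)))"
    unfolding christoffel_def matrix_inv_G'[OF y] pderiv_at_G'[OF y] using w_pos[OF y]
    by (intro arg_cong2[where f="(*)"] sum.cong refl) (simp add: field_simps)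
  also have "\<dots> = christoffel G y c a b + Y y $ a * (\<Sum>d\<in>UNIV. ?i $ c $ d * G y $ b $ d)
      + Y y $ b * (\<Sum>d\<in>UNIV. ?i $ c $ d * G y $ a $ d) - G y $ a $ b * (\<Sum>d\<in>UNIV. ?i $ c $ d * Y y $ d)"
    unfolding christoffel_def by (simp add: sum.distrib sum_subtractf sum_distrib_left algebra_simps)
  finally show ?thesis unfolding inv Ys_def by (simp add: matrix_vector_mult_def mult.commute)
qed

lemma acceleration_G':
  assumes t: "t \<in> T"
  shows "acceleration G' x t = acceleration G x t + (2 * (Y (x t) \<bullet> u t)) *\<^sub>R u t - ip t (u t) (u t) *\<^sub>R Ys (x t)"
proof -
  note y = x_in_U[OF t]
  have "(\<Sum>a\<in>UNIV. \<Sum>b\<in>UNIV. christoffel G' (x t) c a b * u t $ a * u t $ b)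
     = (\<Sum>a\<in>UNIV. \<Sum>b\<in>UNIV. christoffel G (x t) c a b * u t $ a * u t $ b)
       + 2 * (Y (x t) \<bullet> u t) * u t $ c - ip t (u t) (u t) * Ys (x t) $ c" for c
  proof -
    have 1: "(\<Sum>a\<in>UNIV. \<Sum>b\<in>UNIV. of_bool (c = b) * Y (x t) $ a * u t $ a * u t $ b) = (Y (x t) \<bullet> u t) * u t $ c"
    proof -
      have "(\<Sum>b\<in>UNIV. of_bool (c = b) * Y (x t) $ a * u t $ a * u t $ b) = (\<Sum>b\<in>{c}. Y (x t) $ a * u t $ a * u t $ b)" for a
        by (rule sum.mono_neutral_cong_right) auto
      then show ?thesis by (simp add: inner_vec_def sum_distrib_right)
    qed
    have 2: "(\<Sum>a\<in>UNIV. \<Sum>b\<in>UNIV. of_bool (c = a) * Y (x t) $ b * u t $ a * u t $ b) = (Y (x t) \<bullet> u t) * u t $ c"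
      using 1 by (subst sum.swap) (simp add: mult_ac)
    have 3: "(\<Sum>a\<in>UNIV. \<Sum>b\<in>UNIV. G (x t) $ a $ b * Ys (x t) $ c * u t $ a * u t $ b) = ip t (u t) (u t) * Ys (x t) $ c"
      by (simp add: bilin_def inner_vec_def matrix_vector_mult_def sum_distrib_left sum_distrib_right mult_ac)
    show ?thesis
      unfolding christoffel_G'[OF y] distrib_right left_diff_distrib sum.distrib sum_subtractf 1 2 3 by simp
  qed
  then show ?thesis
    by (simp add: acceleration_def cov_deriv_def vec_eq_iff)
qed

text \<open>The acceleration gains \<open>2 Y(u) u - |u|^2 Ys\<close> and its product with the
  velocity gains \<open>Y(u) |u|^2\<close>, apart from the scale factor. With the coefficient 2 in
  \<open>acceleration_vector\<close> all multiples of \<open>u\<close> cancel, leaving the shift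
  \<open>|u| Ys\<close> that the transformation law demands.\<close>

lemma acceleration_tractor_G':
  assumes t: "t \<in> T"
  shows "acceleration_tractor G' x t = tractor_rescale (G (x t)) (w (x t)) (Y (x t)) (acceleration_tractor G x t)"
proof -
  define s where "s = sqrt (ip t (u t) (u t))"
  define a where "a = acceleration G x t"
  define m where "m = acceleration_vector G x t"
  let ?w = "w (x t)" and ?Y = "Y (x t)" and ?Ys = "Ys (x t)" and ?g = "G (x t)"
  note y = x_in_U[OF t]
  have wp: "?w > 0" using w_pos[OF y] .
  have sp: "s > 0" "ip t (u t) (u t) = s * s" using speed_pos[OF t] by (simp_all add: s_def)
  have gYs: "?g *v ?Ys = ?Y"
    by (simp add: Ys_def matrix_vector_mul_assoc spd_matrix_inv[OF spd_x[OF t]])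
  have Yv: "ip t v ?Ys = ?Y \<bullet> v" for v by (simp add: bilin_def gYs inner_commute)
  have Yv': "ip t ?Ys v = ?Y \<bullet> v" for v
    using Yv[of v] ip_commute[OF t, of ?Ys v] by simp
  have s': "sqrt (bilin (G' (x t)) (u t) (u t)) = ?w * s"
    unfolding bilin_G'[OF y] real_sqrt_mult s_def using wp by simp
  have m_def': "m = (2 * ip t (u t) a / s ^ 3) *\<^sub>R u t - (1 / s) *\<^sub>R a"
    by (simp add: m_def acceleration_vector_def Let_def s_def a_def)
  have m': "acceleration_vector G' x t = (1 / ?w) *\<^sub>R (m + s *\<^sub>R ?Ys)"
  proof -
    have c: "2 * bilin (G' (x t)) (u t) (acceleration G' x t) / (?w * s) ^ 3
        = (1 / ?w) * (2 * ip t (u t) a / s ^ 3 + 2 * (?Y \<bullet> u t) / s)"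
      unfolding bilin_G'[OF y] acceleration_G'[OF t] bilin_simps Yv sp(2) a_def[symmetric]
      using wp sp(1) by (simp add: field_simps power2_eq_square power3_eq_cube)
    show ?thesis
      unfolding acceleration_vector_def Let_def s' c
      unfolding acceleration_G'[OF t] m_def' a_def[symmetric] sp(2)
      using wp sp(1) by (simp add: vec_eq_iff field_simps)
  qed
  have V: "acceleration_tractor G x t = tractor s (?g *v m) (- (ip t m m / (2 * s)))"
    by (simp add: acceleration_tractor_def Let_def s_def m_def)
  have "acceleration_tractor G' x t = tractor (?w * s) (G' (x t) *v ((1 / ?w) *\<^sub>R (m + s *\<^sub>R ?Ys)))
      (- (bilin (G' (x t)) ((1 / ?w) *\<^sub>R (m + s *\<^sub>R ?Ys)) ((1 / ?w) *\<^sub>R (m + s *\<^sub>R ?Ys)) / (2 * (?w * s))))"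
    unfolding acceleration_tractor_def Let_def s' m' ..
  also have "G' (x t) *v ((1 / ?w) *\<^sub>R (m + s *\<^sub>R ?Ys)) = ?w *\<^sub>R (?g *v m + s *\<^sub>R ?Y)"
    unfolding G'[OF y] using wp
    by (simp add: matrix_vector_mult_scaleR matrix_vector_right_distrib gYs power2_eq_square
        flip: scaleR_matrix_vector_assoc) (simp add: vec_eq_iff field_simps)
  also have "- (bilin (G' (x t)) ((1 / ?w) *\<^sub>R (m + s *\<^sub>R ?Ys)) ((1 / ?w) *\<^sub>R (m + s *\<^sub>R ?Ys)) / (2 * (?w * s)))
     = (- (ip t m m / (2 * s)) - ?Y \<bullet> m - 1/2 * (?Y \<bullet> ?Ys) * s) / ?w"
    unfolding bilin_G'[OF y] bilin_simps Yv Yv' using wp sp(1)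
    by (simp add: field_simps power2_eq_square)
  also have "?Y \<bullet> ?Ys = bilin (matrix_inv ?g) ?Y ?Y" by (simp add: bilin_def Ys_def)
  also have "?Y \<bullet> m = bilin (matrix_inv ?g) ?Y (?g *v m)"
    by (simp add: bilin_def matrix_vector_mul_assoc spd_matrix_inv[OF spd_x[OF t]])
  finally show ?thesis by (simp add: V tractor_rescale_def)
qed

end

section \<open>From one chart and scale to the curve in the conformal manifold\<close>

section \<open>Conformal circles\<close>

lemma conformal_class_riemannian:
  assumes "conformal_class A C" "g \<in> C"
  shows "riemannian_metric A g"
  using assms by (auto simp: conformal_class_def quotient_def conformal_rel_def)

lemma curve_in_metric_of_chart:
  assumes A: "oriented_atlas A" and C: "conformal_class A C" and \<Gamma>: "oriented_embedded_curve A \<gamma> \<Gamma>"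
    and \<kappa>: "\<kappa> \<in> A" and g: "g \<in> C" and \<pi>: "\<pi> \<in> \<Gamma>"
  shows "curve_in_metric (g \<kappa>) (coord_region \<kappa>) (coord_curve \<kappa> \<pi>) (param_domain \<kappa> \<pi>)"
proof -
  have lp: "local_param A \<gamma> \<pi>" using \<Gamma> \<pi> by (simp add: oriented_embedded_curve_def)
  have r: "riemannian_metric A g" by (rule conformal_class_riemannian[OF C g])
  show ?thesis
  proof
    show "open (coord_region \<kappa>)" using A \<kappa> by (simp add: oriented_atlas_def)
    show "smooth_on (coord_region \<kappa>) (g \<kappa>)" using r \<kappa> by (simp add: riemannian_metric_def)
    show "spd (g \<kappa> y)" if "y \<in> coord_region \<kappa>" for y
      using r \<kappa> that by (simp add: riemannian_metric_def spd_def bilin_def)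
    have "open (fst \<kappa>)" using A \<kappa> by (simp add: oriented_atlas_def)
    moreover have "open (fst \<pi>)" "continuous_on (fst \<pi>) (snd \<pi>)"
      using lp by (auto simp: local_param_def homeomorphism_def)
    ultimately have "open (fst \<pi> \<inter> snd \<pi> -` fst \<kappa>)" by (intro continuous_open_preimage)
    moreover have "param_domain \<kappa> \<pi> = fst \<pi> \<inter> snd \<pi> -` fst \<kappa>" by (auto simp: param_domain_def)
    ultimately show "open (param_domain \<kappa> \<pi>)" by simp
    show "smooth_on (param_domain \<kappa> \<pi>) (coord_curve \<kappa> \<pi>)"
      "\<And>t. t \<in> param_domain \<kappa> \<pi> \<Longrightarrow> velocity (coord_curve \<kappa> \<pi>) t \<noteq> 0"
      using lp \<kappa> by (auto simp: local_param_def)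
    show "coord_curve \<kappa> \<pi> t \<in> coord_region \<kappa>" if "t \<in> param_domain \<kappa> \<pi>" for t
      using that by (auto simp: param_domain_def coord_curve_def coord_region_def)
  qed
qed

lemma tractor_section_acceleration_tractor:
  assumes A: "oriented_atlas A" and C: "conformal_class A C" and \<Gamma>: "oriented_embedded_curve A \<gamma> \<Gamma>"
    and \<kappa>: "\<kappa> \<in> A" and \<pi>: "\<pi> \<in> \<Gamma>"
  shows "tractor_section A C \<kappa> \<pi> (\<lambda>g. acceleration_tractor (g \<kappa>) (coord_curve \<kappa> \<pi>))"
  unfolding tractor_section_def
proof (intro conjI ballI allI impI)
  fix g assume g: "g \<in> C"
  interpret curve_in_metric "g \<kappa>" "coord_region \<kappa>" "coord_curve \<kappa> \<pi>" "param_domain \<kappa> \<pi>"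
    by (rule curve_in_metric_of_chart[OF A C \<Gamma> \<kappa> g \<pi>])
  show "smooth_on (param_domain \<kappa> \<pi>) (acceleration_tractor (g \<kappa>) (coord_curve \<kappa> \<pi>))"
    by (rule smooth_acceleration_tractor)
  fix g' \<Omega> t assume g': "g' \<in> C" and \<Omega>: "rescaled_by A \<Omega> g g'" and t: "t \<in> param_domain \<kappa> \<pi>"
  interpret conformal_change "g \<kappa>" "coord_region \<kappa>" "coord_curve \<kappa> \<pi>" "param_domain \<kappa> \<pi>" "g' \<kappa>" "\<Omega> \<circ> chart_inv \<kappa>"
    by unfold_locales (use \<Omega> \<kappa> in \<open>auto simp: rescaled_by_def conformal_factor_def\<close>)
  \<comment> \<open>The transformation law evaluates \<open>\<Omega>\<close> at the point of the
    curve, the preceding lemma evaluates \<open>\<Omega> \<circ> chart_inv \<kappa>\<close> at its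
    coordinates; inverting the chart identifies the two.\<close>
  have "homeomorphism (fst \<kappa>) (coord_region \<kappa>) (snd \<kappa>) (chart_inv \<kappa>)"
    using A \<kappa> by (simp add: oriented_atlas_def)
  moreover have "snd \<pi> t \<in> fst \<kappa>" using t by (simp add: param_domain_def)
  ultimately have "chart_inv \<kappa> (coord_curve \<kappa> \<pi> t) = snd \<pi> t"
    by (simp add: homeomorphism_def coord_curve_def)
  moreover have "Y (coord_curve \<kappa> \<pi> t) = upsilon \<kappa> \<Omega> (coord_curve \<kappa> \<pi> t)"
    by (simp add: Y_def upsilon_def)
  ultimately show "acceleration_tractor (g' \<kappa>) (coord_curve \<kappa> \<pi>) t =
      tractor_rescale (g \<kappa> (coord_curve \<kappa> \<pi> t)) (\<Omega> (snd \<pi> t)) (upsilon \<kappa> \<Omega> (coord_curve \<kappa> \<pi> t))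
        (acceleration_tractor (g \<kappa>) (coord_curve \<kappa> \<pi>) t)"
    using acceleration_tractor_G'[OF t] by simp
qed

text \<open>Every condition is compared with the vanishing of the conformal curvature. Four of them
  match it point by point; the second fundamental form does not, since it is a condition on
  sections.\<close>

theorem theorem1p2:
  fixes A :: "('a::{t2_space, second_countable_topology}, 'n::finite) chart set"
    and C :: "('a, 'n) metric set"
    and \<gamma> :: "'a set"
    and \<Gamma> :: "'a param set"
  assumes "CARD('n) \<ge> 3"
    and "connected (UNIV :: 'a set)"
    and "oriented_atlas A"
    and "conformal_class A C"
    and "oriented_embedded_curve A \<gamma> \<Gamma>"
  shows "(unparametrised_conformal_circle A C \<Gamma> \<longleftrightarrow> tractor_second_fund_form_vanishes A C \<Gamma>) \<and>
    (unparametrised_conformal_circle A C \<Gamma> \<longleftrightarrow> normal_proj_parallel A C \<Gamma>) \<and>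
    (unparametrised_conformal_circle A C \<Gamma> \<longleftrightarrow> normal_form_parallel A C \<Gamma>) \<and>
    (unparametrised_conformal_circle A C \<Gamma> \<longleftrightarrow> star_normal_form_parallel A C \<Gamma>) \<and>
    (tractor_second_fund_form_vanishes A C \<Gamma> \<longleftrightarrow> conformal_curvature_vanishes A C \<Gamma>)"
proof -
  note cim = curve_in_metric_of_chart[OF assms(3-5)]
  have n: "2 \<le> CARD('n)" using assms(1) by simp
  have along: "holds_along A C \<Gamma> \<Phi> \<longleftrightarrow> conformal_curvature_vanishes A C \<Gamma>"
    if "\<And>G U x T t. curve_in_metric G U x T \<Longrightarrow> t \<in> T \<Longrightarrow> \<Phi> G x t \<longleftrightarrow> conformal_curvature G x t = 0" for \<Phi>
    unfolding conformal_curvature_vanishes_def holds_along_def using that[OF cim] by blast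
  have frame: "\<exists>e. moving_frame G U x T t e" if "curve_in_metric G U x T" "t \<in> T"
    for G :: "real^'n \<Rightarrow> real^'n^'n" and U x T t
    using curve_in_metric.obtain_moving_frame[OF that n] by blast
  have circle: "unparametrised_conformal_circle A C \<Gamma> \<longleftrightarrow> conformal_curvature_vanishes A C \<Gamma>"
    unfolding unparametrised_conformal_circle_def
    by (rule along) (rule curve_in_metric.circle_iff_conformal_curvature)
  have proj: "normal_proj_parallel A C \<Gamma> \<longleftrightarrow> conformal_curvature_vanishes A C \<Gamma>"
    unfolding normal_proj_parallel_def
    by (rule along) (meson frame moving_frame.normal_proj_parallel_iff)
  have form: "normal_form_parallel A C \<Gamma> \<longleftrightarrow> conformal_curvature_vanishes A C \<Gamma>"
    unfolding normal_form_parallel_def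
    by (rule along) (meson frame moving_frame.normal_form_parallel_iff)
  have star: "star_normal_form_parallel A C \<Gamma> \<longleftrightarrow> conformal_curvature_vanishes A C \<Gamma>"
    unfolding star_normal_form_parallel_def
    by (rule along) (meson frame moving_frame.star_normal_form_parallel_iff)
  \<comment> \<open>For one section the second fundamental form sees the curvature only where the
    first slot is nonzero, hence the disjunction.\<close>
  have second: "tractor_second_fund_form G x V t = 0 \<longleftrightarrow> V t $ Hi = 0 \<or> conformal_curvature G x t = 0"
    if c: "curve_in_metric G U x T" "t \<in> T" and V: "smooth_on T V" "\<And>t. t \<in> T \<Longrightarrow> V t \<in> normal_tractors_perp G x t"
    for G :: "real^'n \<Rightarrow> real^'n^'n" and U x T t V
  proof -
    interpret curve_in_metric G U x T by (rule c(1))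
    obtain e where "moving_frame G U x T t e" using frame[OF c] by blast
    moreover have "V differentiable at t" by (rule smooth_differentiable[OF V(1) c(2)])
    moreover have "\<forall>\<^sub>F s in nhds t. V s \<in> normal_tractors_perp G x s"
      using eventually_T[OF c(2)] by eventually_elim (rule V(2))
    ultimately show ?thesis by (rule moving_frame.tractor_second_fund_form_iff)
  qed
  have L: "tractor_second_fund_form_vanishes A C \<Gamma> \<longleftrightarrow> conformal_curvature_vanishes A C \<Gamma>"
  proof
    assume L: "tractor_second_fund_form_vanishes A C \<Gamma>"
    show "conformal_curvature_vanishes A C \<Gamma>"
      unfolding conformal_curvature_vanishes_def holds_along_def
    proof (intro ballI)
      fix \<kappa> g \<pi> t assume \<kappa>: "\<kappa> \<in> A" and g: "g \<in> C" and \<pi>: "\<pi> \<in> \<Gamma>" and t: "t \<in> param_domain \<kappa> \<pi>"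
      \<comment> \<open>The first slot of this section is the speed, so the disjunction above leaves
        only the curvature.\<close>
      let ?V = "\<lambda>g. acceleration_tractor (g \<kappa>) (coord_curve \<kappa> \<pi>)"
      have perp: "?V g t \<in> normal_tractors_perp (g \<kappa>) (coord_curve \<kappa> \<pi>) t" if "g \<in> C" "t \<in> param_domain \<kappa> \<pi>" for g t
        by (rule curve_in_metric.acceleration_tractor_perp[OF cim[OF \<kappa> that(1) \<pi>] that(2)])
      have sec: "tractor_section A C \<kappa> \<pi> ?V"
        by (rule tractor_section_acceleration_tractor[OF assms(3-5) \<kappa> \<pi>])
      have "tractor_second_fund_form (g \<kappa>) (coord_curve \<kappa> \<pi>) (?V g) t = 0"
        using L[unfolded tractor_second_fund_form_vanishes_def, rule_format, OF \<kappa> \<pi> _ g t, of ?V] sec perp by blast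
      moreover have "?V g t $ Hi > 0"
        by (rule curve_in_metric.acceleration_tractor_Hi[OF cim[OF \<kappa> g \<pi>] t])
      ultimately show "conformal_curvature (g \<kappa>) (coord_curve \<kappa> \<pi>) t = 0"
        using second[OF cim[OF \<kappa> g \<pi>] t curve_in_metric.smooth_acceleration_tractor[OF cim[OF \<kappa> g \<pi>]] perp[OF g]]
        by simp
    qed
  next
    assume cc: "conformal_curvature_vanishes A C \<Gamma>"
    show "tractor_second_fund_form_vanishes A C \<Gamma>"
      unfolding tractor_second_fund_form_vanishes_def
    proof (intro ballI allI impI)
      fix \<kappa> \<pi> V g t
      assume \<kappa>: "\<kappa> \<in> A" and \<pi>: "\<pi> \<in> \<Gamma>" and g: "g \<in> C" and t: "t \<in> param_domain \<kappa> \<pi>"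
        and V: "tractor_section A C \<kappa> \<pi> V \<and>
          (\<forall>g\<in>C. \<forall>t\<in>param_domain \<kappa> \<pi>. V g t \<in> normal_tractors_perp (g \<kappa>) (coord_curve \<kappa> \<pi>) t)"
      have "smooth_on (param_domain \<kappa> \<pi>) (V g)" using V g by (simp add: tractor_section_def)
      moreover have "V g t \<in> normal_tractors_perp (g \<kappa>) (coord_curve \<kappa> \<pi>) t" if "t \<in> param_domain \<kappa> \<pi>" for t
        using V g that by blast
      moreover have "conformal_curvature (g \<kappa>) (coord_curve \<kappa> \<pi>) t = 0"
        using cc \<kappa> g \<pi> t by (simp add: conformal_curvature_vanishes_def holds_along_def)
      ultimately show "tractor_second_fund_form (g \<kappa>) (coord_curve \<kappa> \<pi>) (V g) t = 0"
        using second[OF cim[OF \<kappa> g \<pi>] t] by blast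
    qed
  qed
  show ?thesis unfolding circle proj form star L by simp
qed

end
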